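(* Let $\mathcal M$ be a manifold of bounded geometry, let $s>0$ satisfy the bounded geometry conditions for $\mathcal M$, let $H$ be a separable infinite-dimensional Hilbert space, and let $\mathcal P:\mathcal M\to\mathcal L(H)$ be a strongly differentiable map with $\mathcal P(x)$ an orthogonal projection for each $x$ and $\sup_{x\in\mathcal M}\|(d\mathcal P)(x)\|_\infty<\infty$. Let $r\in(0,s)$ be such that $$4r\cdot\sup_{x\in\mathcal M}\|g_{\phi_{x,s}}\|_\infty^{1/2}\cdot\sup_{x\in\mathcal M}\|(d\mathcal P)(x)\|_\infty<1,$$ and write $U_x:=U_{x,r}$. Then the topological Hausdorff space $\mathrm{Im}(P)=\coprod_{x\in\mathcal M}\mathcal P(x)H$, the continuous surjective map $\pi:\mathrm{Im}(P)\to\mathcal M$, and the local trivializations $\psi_x:\mathrm{Im}(P)|_{U_x}\to U_x\times\mathcal P(x)H$, $\psi_x(\xi)=(y,W_x(y)^*\xi)$ for $\xi\in\mathcal P(y)H$, give $\mathrm{Im}(P)$ the structure of a Hilbert bundle of bounded geometry.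
   Context: Manifolds are smooth, connected, second countable, Hausdorff, of finite dimension $N$; $T^*\mathcal M$ is the complexified cotangent bundle with the hermitian inner products induced by the metric. A smooth Riemannian manifold $\mathcal M$ is of bounded geometry if there is $s>0$ satisfying the bounded geometry conditions: (1) for all $x$, $\exp_x:B_s(0)\to U_{x,s}$ is a diffeomorphism from the open $s$-ball of the real tangent space onto an open set $U_{x,s}$; (2) there is $C>0$ such that for all $x$ the normal chart $\phi_{x,s}:U_{x,s}\to B_s(0)\subset\mathbb R^N$ (inverse of $\exp_x$ composed with an orthonormal basis) satisfies $\sup_y\|d\phi_{x,s}(y)\|_\infty\le C$, $\sup_v\|d\phi_{x,s}^{-1}(v)\|_\infty\le C$. For $0<r<s$, $U_{x,r}=\exp_x(B_r(0))$. $(g_\phi)_{ij}=\langle\frac{\partial}{\partial\phi_i},\frac{\partial}{\partial\phi_j}\rangle$ and $\|g_{\phi_{x,s}}\|_\infty=\sup_{y\in U_{x,s}}\|g_{\phi_{x,s}}(y)\|_\infty$ (operator norm). A map $f:U\to\mathcal L(E,F)$ is strongly differentiable if $y\mapsto f(y)\xi$ is $C^1$ for every $\xi\in E$; $(df)(y):E\to F\otimes T_y^*\mathcal M$, $\xi\mapsto d(f(\cdot)\xi)(y)$. $\pi:\mathrm{Im}(P)\to\mathcal M$ maps $\xi\in\mathcal P(x)H$ to $x$. For $y\in U_x$, $W_x(y):=\mathcal P(y)(\mathcal P(x)\mathcal P(y)\mathcal P(x))^{-1/2}:\mathcal P(x)H\to\mathcal P(y)H$ (the inverse square root taken on $\mathcal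 P(x)H$), which is a well-defined unitary. The topology on $\mathrm{Im}(P)$ is generated by the basis of those sets $V$ such that for some $x\in\mathcal M$, $\pi(V)\subset U_x$ and $\psi_x(V)\subset U_x\times\mathcal P(x)H$ is open. A Hilbert bundle of bounded geometry (for a fixed $r$ satisfying the bounded geometry conditions, $U_x=U_{x,r}$) consists of a Hausdorff space $\mathcal H$, a continuous surjection $\pi:\mathcal H\to\mathcal M$, and fibre-preserving homeomorphisms $\psi_x:\pi^{-1}(U_x)\to U_x\times E$, $x\in\mathcal M$, with $E$ a separable Hilbert space, such that the transition maps $\tau_{x,y}:=\psi_x\psi_y^{-1}$ on $U_x\cap U_y$ are strongly differentiable with unitary values and $\sup_{x,y\in\mathcal M}\sup_{z\in U_x\cap U_y}\|(d\tau_{x,y})(z)\|_\infty<\infty$. Here the model fibres $\mathcal P(x)H$, which are all unitarily isomorphic since $\mathcal M$ is connected, are identified with one fixed Hilbert space by arbitrary fixed unitaries; thus $\tau_{x,y}(z)=W_x(z)^*W_y(z)\in\mathcal L(\mathcal P(y)H,\mathcal P(x)H)$. *)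

theory Defs
  imports "HOL-Analysis.Analysis"
begin

section \<open>Complex Hilbert spaces and operators between subspaces\<close>

text \<open>
  The real part of the (conjugate-linear in the first argument) complex inner product is the
  real inner product of the library, so that the norm, the topology and real differentiability
  are the ones of \<^class>\<open>real_inner\<close>.
\<close>

class complex_hilbert_space = real_inner + complete_space +
  fixes scaleC :: "complex \<Rightarrow> 'a \<Rightarrow> 'a"  (infixr "*\<^sub>C" 75)
    and cinner :: "'a \<Rightarrow> 'a \<Rightarrow> complex"
  assumes scaleC_add_right: "a *\<^sub>C (x + y) = a *\<^sub>C x + a *\<^sub>C y"
    and scaleC_add_left: "(a + b) *\<^sub>C x = a *\<^sub>C x + b *\<^sub>C x"
    and scaleC_scaleC: "a *\<^sub>C b *\<^sub>C x = (a * b) *\<^sub>C x"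
    and scaleC_one: "1 *\<^sub>C x = x"
    and scaleR_scaleC: "r *\<^sub>R x = complex_of_real r *\<^sub>C x"
    and cinner_commute: "cinner x y = cnj (cinner y x)"
    and cinner_add_right: "cinner x (y + z) = cinner x y + cinner x z"
    and cinner_scaleC_right: "cinner x (a *\<^sub>C y) = a * cinner x y"
    and Re_cinner: "Re (cinner x y) = x \<bullet> y"

global_interpretation complex_vector: vector_space "scaleC :: complex \<Rightarrow> 'a \<Rightarrow> 'a::complex_hilbert_space"
  by standard (fact scaleC_add_right scaleC_add_left scaleC_scaleC scaleC_one)+

definition clinear_on :: "'a::complex_hilbert_space set \<Rightarrow> ('a \<Rightarrow> 'b::complex_hilbert_space) \<Rightarrow> bool" where
  "clinear_on S T \<longleftrightarrow>
     (\<forall>\<xi>\<in>S. \<forall>\<eta>\<in>S. T (\<xi> + \<eta>) = T \<xi> + T \<eta>) \<and> (\<forall>a. \<forall>\<xi>\<in>S. T (a *\<^sub>C \<xi>) = a *\<^sub>C T \<xi>)"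

definition closed_csubspace :: "'a::complex_hilbert_space set \<Rightarrow> bool" where
  "closed_csubspace S \<longleftrightarrow> complex_vector.subspace S \<and> closed S"

definition unitary_on :: "'a::complex_hilbert_space set \<Rightarrow> 'b::complex_hilbert_space set \<Rightarrow> ('a \<Rightarrow> 'b) \<Rightarrow> bool" where
  "unitary_on S S' T \<longleftrightarrow>
     clinear_on S T \<and> T ` S = S' \<and> (\<forall>\<xi>\<in>S. \<forall>\<eta>\<in>S. cinner (T \<xi>) (T \<eta>) = cinner \<xi> \<eta>)"

definition orthogonal_projection :: "('a::complex_hilbert_space \<Rightarrow> 'a) \<Rightarrow> bool" where
  "orthogonal_projection p \<longleftrightarrow>
     bounded_linear p \<and> clinear_on UNIV p \<and> (\<forall>\<xi>. p (p \<xi>) = p \<xi>) \<and>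
     (\<forall>\<xi> \<eta>. cinner (p \<xi>) \<eta> = cinner \<xi> (p \<eta>))"

definition positive_operator_on :: "'a::complex_hilbert_space set \<Rightarrow> ('a \<Rightarrow> 'a) \<Rightarrow> bool" where
  "positive_operator_on S B \<longleftrightarrow>
     clinear_on S B \<and> B ` S \<subseteq> S \<and> (\<exists>K. \<forall>\<xi>\<in>S. norm (B \<xi>) \<le> K * norm \<xi>) \<and>
     (\<forall>\<xi>\<in>S. cinner \<xi> (B \<xi>) \<in> \<real> \<and> 0 \<le> Re (cinner \<xi> (B \<xi>)))"

text \<open>
  Operators on a subspace \<open>S\<close> are total functions; the value \<open>0\<close> off \<open>S\<close> makes the positive square
  root unique as a function.
\<close>

definition sqrt_on :: "'a::complex_hilbert_space set \<Rightarrow> ('a \<Rightarrow> 'a) \<Rightarrow> 'a \<Rightarrow> 'a" where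
  "sqrt_on S A = (THE B. positive_operator_on S B \<and> (\<forall>\<xi>\<in>S. B (B \<xi>) = A \<xi>) \<and> (\<forall>\<xi>. \<xi> \<notin> S \<longrightarrow> B \<xi> = 0))"

definition inv_sqrt_on :: "'a::complex_hilbert_space set \<Rightarrow> ('a \<Rightarrow> 'a) \<Rightarrow> 'a \<Rightarrow> 'a" where
  "inv_sqrt_on S A = inv_into S (sqrt_on S A)"

text \<open>The adjoint \<open>S' \<rightarrow> S\<close> of an operator \<open>T : S \<rightarrow> S'\<close>.\<close>

definition adjoint_on :: "'a::complex_hilbert_space set \<Rightarrow> ('a \<Rightarrow> 'b::complex_hilbert_space) \<Rightarrow> 'b \<Rightarrow> 'a" where
  "adjoint_on S T \<xi> = (THE \<zeta>. \<zeta> \<in> S \<and> (\<forall>\<eta>\<in>S. cinner \<zeta> \<eta> = cinner \<xi> (T \<eta>)))"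

text \<open>
  Operator norm of a linear map on the subspace \<open>S\<close>, with respect to the norm \<open>p\<close> on the source and
  the norm \<open>q\<close> on the target. Norms and suprema are taken in \<^typ>\<open>ennreal\<close>, where they always exist.
\<close>

definition op_norm :: "'a set \<Rightarrow> ('a \<Rightarrow> real) \<Rightarrow> ('b \<Rightarrow> real) \<Rightarrow> ('a \<Rightarrow> 'b) \<Rightarrow> ennreal" where
  "op_norm S p q f = (SUP v \<in> {v \<in> S. p v \<le> 1}. ennreal (q (f v)))"

definition ennreal_sqrt :: "ennreal \<Rightarrow> ennreal" where
  "ennreal_sqrt a = (if a = \<infinity> then \<infinity> else ennreal (sqrt (enn2real a)))"


section \<open>Smooth manifolds\<close>

text \<open>For open \<open>S\<close> in a finite-dimensional space.\<close>

primrec Ck_on :: "nat \<Rightarrow> ('a::real_normed_vector \<Rightarrow> 'b::real_normed_vector) \<Rightarrow> 'a set \<Rightarrow> bool" where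
  "Ck_on 0 f S \<longleftrightarrow> continuous_on S f"
| "Ck_on (Suc k) f S \<longleftrightarrow>
     (\<forall>x\<in>S. f differentiable (at x)) \<and> (\<forall>v. Ck_on k (\<lambda>x. frechet_derivative f (at x) v) S)"

definition smooth_on :: "('a::real_normed_vector \<Rightarrow> 'b::real_normed_vector) \<Rightarrow> 'a set \<Rightarrow> bool" where
  "smooth_on f S \<longleftrightarrow> (\<forall>k. Ck_on k f S)"

text \<open>A chart is a pair of a domain and a coordinate map; only the values on the domain matter.\<close>

type_synonym ('m, 'n) chart = "'m set \<times> ('m \<Rightarrow> real ^ 'n)"

definition smooth_atlas :: "('m::topological_space, 'n::finite) chart set \<Rightarrow> bool" where
  "smooth_atlas A \<longleftrightarrow>
     (\<Union>c\<in>A. fst c) = UNIV \<and>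
     (\<forall>(U, \<phi>)\<in>A. open U \<and> open (\<phi> ` U) \<and> homeomorphism U (\<phi> ` U) \<phi> (inv_into U \<phi>)) \<and>
     (\<forall>(U, \<phi>)\<in>A. \<forall>(V, \<rho>)\<in>A. smooth_on (\<rho> \<circ> inv_into U \<phi>) (\<phi> ` (U \<inter> V)))"

text \<open>
  The tangent space at \<open>p\<close> is \<^typ>\<open>real ^ 'n\<close>, identified with the geometric tangent space through
  one preferred chart at \<open>p\<close>. All derivatives of maps from or into the manifold below are expressed
  in the preferred charts; \<open>mderiv\<close> is the differential of a map defined on the manifold and
  \<open>pderiv\<close> that of a map into the manifold.
\<close>

definition chart_at :: "('m, 'n) chart set \<Rightarrow> 'm \<Rightarrow> ('m, 'n) chart" where
  "chart_at A p = (SOME c. c \<in> A \<and> p \<in> fst c)"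

definition mderiv :: "('m, 'n::finite) chart set \<Rightarrow> ('m \<Rightarrow> 'b::real_normed_vector) \<Rightarrow> 'm \<Rightarrow> real ^ 'n \<Rightarrow> 'b" where
  "mderiv A f p =
     (let (U, \<phi>) = chart_at A p in frechet_derivative (f \<circ> inv_into U \<phi>) (at (\<phi> p)))"

definition pderiv :: "('m, 'n::finite) chart set \<Rightarrow> ('a::real_normed_vector \<Rightarrow> 'm) \<Rightarrow> 'a \<Rightarrow> 'a \<Rightarrow> real ^ 'n" where
  "pderiv A f a = frechet_derivative (snd (chart_at A (f a)) \<circ> f) (at a)"

text \<open>\<open>f\<close> is a diffeomorphism from the open set \<open>S\<close> of a vector space onto an open set of the manifold.\<close>

definition diffeo_into ::
  "('m::topological_space, 'n::finite) chart set \<Rightarrow> 'a::real_normed_vector set \<Rightarrow> ('a \<Rightarrow> 'm) \<Rightarrow> bool" where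
  "diffeo_into A S f \<longleftrightarrow>
     inj_on f S \<and> open (f ` S) \<and> continuous_on S f \<and>
     (\<forall>(U, \<phi>)\<in>A. smooth_on (\<phi> \<circ> f) (S \<inter> f -` U)) \<and>
     (\<forall>(U, \<phi>)\<in>A. smooth_on (inv_into S f \<circ> inv_into U \<phi>) (\<phi> ` (f ` S \<inter> U)))"


section \<open>Riemannian metrics and bounded geometry\<close>

type_synonym ('m, 'n) metric = "'m \<Rightarrow> real ^ 'n \<Rightarrow> real ^ 'n \<Rightarrow> real"

text \<open>
  \<open>metric_coord A g (U, \<phi>) u v w\<close> is the inner product, at the point \<open>\<phi>\<^sup>-\<^sup>1(u)\<close>, of the tangent vectors
  with coordinates \<open>v\<close> and \<open>w\<close> in the chart \<open>(U, \<phi>)\<close>, which need not belong to the atlas.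
\<close>

definition metric_coord ::
  "('m, 'n::finite) chart set \<Rightarrow> ('m, 'n) metric \<Rightarrow> ('m, 'n) chart \<Rightarrow> real ^ 'n \<Rightarrow> real ^ 'n \<Rightarrow> real ^ 'n \<Rightarrow> real" where
  "metric_coord A g c u v w =
     (let \<psi> = inv_into (fst c) (snd c) in g (\<psi> u) (pderiv A \<psi> u v) (pderiv A \<psi> u w))"

definition riemannian_metric :: "('m, 'n::finite) chart set \<Rightarrow> ('m, 'n) metric \<Rightarrow> bool" where
  "riemannian_metric A g \<longleftrightarrow>
     (\<forall>p. bilinear (g p) \<and> (\<forall>v w. g p v w = g p w v) \<and> (\<forall>v. v \<noteq> 0 \<longrightarrow> g p v v > 0)) \<and>
     (\<forall>c\<in>A. \<forall>v w. smooth_on (\<lambda>u. metric_coord A g c u v w) (snd c ` fst c))"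

definition metric_norm :: "('m, 'n) metric \<Rightarrow> 'm \<Rightarrow> real ^ 'n \<Rightarrow> real" where
  "metric_norm g p v = sqrt (g p v v)"

text \<open>\<open>\<Gamma>(u)(v, w) = \<Gamma>\<^sup>k\<^sub>i\<^sub>j(u) v\<^sup>i w\<^sup>j\<close>, given by the Koszul formula.\<close>

definition christoffel ::
  "('m, 'n::finite) chart set \<Rightarrow> ('m, 'n) metric \<Rightarrow> ('m, 'n) chart \<Rightarrow> real ^ 'n \<Rightarrow> real ^ 'n \<Rightarrow> real ^ 'n \<Rightarrow> real ^ 'n" where
  "christoffel A g c u v w =
     (let G = metric_coord A g c; D = (\<lambda>a b d. frechet_derivative (\<lambda>u'. G u' b d) (at u) a)
      in THE z. \<forall>y. G u z y = (D v w y + D w v y - D y v w) / 2)"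

definition geodesic_on ::
  "('m::topological_space, 'n::finite) chart set \<Rightarrow> ('m, 'n) metric \<Rightarrow> real set \<Rightarrow> (real \<Rightarrow> 'm) \<Rightarrow> bool" where
  "geodesic_on A g J \<gamma> \<longleftrightarrow>
     continuous_on J \<gamma> \<and>
     (\<forall>c\<in>A. let u = snd c \<circ> \<gamma>; u' = (\<lambda>t. vector_derivative u (at t)) in
        smooth_on u (J \<inter> \<gamma> -` fst c) \<and>
        (\<forall>t \<in> J \<inter> \<gamma> -` fst c.
           vector_derivative u' (at t) + christoffel A g c (u t) (u' t) (u' t) = 0))"

text \<open>\<open>exp_rel A g x v y\<close>: the geodesic with initial point \<open>x\<close> and velocity \<open>v\<close> is at \<open>y\<close> at time \<open>1\<close>.\<close>

definition exp_rel ::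
  "('m::topological_space, 'n::finite) chart set \<Rightarrow> ('m, 'n) metric \<Rightarrow> 'm \<Rightarrow> real ^ 'n \<Rightarrow> 'm \<Rightarrow> bool" where
  "exp_rel A g x v y \<longleftrightarrow>
     (\<exists>J \<gamma>. open J \<and> is_interval J \<and> {0..1} \<subseteq> J \<and> geodesic_on A g J \<gamma> \<and>
        \<gamma> 0 = x \<and> pderiv A \<gamma> 0 1 = v \<and> \<gamma> 1 = y)"

definition exp_dom ::
  "('m::topological_space, 'n::finite) chart set \<Rightarrow> ('m, 'n) metric \<Rightarrow> 'm \<Rightarrow> (real ^ 'n) set" where
  "exp_dom A g x = {v. \<exists>y. exp_rel A g x v y}"

definition exp_map ::
  "('m::topological_space, 'n::finite) chart set \<Rightarrow> ('m, 'n) metric \<Rightarrow> 'm \<Rightarrow> real ^ 'n \<Rightarrow> 'm" where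
  "exp_map A g x v = (THE y. exp_rel A g x v y)"

definition tangent_ball :: "('m, 'n) metric \<Rightarrow> 'm \<Rightarrow> real \<Rightarrow> (real ^ 'n) set" where
  "tangent_ball g x r = {v. metric_norm g x v < r}"

definition geod_ball ::
  "('m::topological_space, 'n::finite) chart set \<Rightarrow> ('m, 'n) metric \<Rightarrow> 'm \<Rightarrow> real \<Rightarrow> 'm set" where
  "geod_ball A g x r = exp_map A g x ` tangent_ball g x r"

definition orthonormal_frame :: "('m, 'n::finite) metric \<Rightarrow> ('m \<Rightarrow> 'n \<Rightarrow> real ^ 'n) \<Rightarrow> bool" where
  "orthonormal_frame g e \<longleftrightarrow> (\<forall>x i j. g x (e x i) (e x j) = (if i = j then 1 else 0))"

text \<open>
  \<open>e x\<close> is an arbitrary orthonormal basis of the tangent space at \<open>x\<close>, not assumed to depend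
  continuously on \<open>x\<close>. The normal chart at \<open>x\<close> is the inverse of \<open>normal_param A g e x\<close> on a ball.
\<close>

definition normal_param ::
  "('m::topological_space, 'n::finite) chart set \<Rightarrow> ('m, 'n) metric \<Rightarrow> ('m \<Rightarrow> 'n \<Rightarrow> real ^ 'n) \<Rightarrow> 'm \<Rightarrow> real ^ 'n \<Rightarrow> 'm" where
  "normal_param A g e x v = exp_map A g x (\<Sum>i\<in>UNIV. (v $ i) *\<^sub>R e x i)"

definition normal_chart ::
  "('m::topological_space, 'n::finite) chart set \<Rightarrow> ('m, 'n) metric \<Rightarrow> ('m \<Rightarrow> 'n \<Rightarrow> real ^ 'n) \<Rightarrow> real \<Rightarrow> 'm \<Rightarrow> 'm \<Rightarrow> real ^ 'n" where
  "normal_chart A g e s x = inv_into (ball 0 s) (normal_param A g e x)"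

definition bounded_geometry_conditions ::
  "('m::topological_space, 'n::finite) chart set \<Rightarrow> ('m, 'n) metric \<Rightarrow> ('m \<Rightarrow> 'n \<Rightarrow> real ^ 'n) \<Rightarrow> real \<Rightarrow> bool" where
  "bounded_geometry_conditions A g e s \<longleftrightarrow>
     s > 0 \<and>
     (\<forall>x. tangent_ball g x s \<subseteq> exp_dom A g x \<and> diffeo_into A (tangent_ball g x s) (exp_map A g x)) \<and>
     (\<exists>C>0. \<forall>x.
        (SUP y \<in> geod_ball A g x s.
           op_norm UNIV (metric_norm g y) norm (mderiv A (normal_chart A g e s x) y)) \<le> ennreal C \<and>
        (SUP v \<in> ball 0 s.
           op_norm UNIV norm (metric_norm g (normal_param A g e x v)) (pderiv A (normal_param A g e x) v)) \<le> ennreal C)"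

text \<open>The matrix \<open>(g\<^sub>\<phi>)\<^sub>i\<^sub>j\<close> for the normal chart \<open>\<phi>\<close> at \<open>x\<close> on the geodesic ball of radius \<open>s\<close>.\<close>

definition metric_matrix ::
  "('m::topological_space, 'n::finite) chart set \<Rightarrow> ('m, 'n) metric \<Rightarrow> ('m \<Rightarrow> 'n \<Rightarrow> real ^ 'n) \<Rightarrow> real \<Rightarrow> 'm \<Rightarrow> 'm \<Rightarrow> real ^ 'n ^ 'n" where
  "metric_matrix A g e s x y =
     (let \<phi> = normal_chart A g e s x in
      \<chi> i j. metric_coord A g (geod_ball A g x s, \<phi>) (\<phi> y) (axis i 1) (axis j 1))"

definition metric_matrix_norm ::
  "('m::topological_space, 'n::finite) chart set \<Rightarrow> ('m, 'n) metric \<Rightarrow> ('m \<Rightarrow> 'n \<Rightarrow> real ^ 'n) \<Rightarrow> real \<Rightarrow> 'm \<Rightarrow> ennreal" where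
  "metric_matrix_norm A g e s x =
     (SUP y \<in> geod_ball A g x s. op_norm UNIV norm norm (\<lambda>v. metric_matrix A g e s x y *v v))"


section \<open>Strongly differentiable operator-valued maps\<close>

definition strongly_differentiable_on ::
  "('m::topological_space, 'n::finite) chart set \<Rightarrow> 'm set \<Rightarrow> 'a::real_normed_vector set \<Rightarrow> ('m \<Rightarrow> 'a \<Rightarrow> 'b::real_normed_vector) \<Rightarrow> bool" where
  "strongly_differentiable_on A D E f \<longleftrightarrow>
     (\<forall>\<xi>\<in>E. \<forall>(U, \<phi>)\<in>A. Ck_on 1 (\<lambda>u. f (inv_into U \<phi> u) \<xi>) (\<phi> ` (D \<inter> U)))"

text \<open>
  An element of the tensor product of a complex Hilbert space \<open>F\<close> with the complexified cotangent
  space at \<open>y\<close> is a real-linear map from the tangent space to \<open>F\<close>. In terms of an orthonormal basis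
  \<open>e y\<close> of the tangent space, it is \<open>\<Sum>i. L (e y i) \<otimes> e\<^sup>i\<close> with \<open>e\<^sup>i\<close> the (orthonormal) dual basis, so
  that its Hilbert space norm is the following one (independently of the choice of the basis).
\<close>

definition cotensor_norm ::
  "('m \<Rightarrow> 'n::finite \<Rightarrow> real ^ 'n) \<Rightarrow> 'm \<Rightarrow> (real ^ 'n \<Rightarrow> 'b::real_normed_vector) \<Rightarrow> real" where
  "cotensor_norm e y L = sqrt (\<Sum>i\<in>UNIV. (norm (L (e y i)))\<^sup>2)"

definition strong_deriv ::
  "('m, 'n::finite) chart set \<Rightarrow> ('m \<Rightarrow> 'a \<Rightarrow> 'b::real_normed_vector) \<Rightarrow> 'm \<Rightarrow> 'a \<Rightarrow> real ^ 'n \<Rightarrow> 'b" where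
  "strong_deriv A f y \<xi> = mderiv A (\<lambda>z. f z \<xi>) y"

definition strong_deriv_norm ::
  "('m, 'n::finite) chart set \<Rightarrow> ('m \<Rightarrow> 'n \<Rightarrow> real ^ 'n) \<Rightarrow> 'a::real_normed_vector set \<Rightarrow> ('m \<Rightarrow> 'a \<Rightarrow> 'b::real_normed_vector) \<Rightarrow> 'm \<Rightarrow> ennreal" where
  "strong_deriv_norm A e E f y = op_norm E norm (cotensor_norm e y) (strong_deriv A f y)"


section \<open>Hilbert bundles of bounded geometry\<close>

text \<open>\<open>\<psi>\<^sub>x \<psi>\<^sub>y\<^sup>-\<^sup>1 (z, \<xi>) = (z, transition T \<pi> U \<psi> x y z \<xi>)\<close>, where \<open>\<psi>\<^sub>y\<close> is defined on \<open>\<pi>\<^sup>-\<^sup>1(U\<^sub>y)\<close>.\<close>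

definition transition ::
  "'t topology \<Rightarrow> ('t \<Rightarrow> 'm) \<Rightarrow> ('m \<Rightarrow> 'm set) \<Rightarrow> ('m \<Rightarrow> 't \<Rightarrow> 'm \<times> 'h) \<Rightarrow> 'm \<Rightarrow> 'm \<Rightarrow> 'm \<Rightarrow> 'h \<Rightarrow> 'h" where
  "transition T \<pi> U \<psi> x y z \<xi> = snd (\<psi> x (inv_into {p \<in> topspace T. \<pi> p \<in> U y} (\<psi> y) (z, \<xi>)))"

text \<open>
  The total space is the topological space \<open>T\<close>; the model fibre is the closed subspace \<open>E\<close> of a
  Hilbert space (possibly all of it).
\<close>

definition hilbert_bundle_bounded_geometry ::
  "('m::topological_space, 'n::finite) chart set \<Rightarrow> ('m, 'n) metric \<Rightarrow> ('m \<Rightarrow> 'n \<Rightarrow> real ^ 'n) \<Rightarrow> real \<Rightarrow>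
   't topology \<Rightarrow> ('t \<Rightarrow> 'm) \<Rightarrow> 'h::complex_hilbert_space set \<Rightarrow> ('m \<Rightarrow> 't \<Rightarrow> 'm \<times> 'h) \<Rightarrow> bool" where
  "hilbert_bundle_bounded_geometry A g e r T \<pi> E \<psi> \<longleftrightarrow>
     (let U = (\<lambda>x. geod_ball A g x r); \<tau> = transition T \<pi> U \<psi> in
      bounded_geometry_conditions A g e r \<and>
      closed_csubspace E \<and> separable_space (top_of_set E) \<and>
      Hausdorff_space T \<and>
      continuous_map T euclidean \<pi> \<and> \<pi> ` topspace T = UNIV \<and>
      (\<forall>x. homeomorphic_map (subtopology T {p \<in> topspace T. \<pi> p \<in> U x}) (top_of_set (U x \<times> E)) (\<psi> x) \<and>
           (\<forall>p \<in> topspace T. \<pi> p \<in> U x \<longrightarrow> fst (\<psi> x p) = \<pi> p)) \<and>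
      (\<forall>x y. strongly_differentiable_on A (U x \<inter> U y) E (\<tau> x y) \<and>
             (\<forall>z \<in> U x \<inter> U y. unitary_on E E (\<tau> x y z))) \<and>
      (SUP x. SUP y. SUP z \<in> U x \<inter> U y. strong_deriv_norm A e E (\<tau> x y) z) < \<infinity>)"


section \<open>The bundle of ranges of a family of projections\<close>

definition im_total :: "('m \<Rightarrow> 'h \<Rightarrow> 'h) \<Rightarrow> ('m \<times> 'h) set" where
  "im_total P = (SIGMA x:UNIV. range (P x))"

definition im_W :: "('m \<Rightarrow> 'h \<Rightarrow> 'h::complex_hilbert_space) \<Rightarrow> 'm \<Rightarrow> 'm \<Rightarrow> 'h \<Rightarrow> 'h" where
  "im_W P x y = P y \<circ> inv_sqrt_on (range (P x)) (P x \<circ> P y \<circ> P x)"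

definition im_triv :: "('m \<Rightarrow> 'h \<Rightarrow> 'h::complex_hilbert_space) \<Rightarrow> 'm \<Rightarrow> 'm \<times> 'h \<Rightarrow> 'm \<times> 'h" where
  "im_triv P x = (\<lambda>(y, \<xi>). (y, adjoint_on (range (P x)) (im_W P x y) \<xi>))"

definition im_topology ::
  "('m \<Rightarrow> 'm::topological_space set) \<Rightarrow> ('m \<Rightarrow> 'h \<Rightarrow> 'h::complex_hilbert_space) \<Rightarrow> ('m \<times> 'h) topology" where
  "im_topology U P = topology_generated_by
     {V. V \<subseteq> im_total P \<and>
         (\<exists>x. fst ` V \<subseteq> U x \<and> openin (top_of_set (U x \<times> range (P x))) (im_triv P x ` V))}"

text \<open>Identification of all the model fibres \<open>\<P>(x)H\<close> with one Hilbert space \<open>E\<close>.\<close>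

definition fibre_identification ::
  "('m \<Rightarrow> 'h \<Rightarrow> 'h::complex_hilbert_space) \<Rightarrow> 'h set \<Rightarrow> ('m \<Rightarrow> 'h \<Rightarrow> 'h) \<Rightarrow> bool" where
  "fibre_identification P E \<Theta> \<longleftrightarrow> closed_csubspace E \<and> (\<forall>x. unitary_on (range (P x)) E (\<Theta> x))"

end

theory Submission
  imports Defs
begin

text \<open>
  Along a radial segment of a normal chart the derivative of \<open>P\<close> is bounded by
  $r\,\|g_\phi\|^{1/2}\,\|dP\|$, so $\|P(x) - P(y)\| \le \delta < 1/4$ for $y \in U_x$. Therefore
  $D = P(x) - P(x)P(y)P(x)$ has norm at most $\delta$, and $(P(x)P(y)P(x))^{-1/2}$ is the power series
  of $(1 - D)^{-1/2}$. Operator families that are uniformly bounded and strongly $C^1$ with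
  uniformly bounded derivative are closed under composition and under normally convergent series,
  which bounds the derivatives of the transition maps uniformly. Such families are also jointly
  continuous in the point and the vector, so that the topology of the total space is the subspace
  topology inherited from the product of the manifold and the Hilbert space.

  As the exponential map is defined by a description operator, $\exp_x(0) = x$ requires that the
  geodesic with initial velocity \<open>0\<close> is unique; this follows from conservation of energy, without an
  appeal to the uniqueness theorem for differential equations.
\<close>

text \<open>\<open>P\<close> is differentiable only strongly, so products of operator families
  cannot be differentiated in the operator norm. The product rule survives because the base is
  finite-dimensional and the families are uniformly bounded; hence each family carries one constant
  for itself and one for its derivative. Both are measured with \<open>g\<close>, not in
  coordinates, which makes them uniform over charts and base points; charts enter only through a
  local comparison of \<open>g\<close> with the Euclidean norm. Since \<open>sqrt_on\<close> is a
  definite description, every positive square root of pqp on the range of p must be shown to equal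
  pqR, where R is the power series. That argument needs R to be strictly positive. All that is used
  of the coefficients is that they are nonnegative, at most 1, and convolve with themselves to the
  constant sequence 1; so R - 1 has norm at most \<delta>/(1 - \<delta>), which is below 1 exactly
  for \<delta> < 1/2. The smallness hypothesis is an inequality in \<open>ennreal\<close>, where a
  product of 0 and infinity is 0. If dP vanishes it says nothing about the metric matrices, and the
  bound on the normal charts comes from bounded geometry instead.\<close>

instance complex_hilbert_space \<subseteq> banach ..

section \<open>Elementary facts about the complex inner product\<close>

lemma clinear_on_scaleR:
  assumes "clinear_on S T" "\<xi> \<in> S"
  shows "T (a *\<^sub>R \<xi>) = a *\<^sub>R T \<xi>"
  using assms by (simp add: clinear_on_def scaleR_scaleC)

lemma cinner_add_left: "cinner (x + y) z = cinner x z + cinner y z"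
  by (metis cinner_add_right cinner_commute complex_cnj_add)

lemma cinner_scaleC_left: "cinner (a *\<^sub>C x) y = cnj a * cinner x y"
  by (metis cinner_commute cinner_scaleC_right complex_cnj_mult)

lemma cinner_diff_left: "cinner (x - y) z = cinner x z - cinner y z"
  by (metis add_diff_cancel cinner_add_left diff_add_cancel)

text \<open>The complex inner product is determined by the real one through multiplication by the
  imaginary unit. This lets real self-adjointness be upgraded to the complex kind.\<close>

lemma Im_cinner: "Im (cinner x y) = - (x \<bullet> (\<i> *\<^sub>C y))"
  by (simp flip: Re_cinner add: cinner_scaleC_right)

lemma cinner_self: "cinner x x = complex_of_real ((norm x)\<^sup>2)"
  by (metis Re_cinner Reals_cnj_iff cinner_commute dot_square_norm of_real_Re)

lemma norm_scaleC: "norm (a *\<^sub>C x) = cmod a * norm x" for x :: "'h::complex_hilbert_space"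
proof -
  have "complex_of_real ((norm (a *\<^sub>C x))\<^sup>2) = a * cnj a * complex_of_real ((norm x)\<^sup>2)"
    by (simp only: cinner_scaleC_left cinner_scaleC_right mult_ac flip: cinner_self)
  also have "a * cnj a = complex_of_real ((cmod a)\<^sup>2)"
    by (rule complex_norm_square[symmetric])
  finally have "(norm (a *\<^sub>C x))\<^sup>2 = (cmod a * norm x)\<^sup>2"
    unfolding power_mult_distrib by (metis of_real_eq_iff of_real_mult)
  then show ?thesis
    by (simp add: power2_eq_iff_nonneg)
qed

lemma bounded_linear_scaleC: "bounded_linear (\<lambda>x::'h::complex_hilbert_space. a *\<^sub>C x)"
  by (rule bounded_linear_intro[of _ "cmod a"])
     (simp_all add: scaleC_add_right scaleR_scaleC scaleC_scaleC mult.commute norm_scaleC)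

lemma clinear_on_imp_linear:
  assumes "clinear_on UNIV T"
  shows "linear T"
  using assms by (intro linearI) (auto simp: clinear_on_def scaleR_scaleC)

lemma unitary_on_norm:
  assumes "unitary_on S S' T" "\<xi> \<in> S"
  shows "norm (T \<xi>) = norm \<xi>"
proof -
  have "cinner (T \<xi>) (T \<xi>) = cinner \<xi> \<xi>"
    using assms by (auto simp: unitary_on_def)
  then have "(norm (T \<xi>))\<^sup>2 = (norm \<xi>)\<^sup>2"
    by (simp only: cinner_self of_real_eq_iff)
  then show ?thesis
    by (simp add: power2_eq_iff_nonneg)
qed


subsection \<open>The inverse square root as a power series\<close>

text \<open>The coefficients of $(1 - x)^{-1/2}$.\<close>

definition isqrt_coeff :: "nat \<Rightarrow> real" where
  "isqrt_coeff k = pochhammer (1/2) k / fact k"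

lemma isqrt_coeff_0 [simp]: "isqrt_coeff 0 = 1"
  by (simp add: isqrt_coeff_def)

lemma isqrt_coeff_nonneg: "0 \<le> isqrt_coeff k"
  by (simp add: isqrt_coeff_def pochhammer_nonneg)

text \<open>The square of the series of (1 - x)^(-1/2) is the geometric series. On coefficients this
  is the Vandermonde identity for rising factorials at 1/2 + 1/2 = 1.\<close>

lemma isqrt_coeff_convolution: "(\<Sum>i\<le>n. isqrt_coeff i * isqrt_coeff (n - i)) = 1"
proof -
  have "(fact n :: real) = pochhammer (1/2 + 1/2) n"
    by (simp add: pochhammer_fact)
  also have "\<dots> = (\<Sum>k\<le>n. of_nat (n choose k) * pochhammer (1/2) k * pochhammer (1/2) (n - k) :: real)"
    by (rule pochhammer_binomial_sum)
  also have "\<dots> = (\<Sum>k\<le>n. fact n * (isqrt_coeff k * isqrt_coeff (n - k)))"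
    by (intro sum.cong refl) (simp add: isqrt_coeff_def binomial_fact)
  finally show ?thesis
    by (simp flip: sum_distrib_left)
qed

text \<open>The coefficient is the term \<open>i = n\<close> of the convolution sum, whose terms are
  nonnegative and add up to 1. So the geometric series in \<delta> dominates everywhere
  below.\<close>

lemma isqrt_coeff_le_1: "isqrt_coeff n \<le> 1"
proof -
  have "isqrt_coeff n * isqrt_coeff (n - n) \<le> (\<Sum>i\<le>n. isqrt_coeff i * isqrt_coeff (n - i))"
    by (rule member_le_sum) (auto intro: mult_nonneg_nonneg isqrt_coeff_nonneg)
  then show ?thesis
    by (simp add: isqrt_coeff_convolution)
qed

definition isqrt_series :: "('h::real_normed_vector \<Rightarrow> 'h) \<Rightarrow> 'h \<Rightarrow> 'h" where
  "isqrt_series D \<xi> = (\<Sum>k. isqrt_coeff k *\<^sub>R (D ^^ k) \<xi>)"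

text \<open>Self-adjointness is asked for the real inner product only; with complex linearity it
  gives the complex version. The threshold 1/2 is the one at which \<delta>/(1 - \<delta>), the
  bound for the tail of the series after its first term, reaches 1.\<close>

locale small_selfadjoint =
  fixes D :: "'h::complex_hilbert_space \<Rightarrow> 'h" and \<delta> :: real
  assumes clin: "clinear_on UNIV D"
    and bound: "norm (D \<xi>) \<le> \<delta> * norm \<xi>"
    and selfadj: "D \<xi> \<bullet> \<eta> = \<xi> \<bullet> D \<eta>"
    and delta: "0 \<le> \<delta>" "\<delta> < 1/2"
begin

abbreviation "R \<equiv> isqrt_series D"

lemma lin: "linear D"
  by (rule clinear_on_imp_linear[OF clin])

lemma bounded_lin: "bounded_linear D"
  using lin bound by (auto simp: bounded_linear_def bounded_linear_axioms_def mult.commute)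

lemma pow_linear: "linear (D ^^ k)"
proof (induction k)
  case (Suc k)
  show ?case
    using linear_compose[OF Suc lin] by (simp add: o_def)
qed (simp add: linear_iff)

lemma pow_bound: "norm ((D ^^ k) \<xi>) \<le> \<delta> ^ k * norm \<xi>"
proof (induction k)
  case (Suc k)
  have "norm ((D ^^ Suc k) \<xi>) \<le> \<delta> * norm ((D ^^ k) \<xi>)"
    by (simp add: bound)
  also have "\<dots> \<le> \<delta> * (\<delta> ^ k * norm \<xi>)"
    by (intro mult_left_mono Suc delta)
  finally show ?case by simp
qed simp

lemma pow_bounded_linear: "bounded_linear (D ^^ k)"
  by (intro bounded_linear_intro[of _ "\<delta> ^ k"])
     (use pow_bound in \<open>auto simp: linear_add[OF pow_linear] linear_scale[OF pow_linear] mult.commute\<close>)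

lemma pow_selfadj: "(D ^^ k) \<xi> \<bullet> \<eta> = \<xi> \<bullet> (D ^^ k) \<eta>"
  by (induction k arbitrary: \<xi> \<eta>) (auto simp: selfadj funpow_swap1)

lemma coeff_pow_bound: "norm (isqrt_coeff k *\<^sub>R (D ^^ k) \<xi>) \<le> \<delta> ^ k * norm \<xi>"
  using mult_mono[OF isqrt_coeff_le_1[of k] pow_bound[of k \<xi>]] 
  by (simp add: isqrt_coeff_nonneg)

lemma delta_summable: "summable (\<lambda>k. \<delta> ^ k * c)"
  using delta by (intro summable_mult2 summable_geometric) auto

lemma summ: "summable (\<lambda>k. isqrt_coeff k *\<^sub>R (D ^^ k) \<xi>)"
  by (rule summable_comparison_test'[OF delta_summable coeff_pow_bound])

lemma norm_summ: "summable (\<lambda>k. norm (isqrt_coeff k *\<^sub>R (D ^^ k) \<xi>))"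
  by (rule summable_comparison_test'[OF delta_summable[of "norm \<xi>"]])
     (use coeff_pow_bound in auto)

lemma R_sums: "(\<lambda>k. isqrt_coeff k *\<^sub>R (D ^^ k) \<xi>) sums R \<xi>"
  using summ by (simp add: isqrt_series_def summable_sums)

lemma R_bound: "norm (R \<xi>) \<le> norm \<xi> / (1 - \<delta>)"
proof -
  have "norm (R \<xi>) \<le> (\<Sum>k. norm (isqrt_coeff k *\<^sub>R (D ^^ k) \<xi>))"
    unfolding isqrt_series_def by (rule summable_norm[OF norm_summ])
  also have "\<dots> \<le> (\<Sum>k. \<delta> ^ k * norm \<xi>)"
    by (rule suminf_le[OF coeff_pow_bound norm_summ delta_summable])
  also have "\<dots> = norm \<xi> / (1 - \<delta>)"
    using delta by (subst suminf_mult2[symmetric]) (auto simp: suminf_geometric summable_geometric)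
  finally show ?thesis .
qed

text \<open>A continuous linear map passes through the series term by term. It is applied to complex
  scalars, to \<open>D\<close>, to a projection, and to an arbitrary positive square root.\<close>

lemma R_commute:
  assumes T: "bounded_linear T" and comm: "\<And>\<xi>. T (D \<xi>) = D (T \<xi>)"
  shows "T (R \<xi>) = R (T \<xi>)"
proof -
  have "T ((D ^^ k) \<eta>) = (D ^^ k) (T \<eta>)" for k \<eta>
    by (induction k) (auto simp: comm)
  then have "(\<lambda>k. isqrt_coeff k *\<^sub>R (D ^^ k) (T \<xi>)) sums T (R \<xi>)"
    using bounded_linear.sums[OF T R_sums[of \<xi>]]
    by (simp add: linear_scale[OF bounded_linear.linear[OF T]])
  then show ?thesis
    using R_sums sums_unique2 by blast
qed

lemma R_add: "R (\<xi> + \<eta>) = R \<xi> + R \<eta>"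
  using sums_add[OF R_sums[of \<xi>] R_sums[of \<eta>]] R_sums[of "\<xi> + \<eta>"]
  by (simp add: linear_add[OF pow_linear] scaleR_add_right sums_unique2)

lemma R_scaleC: "R (a *\<^sub>C \<xi>) = a *\<^sub>C R \<xi>"
  using R_commute[OF bounded_linear_scaleC[of a]] clin by (simp add: clinear_on_def)

lemma R_D: "R (D \<xi>) = D (R \<xi>)"
  by (rule R_commute[OF bounded_lin, symmetric]) simp

lemma R_selfadj: "R \<xi> \<bullet> \<eta> = \<xi> \<bullet> R \<eta>"
proof -
  have "(\<lambda>k. (isqrt_coeff k *\<^sub>R (D ^^ k) \<xi>) \<bullet> \<eta>) sums (R \<xi> \<bullet> \<eta>)"
    by (rule bounded_linear.sums[OF bounded_linear_inner_left R_sums])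
  moreover have "(\<lambda>k. \<xi> \<bullet> (isqrt_coeff k *\<^sub>R (D ^^ k) \<eta>)) sums (\<xi> \<bullet> R \<eta>)"
    by (rule bounded_linear.sums[OF bounded_linear_inner_right R_sums])
  ultimately show ?thesis
    by (simp add: pow_selfadj sums_unique2)
qed

text \<open>Splitting off the term \<open>k = 0\<close> leaves a tail of norm at most \<delta>/(1 -
  \<delta>) times that of the vector, and Cauchy-Schwarz bounds its contribution. The factor 1 -
  \<delta> clears the denominator. For \<delta> < 1/2 this is strict positivity, on which uniqueness
  of the square root rests.\<close>

lemma R_positive: "(1 - 2 * \<delta>) * (norm \<xi>)\<^sup>2 \<le> (1 - \<delta>) * (\<xi> \<bullet> R \<xi>)"
proof -
  let ?f = "\<lambda>k. isqrt_coeff k *\<^sub>R (D ^^ k) \<xi>"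
  have tail: "R \<xi> = \<xi> + (\<Sum>k. ?f (Suc k))"
    using suminf_split_head[OF summ[of \<xi>]] by (simp add: isqrt_series_def)
  have s: "summable (\<lambda>k. norm (?f (Suc k)))"
    using norm_summ[of \<xi>] by (subst summable_Suc_iff)
  have s': "summable (\<lambda>k. \<delta> ^ Suc k * norm \<xi>)"
    using delta_summable[of "norm \<xi>"] by (subst summable_Suc_iff[where f="\<lambda>k. \<delta> ^ k * norm \<xi>"])
  have "norm (\<Sum>k. ?f (Suc k)) \<le> (\<Sum>k. norm (?f (Suc k)))"
    by (rule summable_norm[OF s])
  also have "\<dots> \<le> (\<Sum>k. \<delta> ^ Suc k * norm \<xi>)"
    by (rule suminf_le[OF coeff_pow_bound s s'])
  also have "\<dots> = \<delta> * norm \<xi> / (1 - \<delta>)"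
    using delta suminf_mult2[of "\<lambda>k. \<delta> ^ k" "\<delta> * norm \<xi>"] 
    by (simp add: suminf_geometric summable_geometric mult_ac)
  finally have t: "norm (\<Sum>k. ?f (Suc k)) \<le> \<delta> * norm \<xi> / (1 - \<delta>)" .
  have "\<bar>\<xi> \<bullet> (\<Sum>k. ?f (Suc k))\<bar> \<le> norm \<xi> * norm (\<Sum>k. ?f (Suc k))"
    by (rule Cauchy_Schwarz_ineq2)
  also have "\<dots> \<le> norm \<xi> * (\<delta> * norm \<xi> / (1 - \<delta>))"
    by (intro mult_left_mono t) simp
  finally have "\<xi> \<bullet> R \<xi> \<ge> (norm \<xi>)\<^sup>2 - (norm \<xi>)\<^sup>2 * \<delta> / (1 - \<delta>)"
    unfolding tail by (simp add: inner_add_right power2_eq_square dot_square_norm mult_ac)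
  then have "(1 - \<delta>) * ((norm \<xi>)\<^sup>2 - (norm \<xi>)\<^sup>2 * \<delta> / (1 - \<delta>)) \<le> (1 - \<delta>) * (\<xi> \<bullet> R \<xi>)"
    using delta by (intro mult_left_mono) auto
  then show ?thesis
    using delta by (simp add: right_diff_distrib mult_ac) (simp add: algebra_simps)
qed

text \<open>A Cauchy product: the double series is dominated by a product of two geometric series,
  so it may be summed by rows, giving \<open>R (R \<xi>)\<close>, or by antidiagonals, where the
  convolution identity leaves the Neumann series of \<open>D\<close>.\<close>

lemma R_R_sums: "(\<lambda>k. (D ^^ k) \<xi>) sums R (R \<xi>)"
proof -
  let ?c = isqrt_coeff
  let ?f = "\<lambda>(i, j). (?c i * ?c j) *\<^sub>R (D ^^ (i + j)) \<xi>"
  have hs: "((\<lambda>k. isqrt_coeff k *\<^sub>R (D ^^ k) \<zeta>) has_sum R \<zeta>) UNIV" for \<zeta>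
    by (rule norm_summable_imp_has_sum[OF norm_summ R_sums])
  have inner: "((\<lambda>j. ?f (i, j)) has_sum ?c i *\<^sub>R (D ^^ i) (R \<xi>)) UNIV" for i
  proof -
    have "bounded_linear (\<lambda>\<zeta>. ?c i *\<^sub>R (D ^^ i) \<zeta>)"
      by (intro bounded_linear_intros pow_bounded_linear)
    from has_sum_bounded_linear[OF this hs[of \<xi>]] show ?thesis
      by (simp add: o_def linear_scale[OF pow_linear] funpow_add mult_ac)
  qed
  have geo: "((\<lambda>j. \<delta> ^ j) has_sum 1 / (1 - \<delta>)) UNIV"
    using delta by (intro norm_summable_imp_has_sum)
      (auto simp: norm_power intro!: summable_geometric geometric_sums)
  have "(\<lambda>(i, j). \<delta> ^ i * (\<delta> ^ j * norm \<xi>)) summable_on UNIV \<times> UNIV"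
  proof (rule summable_on_SigmaI)
    show "((\<lambda>j. case (i, j) of (i, j) \<Rightarrow> \<delta> ^ i * (\<delta> ^ j * norm \<xi>)) has_sum
        \<delta> ^ i * (1 / (1 - \<delta>) * norm \<xi>)) UNIV" for i
      using has_sum_cmult_right[OF has_sum_cmult_left[OF geo, of "norm \<xi>"], of "\<delta> ^ i"] by simp
    show "(\<lambda>i. \<delta> ^ i * (1 / (1 - \<delta>) * norm \<xi>)) summable_on UNIV"
      using has_sum_cmult_left[OF geo, of "1 / (1 - \<delta>) * norm \<xi>"] by (auto simp: summable_on_def)
  qed (use delta in auto)
  moreover have "norm (?f ij) \<le> (\<lambda>(i, j). \<delta> ^ i * (\<delta> ^ j * norm \<xi>)) ij" for ij
  proof (cases ij)
    case (Pair i j)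
    have "?c i * ?c j \<le> 1 * 1"
      by (intro mult_mono isqrt_coeff_le_1 isqrt_coeff_nonneg) auto
    then have "(?c i * ?c j) * norm ((D ^^ (i + j)) \<xi>) \<le> 1 * (\<delta> ^ (i + j) * norm \<xi>)"
      by (intro mult_mono pow_bound) auto
    then show ?thesis
      by (simp add: Pair isqrt_coeff_nonneg power_add mult_ac abs_mult)
  qed
  ultimately have "?f abs_summable_on UNIV \<times> UNIV"
    by (intro Infinite_Sum.abs_summable_on_comparison_test'[where g = "\<lambda>(i, j). \<delta> ^ i * (\<delta> ^ j * norm \<xi>)"]) auto
  then have summ2: "?f summable_on UNIV \<times> UNIV"
    by (rule abs_summable_summable)
  then obtain S where S: "(?f has_sum S) (UNIV \<times> UNIV)"
    by (auto simp: summable_on_def)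
  have "((\<lambda>i. ?c i *\<^sub>R (D ^^ i) (R \<xi>)) has_sum S) UNIV"
    by (rule has_sum_SigmaD[OF S inner])
  with hs[of "R \<xi>"] have SR: "S = R (R \<xi>)"
    by (rule has_sum_unique[rotated])
  \<comment> \<open>The pair (i, j) is relabelled as (i + j, i). Since i is at most n = i + j, the
    truncated subtraction \<open>n - i\<close> is exact.\<close>
  have "((\<lambda>(n, i). ?f (i, n - i)) has_sum S) (SIGMA n:UNIV. {..n})"
    by (rule has_sum_reindex_bij_witness[THEN iffD2, OF _ _ _ _ _ _ S,
          of _ "\<lambda>(i, j). (i + j, i)" "\<lambda>(n, i). (i, n - i)"]) auto
  moreover have "((\<lambda>i. case (n, i) of (n, i) \<Rightarrow> ?f (i, n - i)) has_sum (D ^^ n) \<xi>) {..n}" for n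
  proof -
    have "(\<Sum>i\<le>n. ?f (i, n - i)) = (\<Sum>i\<le>n. ?c i * ?c (n - i)) *\<^sub>R (D ^^ n) \<xi>"
      by (simp add: scaleR_sum_left)
    then show ?thesis
      by (simp add: isqrt_coeff_convolution has_sum_finite_iff)
  qed
  ultimately have "((\<lambda>n. (D ^^ n) \<xi>) has_sum S) UNIV"
    by (rule has_sum_SigmaD)
  then show ?thesis
    unfolding SR by (rule has_sum_imp_sums)
qed

text \<open>The Neumann series telescopes: applying \<open>D\<close> shifts it by one index, so only
  the term \<open>k = 0\<close> remains.\<close>

lemma R_R: "R (R \<xi>) - D (R (R \<xi>)) = \<xi>"
proof -
  have "(\<lambda>k. (D ^^ Suc k) \<xi>) sums D (R (R \<xi>))"
    using bounded_linear.sums[OF bounded_lin R_R_sums] by simp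
  moreover have "(\<lambda>k. (D ^^ Suc k) \<xi>) sums (R (R \<xi>) - \<xi>)"
    using R_R_sums[of \<xi>] by (subst sums_Suc_iff) simp
  ultimately show ?thesis
    by (metis add_diff_cancel_left' diff_add_cancel sums_unique2)
qed

lemma R_diff: "R (\<xi> - \<eta>) = R \<xi> - R \<eta>"
  using R_add[of "\<xi> - \<eta>" \<eta>] by simp

lemma R_R_1: "R (R (\<xi> - D \<xi>)) = \<xi>"
  using R_R by (simp add: R_diff R_D)

lemma R_1_R: "R (R \<xi> - D (R \<xi>)) = \<xi>"
  using R_R by (simp add: R_diff R_D)

end


subsection \<open>Two nearby projections\<close>

lemma orthogonal_projection_clinear: "orthogonal_projection p \<Longrightarrow> clinear_on UNIV p"
  by (simp add: orthogonal_projection_def)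

lemma orthogonal_projection_bounded_linear: "orthogonal_projection p \<Longrightarrow> bounded_linear p"
  by (simp add: orthogonal_projection_def)

lemma orthogonal_projection_linear: "orthogonal_projection p \<Longrightarrow> linear p"
  by (simp add: orthogonal_projection_def bounded_linear.linear)

lemma orthogonal_projection_idem: "orthogonal_projection p \<Longrightarrow> p (p \<xi>) = p \<xi>"
  by (simp add: orthogonal_projection_def)

lemma orthogonal_projection_cinner:
  "orthogonal_projection p \<Longrightarrow> cinner (p \<xi>) \<eta> = cinner \<xi> (p \<eta>)"
  by (simp add: orthogonal_projection_def)

lemma orthogonal_projection_inner: "orthogonal_projection p \<Longrightarrow> p \<xi> \<bullet> \<eta> = \<xi> \<bullet> p \<eta>"
  by (metis orthogonal_projection_cinner Re_cinner)

lemma orthogonal_projection_range: "orthogonal_projection p \<Longrightarrow> \<xi> \<in> range p \<longleftrightarrow> p \<xi> = \<xi>"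
  by (metis orthogonal_projection_idem rangeE rangeI)

lemma orthogonal_projection_norm:
  assumes "orthogonal_projection p"
  shows "norm (p \<xi>) \<le> norm \<xi>"
proof -
  have "norm (p \<xi>) * norm (p \<xi>) = \<xi> \<bullet> p \<xi>"
    using orthogonal_projection_inner[OF assms, of \<xi> "p \<xi>"]
    by (simp add: orthogonal_projection_idem[OF assms] flip: power2_norm_eq_inner power2_eq_square)
  also have "\<dots> \<le> norm \<xi> * norm (p \<xi>)"
    by (rule norm_cauchy_schwarz)
  finally show ?thesis
    by (cases "p \<xi> = 0") auto
qed

lemma closed_csubspace_range_projection:
  assumes "orthogonal_projection p"
  shows "closed_csubspace (range p)"
proof -
  interpret p: bounded_linear p
    by (rule orthogonal_projection_bounded_linear[OF assms])
  have "range p = {\<xi>. p \<xi> = \<xi>}"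
    using orthogonal_projection_range[OF assms] by auto
  moreover have "closed {\<xi>. p \<xi> = \<xi>}"
    by (intro closed_Collect_eq continuous_intros p.continuous_on)
  moreover have "complex_vector.subspace {\<xi>. p \<xi> = \<xi>}"
    using orthogonal_projection_clinear[OF assms]
    by (auto simp: complex_vector.subspace_def p.zero p.add clinear_on_def)
  ultimately show ?thesis
    by (simp add: closed_csubspace_def)
qed

text \<open>This is p(1 - q)p. As an operator on the whole space it can be iterated without
  reference to the range of p; it vanishes on the kernel of p, where the power series is therefore
  the identity.\<close>

definition proj_gap :: "('h \<Rightarrow> 'h) \<Rightarrow> ('h \<Rightarrow> 'h) \<Rightarrow> 'h \<Rightarrow> 'h::real_vector" where
  "proj_gap p q \<xi> = p \<xi> - p (q (p \<xi>))"

text \<open>On the range of \<open>p\<close> this is $(pqp)^{-1/2}$, since there \<open>pqp = 1 - proj_gap p q\<close>.\<close>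

definition proj_isqrt :: "('h \<Rightarrow> 'h) \<Rightarrow> ('h \<Rightarrow> 'h) \<Rightarrow> 'h \<Rightarrow> 'h::real_normed_vector" where
  "proj_isqrt p q = isqrt_series (proj_gap p q)"

locale near_projections =
  fixes p q :: "'h::complex_hilbert_space \<Rightarrow> 'h" and \<delta> :: real
  assumes p: "orthogonal_projection p" and q: "orthogonal_projection q"
    and near: "norm (p \<xi> - q \<xi>) \<le> \<delta> * norm \<xi>"
    and del: "0 \<le> \<delta>" "\<delta> < 1/2"
begin

lemma swapped: "near_projections q p \<delta>"
  using p q near del by unfold_locales (simp_all add: norm_minus_commute)

lemmas p_idem [simp] = orthogonal_projection_idem[OF p]
  and q_idem [simp] = orthogonal_projection_idem[OF q]
  and p_range = orthogonal_projection_range[OF p]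
  and q_range = orthogonal_projection_range[OF q]
  and p_diff = linear_diff[OF orthogonal_projection_linear[OF p]]
  and q_diff = linear_diff[OF orthogonal_projection_linear[OF q]]

sublocale small_selfadjoint "proj_gap p q" \<delta>
proof
  show "clinear_on UNIV (proj_gap p q)"
    using orthogonal_projection_clinear[OF p] orthogonal_projection_clinear[OF q]
    by (auto simp: clinear_on_def proj_gap_def complex_vector.scale_right_diff_distrib)
  show "norm (proj_gap p q \<xi>) \<le> \<delta> * norm \<xi>" for \<xi>
  proof -
    have "norm (proj_gap p q \<xi>) = norm (p (p (p \<xi>) - q (p \<xi>)))"
      by (simp add: proj_gap_def p_diff)
    also have "\<dots> \<le> norm (p (p \<xi>) - q (p \<xi>))"
      by (rule orthogonal_projection_norm[OF p])
    also have "\<dots> \<le> \<delta> * norm (p \<xi>)"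
      by (rule near)
    also have "\<dots> \<le> \<delta> * norm \<xi>"
      by (intro mult_left_mono orthogonal_projection_norm p del)
    finally show ?thesis .
  qed
  show "proj_gap p q \<xi> \<bullet> \<eta> = \<xi> \<bullet> proj_gap p q \<eta>" for \<xi> \<eta>
    by (simp add: proj_gap_def inner_diff_left inner_diff_right orthogonal_projection_inner p q)
qed (fact del)+

lemma gap_bound: "norm (proj_gap p q \<xi>) \<le> \<delta> * norm \<xi>"
  by (rule bound)

lemma gap_eq: "p \<xi> = \<xi> \<Longrightarrow> \<xi> - proj_gap p q \<xi> = p (q \<xi>)"
  by (simp add: proj_gap_def)

lemma p_R: "p (R \<xi>) = R (p \<xi>)"
  by (rule R_commute[OF orthogonal_projection_bounded_linear[OF p]]) (simp add: proj_gap_def p_diff)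

lemma R_range: "\<xi> \<in> range p \<Longrightarrow> R \<xi> \<in> range p"
  by (simp add: p_range p_R)

text \<open>By \<open>gap_eq\<close> the operator 1 - D acts as pq on the range of p, and R
  preserves that range. This lemma and the next two are the three positions of pq relative to the
  two factors R that invert it.\<close>

lemma pq_R_R: "\<xi> \<in> range p \<Longrightarrow> p (q (R (R \<xi>))) = \<xi>"
  using R_R[of \<xi>] gap_eq[of "R (R \<xi>)"] by (simp add: p_range p_R)

lemma R_pq_R: "\<xi> \<in> range p \<Longrightarrow> R (p (q (R \<xi>))) = \<xi>"
  using R_1_R[of \<xi>] gap_eq[of "R \<xi>"] by (simp add: p_range p_R)

lemma R_R_pq: "\<xi> \<in> range p \<Longrightarrow> R (R (p (q \<xi>))) = \<xi>"
  using R_R_1[of \<xi>] gap_eq[of "\<xi>"] by (simp add: p_range p_R)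

text \<open>The real part is real self-adjointness. The imaginary part is the same fact with the
  second argument multiplied by the imaginary unit, with which R commutes.\<close>

lemma cinner_R: "cinner (R \<xi>) \<eta> = cinner \<xi> (R \<eta>)"
  by (simp add: complex_eq_iff Re_cinner Im_cinner R_selfadj R_scaleC)

text \<open>On the range of \<open>p\<close> the operator \<open>p q R\<close> inverts \<open>R\<close>, so it is the square root of \<open>p q p\<close>.\<close>

lemma pqR_positive: "positive_operator_on (range p) (\<lambda>\<xi>. if \<xi> \<in> range p then p (q (R \<xi>)) else 0)"
proof -
  note sub = closed_csubspace_range_projection[OF p]
  have "cinner \<xi> (p (q (R \<xi>))) \<in> \<real> \<and> 0 \<le> Re (cinner \<xi> (p (q (R \<xi>))))" if "\<xi> \<in> range p" for \<xi>
  proof -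
    \<comment> \<open>With this vector \<xi> = R \<eta>, so the quadratic form of pqR at \<xi>
      becomes that of R at \<eta>, whose sign is known.\<close>
    define \<eta> where "\<eta> = p (q (R \<xi>))"
    have \<xi>: "\<xi> = R \<eta>"
      using R_pq_R[OF that] by (simp add: \<eta>_def)
    have "cinner \<xi> \<eta> = cnj (cinner \<xi> \<eta>)"
      using cinner_R[of \<eta> \<eta>] cinner_commute[of \<eta> \<xi>] \<xi> by simp
    then have "cinner \<xi> \<eta> \<in> \<real>"
      by (simp add: Reals_cnj_iff)
    moreover have "0 \<le> (1 - 2 * \<delta>) * (norm \<eta>)\<^sup>2"
      using delta by simp
    then have "0 \<le> (1 - \<delta>) * (\<eta> \<bullet> R \<eta>)"
      using R_positive[of \<eta>] by linarith
    then have "0 \<le> \<xi> \<bullet> \<eta>"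
      using delta \<xi> by (simp add: zero_le_mult_iff inner_commute)
    ultimately show ?thesis
      by (simp add: Re_cinner flip: \<eta>_def)
  qed
  moreover have "norm (p (q (R \<xi>))) \<le> 1 / (1 - \<delta>) * norm \<xi>" for \<xi>
    using orthogonal_projection_norm[OF p, of "q (R \<xi>)"] orthogonal_projection_norm[OF q, of "R \<xi>"]
      R_bound[of \<xi>] by simp
  moreover have "clinear_on (range p) (\<lambda>\<xi>. if \<xi> \<in> range p then p (q (R \<xi>)) else 0)"
    using sub orthogonal_projection_clinear[OF p] orthogonal_projection_clinear[OF q]
    by (auto simp: clinear_on_def R_add R_scaleC closed_csubspace_def complex_vector.subspace_def)
  ultimately show ?thesis
    by (auto simp: positive_operator_on_def intro!: exI[of _ "1 / (1 - \<delta>)"])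
qed

text \<open>A square root B commutes with its own square, hence with the gap and with R. As B and
  pqR commute and have equal squares, the difference \<zeta> of their values at \<xi> satisfies B
  \<zeta> = -pqR \<zeta>. Positivity of B and strict positivity of R then have opposite signs unless
  \<zeta> = 0.\<close>

lemma positive_sqrt_unique:
  assumes "positive_operator_on (range p) B" and sq: "\<forall>\<xi>\<in>range p. B (B \<xi>) = (p \<circ> q \<circ> p) \<xi>"
    and \<xi>: "\<xi> \<in> range p"
  shows "B \<xi> = p (q (R \<xi>))"
proof -
  obtain K where lin: "clinear_on (range p) B" and B_range: "\<And>\<xi>. \<xi> \<in> range p \<Longrightarrow> B \<xi> \<in> range p"
    and K: "\<And>\<xi>. \<xi> \<in> range p \<Longrightarrow> norm (B \<xi>) \<le> K * norm \<xi>"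
    and pos: "\<And>\<xi>. \<xi> \<in> range p \<Longrightarrow> 0 \<le> \<xi> \<bullet> B \<xi>"
    using assms(1) unfolding positive_operator_on_def Re_cinner by blast
  have pB: "p (B (p \<eta>)) = B (p \<eta>)" for \<eta>
    using B_range p_range by blast
  have K': "norm (B (p \<eta>)) \<le> norm \<eta> * \<bar>K\<bar>" for \<eta>
  proof -
    have "norm (B (p \<eta>)) \<le> K * norm (p \<eta>)"
      by (simp add: K)
    also have "\<dots> \<le> \<bar>K\<bar> * norm \<eta>"
      by (intro mult_mono orthogonal_projection_norm[OF p]) auto
    finally show ?thesis by (simp add: mult.commute)
  qed
  \<comment> \<open>\<open>B\<close> is controlled only on the range of p. Precomposing with p gives
    a bounded linear map on the whole space, to which \<open>R_commute\<close> applies.\<close>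
  have bl: "bounded_linear (\<lambda>\<eta>. B (p \<eta>))"
    using lin linear_add[OF orthogonal_projection_linear[OF p]]
      linear_scale[OF orthogonal_projection_linear[OF p]]
    using lin by (intro bounded_linear_intro[OF _ _ K'])
       (simp_all add: clinear_on_scaleR[OF lin] clinear_on_def)
  have B_diff: "B (\<eta> - \<zeta>) = B \<eta> - B \<zeta>" if "\<eta> \<in> range p" "\<zeta> \<in> range p" for \<eta> \<zeta>
    using linear_diff[OF bounded_linear.linear[OF bl], of \<eta> \<zeta>] that by (simp add: p_range p_diff)
  \<comment> \<open>Both sides are the third power of \<open>B\<close>, bracketed in two
    ways.\<close>
  have B_comm: "B (p (q \<eta>)) = p (q (B \<eta>))" if "\<eta> \<in> range p" for \<eta>
  proof -
    have "B (B (B \<eta>)) = p (q (B \<eta>))"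
      using bspec[OF sq B_range[OF that]] B_range[OF that] by (simp add: p_range)
    moreover have "B (B \<eta>) = p (q \<eta>)"
      using bspec[OF sq that] that by (simp add: p_range)
    ultimately show ?thesis
      by simp
  qed
  have "B (p (proj_gap p q \<eta>)) = proj_gap p q (B (p \<eta>))" for \<eta>
    by (simp add: proj_gap_def p_diff B_diff B_comm pB)
  from R_commute[OF bl this, of \<xi>] have BR: "B (R \<xi>) = R (B \<xi>)"
    using \<xi> by (simp add: p_range p_R)
  define \<zeta> where "\<zeta> = B \<xi> - p (q (R \<xi>))"
  have B\<xi>: "p (B \<xi>) = B \<xi>" "p \<xi> = \<xi>"
    using B_range[OF \<xi>] \<xi> by (simp_all add: p_range)
  have \<zeta>: "p \<zeta> = \<zeta>"
    by (simp add: \<zeta>_def p_diff B\<xi>)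
  have "B \<zeta> = p (q \<xi>) - p (q (B (R \<xi>)))"
    using bspec[OF sq \<xi>] \<xi> R_range[OF \<xi>] B_range[OF \<xi>] by (simp add: \<zeta>_def B_diff B_comm B\<xi>)
  also have "\<dots> = - p (q (R \<zeta>))"
    using pq_R_R[of "p (q \<xi>)"] R_R_pq[OF \<xi>] R_pq_R[OF \<xi>] BR
    by (simp add: \<zeta>_def R_diff q_diff p_diff)
  finally have B\<zeta>: "B \<zeta> = - p (q (R \<zeta>))" .
  \<comment> \<open>As \<zeta> = R \<eta> and B \<zeta> = -\<eta>, positivity of \<open>B\<close> at
    \<zeta> reads as nonpositivity of the form of R at \<eta>; \<open>R_positive\<close> then forces
    \<eta> = 0.\<close>
  define \<eta> where "\<eta> = p (q (R \<zeta>))"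
  have "\<zeta> = R \<eta>"
    using R_pq_R[of \<zeta>] \<zeta> unfolding \<eta>_def p_range by simp
  have "0 \<le> \<zeta> \<bullet> B \<zeta>"
    using \<zeta> by (intro pos) (simp add: p_range)
  then have "\<zeta> \<bullet> \<eta> \<le> 0"
    by (simp add: B\<zeta> flip: \<eta>_def)
  then have "\<eta> \<bullet> R \<eta> \<le> 0"
    using \<open>\<zeta> = R \<eta>\<close> by (simp add: inner_commute)
  then have "(1 - \<delta>) * (\<eta> \<bullet> R \<eta>) \<le> 0"
    using delta by (simp add: mult_nonneg_nonpos)
  with R_positive[of \<eta>] have "(1 - 2 * \<delta>) * (norm \<eta>)\<^sup>2 \<le> 0"
    by linarith
  then have "\<eta> = 0"
    using delta by (simp add: mult_le_0_iff)
  then have "\<zeta> = 0"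
    using \<open>\<zeta> = R \<eta>\<close> R_diff[of 0 0] by simp
  then show ?thesis
    by (simp add: \<zeta>_def)
qed

lemma sqrt_on_eq:
  "sqrt_on (range p) (p \<circ> q \<circ> p) = (\<lambda>\<xi>. if \<xi> \<in> range p then p (q (R \<xi>)) else 0)"
  unfolding sqrt_on_def
proof (rule the_equality, intro conjI allI ballI impI)
  fix \<xi> assume "\<xi> \<in> range p"
  then show "(if (if \<xi> \<in> range p then p (q (R \<xi>)) else 0) \<in> range p
      then p (q (R (if \<xi> \<in> range p then p (q (R \<xi>)) else 0))) else 0) = (p \<circ> q \<circ> p) \<xi>"
    using R_pq_R[of \<xi>] by (simp add: p_range)
next
  fix B
  assume B: "positive_operator_on (range p) B \<and> (\<forall>\<xi>\<in>range p. B (B \<xi>) = (p \<circ> q \<circ> p) \<xi>) \<and>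
    (\<forall>\<xi>. \<xi> \<notin> range p \<longrightarrow> B \<xi> = 0)"
  then have "B \<xi> = p (q (R \<xi>))" if "\<xi> \<in> range p" for \<xi>
    using positive_sqrt_unique that by blast
  with B show "B = (\<lambda>\<xi>. if \<xi> \<in> range p then p (q (R \<xi>)) else 0)"
    by auto
qed (use pqR_positive in auto)

lemma inv_sqrt_on_eq:
  assumes "\<eta> \<in> range p"
  shows "inv_sqrt_on (range p) (p \<circ> q \<circ> p) \<eta> = R \<eta>"
  unfolding inv_sqrt_on_def sqrt_on_eq
proof (rule inv_into_f_eq)
  show "inj_on (\<lambda>\<xi>. if \<xi> \<in> range p then p (q (R \<xi>)) else 0) (range p)"
    by (rule inj_on_inverseI[of _ R]) (use R_pq_R in auto)
qed (use assms R_range pq_R_R in auto)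

text \<open>The isometry property is the identity R pq R = 1 on the range of p, after the
  self-adjoint factors are moved to one side. Surjectivity needs the pair of projections with its
  roles exchanged.\<close>

lemma unitary: "unitary_on (range p) (range q) (\<lambda>\<eta>. q (R \<eta>))"
proof -
  \<comment> \<open>For the exchanged pair, qp is invertible on the range of q. So each of its
    elements is q applied to a vector in the range of p, and its preimage under qR can be named:
    \<open>R (p \<xi>)\<close>.\<close>
  interpret sw: near_projections q p \<delta>
    by (rule swapped)
  have "cinner (q (R \<xi>)) (q (R \<eta>)) = cinner \<xi> \<eta>" if "\<xi> \<in> range p" "\<eta> \<in> range p" for \<xi> \<eta>
  proof -
    have "cinner (q (R \<xi>)) (q (R \<eta>)) = cinner (p (R \<xi>)) (q (R \<eta>))"
      using that by (simp add: orthogonal_projection_cinner[OF q] p_R p_range)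
    also have "\<dots> = cinner \<xi> (R (p (q (R \<eta>))))"
      by (simp add: orthogonal_projection_cinner[OF p] cinner_R)
    finally show ?thesis
      using that by (simp add: R_pq_R)
  qed
  moreover have "clinear_on (range p) (\<lambda>\<eta>. q (R \<eta>))"
    using orthogonal_projection_clinear[OF q] by (simp add: clinear_on_def R_add R_scaleC)
  moreover have "\<xi> = q (R (R (p \<xi>)))" if "\<xi> \<in> range q" for \<xi>
  proof -
    define \<zeta> where "\<zeta> = sw.R (sw.R \<xi>)"
    have \<xi>: "\<xi> = q (p \<zeta>)"
      using sw.pq_R_R[OF that] by (simp add: \<zeta>_def)
    then have "R (R (p \<xi>)) = p \<zeta>"
      using R_R_pq[of "p \<zeta>"] by simp
    then show ?thesis
      using \<xi> by simp
  qed
  then have "\<xi> \<in> (\<lambda>\<eta>. q (R \<eta>)) ` range p" if "\<xi> \<in> range q" for \<xi>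
    using that R_range[of "p \<xi>"] by (intro image_eqI[of _ _ "R (p \<xi>)"]) auto
  ultimately show ?thesis
    unfolding unitary_on_def by blast
qed

lemma unitary_right_inverse:
  assumes "\<xi> \<in> range q"
  shows "q (R (R (p \<xi>))) = \<xi>"
proof -
  obtain \<eta> where \<eta>: "\<eta> \<in> range p" "\<xi> = q (R \<eta>)"
    using unitary assms unfolding unitary_on_def by blast
  then show ?thesis
    by (simp add: R_pq_R)
qed

text \<open>Formally the adjoint of qR is Rq, which is R on the range of q; compressing to the range
  of p gives Rp because R and p commute. A second candidate differs from it by a vector of the range
  of p that is orthogonal to that range. Only the values of \<open>T\<close> on the range of p are
  prescribed, since the operator built from \<open>inv_sqrt_on\<close> is known only there.\<close>

lemma adjoint_on_eq:
  assumes T: "\<And>\<eta>. \<eta> \<in> range p \<Longrightarrow> T \<eta> = q (R \<eta>)" and \<xi>: "\<xi> \<in> range q"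
  shows "adjoint_on (range p) T \<xi> = R (p \<xi>)"
  unfolding adjoint_on_def
proof (rule the_equality)
  have "cinner (R (p \<xi>)) \<eta> = cinner \<xi> (T \<eta>)" if "\<eta> \<in> range p" for \<eta>
  proof -
    have "cinner \<xi> (T \<eta>) = cinner (q \<xi>) (R \<eta>)"
      using that by (simp add: T orthogonal_projection_cinner[OF q])
    also have "\<dots> = cinner \<xi> (p (R \<eta>))"
      using that \<xi> by (simp add: q_range p_R p_range)
    finally show ?thesis
      by (simp add: orthogonal_projection_cinner[OF p] cinner_R flip: p_R)
  qed
  then show *: "R (p \<xi>) \<in> range p \<and> (\<forall>\<eta>\<in>range p. cinner (R (p \<xi>)) \<eta> = cinner \<xi> (T \<eta>))"
    using R_range by blast
  fix \<zeta> assume \<zeta>: "\<zeta> \<in> range p \<and> (\<forall>\<eta>\<in>range p. cinner \<zeta> \<eta> = cinner \<xi> (T \<eta>))"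
  have "p (\<zeta> - R (p \<xi>)) = \<zeta> - R (p \<xi>)"
    using * \<zeta> unfolding p_range p_diff by argo
  then have "\<zeta> - R (p \<xi>) \<in> range p"
    unfolding p_range .
  then have "cinner \<zeta> (\<zeta> - R (p \<xi>)) = cinner (R (p \<xi>)) (\<zeta> - R (p \<xi>))"
    using * \<zeta> by metis
  then have "cinner (\<zeta> - R (p \<xi>)) (\<zeta> - R (p \<xi>)) = 0"
    by (simp only: cinner_diff_left diff_self)
  then show "\<zeta> = R (p \<xi>)"
    by (simp add: cinner_self)
qed

end


subsection \<open>Functions of class $C^k$\<close>

lemma Ck_on_subset: "Ck_on k f S \<Longrightarrow> T \<subseteq> S \<Longrightarrow> Ck_on k f T"
  by (induction k arbitrary: f) (auto intro: continuous_on_subset)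

lemma frechet_derivative_cong_open:
  assumes "open S" "x \<in> S" "\<And>y. y \<in> S \<Longrightarrow> f y = h y"
  shows "frechet_derivative f (at x) = frechet_derivative h (at x)"
proof -
  have "(f has_derivative d) (at x) \<longleftrightarrow> (h has_derivative d) (at x)" for d
    using has_derivative_transform_within_open[of f d x UNIV S h]
      has_derivative_transform_within_open[of h d x UNIV S f] assms by auto
  then show ?thesis
    by (simp add: frechet_derivative_def)
qed

lemma Ck_on_cong:
  assumes "open S" "\<And>x. x \<in> S \<Longrightarrow> f x = h x"
  shows "Ck_on k f S \<longleftrightarrow> Ck_on k h S"
  using assms(2)
proof (induction k arbitrary: f h)
  case 0
  then show ?case
    by (simp cong: continuous_on_cong)
next
  case (Suc k)
  have d: "(f has_derivative d) (at x) \<longleftrightarrow> (h has_derivative d) (at x)" if "x \<in> S" for x d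
    using that Suc.prems assms(1) has_derivative_transform_within_open[of f d x UNIV S h]
      has_derivative_transform_within_open[of h d x UNIV S f] by auto
  moreover have "frechet_derivative f (at x) = frechet_derivative h (at x)" if "x \<in> S" for x
    using frechet_derivative_cong_open[OF assms(1) that Suc.prems] .
  ultimately show ?case
    using Suc.IH[of "\<lambda>x. frechet_derivative f (at x) _" "\<lambda>x. frechet_derivative h (at x) _"]
    by (simp add: differentiable_def)
qed

lemma smooth_on_subset: "smooth_on f S \<Longrightarrow> T \<subseteq> S \<Longrightarrow> smooth_on f T"
  by (auto simp: smooth_on_def intro: Ck_on_subset)

lemma smooth_on_cong: "open S \<Longrightarrow> (\<And>x. x \<in> S \<Longrightarrow> f x = h x) \<Longrightarrow> smooth_on f S \<longleftrightarrow> smooth_on h S"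
  unfolding smooth_on_def using Ck_on_cong by metis

lemma smooth_on_differentiable: "smooth_on f S \<Longrightarrow> x \<in> S \<Longrightarrow> f differentiable (at x)"
  unfolding smooth_on_def by (metis Ck_on.simps(2))

lemma smooth_on_frechet_derivative:
  "smooth_on f S \<Longrightarrow> smooth_on (\<lambda>x. frechet_derivative f (at x) v) S"
  unfolding smooth_on_def by (metis Ck_on.simps(2))

lemma smooth_on_continuous: "smooth_on f S \<Longrightarrow> continuous_on S f"
  unfolding smooth_on_def by (metis Ck_on.simps(1))

lemma Ck_on_1:
  "Ck_on (Suc 0) f S \<longleftrightarrow>
     (\<forall>x\<in>S. f differentiable (at x)) \<and> (\<forall>v. continuous_on S (\<lambda>x. frechet_derivative f (at x) v))"
  by simp

lemma frechet_derivative_eq: "(f has_derivative f') (at x) \<Longrightarrow> frechet_derivative f (at x) = f'"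
  by (rule frechet_derivative_at[symmetric])

lemma has_derivative_frechet: "f differentiable (at x) \<Longrightarrow> (f has_derivative frechet_derivative f (at x)) (at x)"
  by (simp add: frechet_derivative_works)

text \<open>Smoothness of the metric is given for fixed pairs of vectors only. The expansion reduces
  varying vectors to finitely many metric coefficients.\<close>

lemma bilinear_axis_expansion:
  fixes b :: "real ^ 'n \<Rightarrow> real ^ 'n \<Rightarrow> real"
  assumes "bilinear b"
  shows "b v w = (\<Sum>i\<in>UNIV. \<Sum>j\<in>UNIV. v $ i * w $ j * b (axis i 1) (axis j 1))"
proof -
  have *: "v = (\<Sum>i\<in>UNIV. v $ i *\<^sub>R axis i 1)" for v :: "real ^ 'n"
    using basis_expansion[of v] by (simp add: scalar_mult_eq_scaleR)
  have "b v w = b (\<Sum>i\<in>UNIV. v $ i *\<^sub>R axis i 1) (\<Sum>j\<in>UNIV. w $ j *\<^sub>R axis j 1)"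
    by (simp flip: *)
  also have "\<dots> = (\<Sum>i\<in>UNIV. \<Sum>j\<in>UNIV. b (v $ i *\<^sub>R axis i 1) (w $ j *\<^sub>R axis j 1))"
    by (simp add: bilinear_sum[OF assms] sum.cartesian_product)
  also have "\<dots> = (\<Sum>i\<in>UNIV. \<Sum>j\<in>UNIV. v $ i * w $ j * b (axis i 1) (axis j 1))"
    by (simp add: bilinear_lmul[OF assms] bilinear_rmul[OF assms] mult_ac)
  finally show ?thesis .
qed


subsection \<open>Strongly differentiable families applied to vector functions\<close>

text \<open>Strong convergence and a uniform bound allow the argument to move: replacing
  \<open>w u\<close> by \<open>w0\<close> costs at most \<open>K * norm (w u - w0)\<close>.\<close>

lemma tendsto_strong_apply:
  fixes \<Phi> :: "'a \<Rightarrow> 'b::real_normed_vector \<Rightarrow> 'c::real_normed_vector"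
  assumes lin: "eventually (\<lambda>u. linear (\<Phi> u)) F"
    and bound: "eventually (\<lambda>u. \<forall>\<eta>. norm (\<Phi> u \<eta>) \<le> K * norm \<eta>) F"
    and w: "(w \<longlongrightarrow> w0) F" and \<Phi>: "((\<lambda>u. \<Phi> u w0) \<longlongrightarrow> l) F"
  shows "((\<lambda>u. \<Phi> u (w u)) \<longlongrightarrow> l) F"
proof -
  have "((\<lambda>u. K * norm (w u - w0)) \<longlongrightarrow> K * norm (w0 - w0)) F"
    by (intro tendsto_intros w)
  then have lim: "((\<lambda>u. K * norm (w u - w0)) \<longlongrightarrow> 0) F"
    by simp
  have "eventually (\<lambda>u. norm (\<Phi> u (w u) - \<Phi> u w0) \<le> K * norm (w u - w0)) F"
    using lin bound by eventually_elim (metis linear_diff)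
  from Lim_null_comparison[OF this lim] have "((\<lambda>u. \<Phi> u (w u) - \<Phi> u w0) \<longlongrightarrow> 0) F" .
  from tendsto_add[OF this \<Phi>] show ?thesis
    by simp
qed

text \<open>The product rule without norm differentiability. The increment of \<open>w\<close> is
  split into its linear part and an error; the uniform bound handles the error. On the linear part
  the operators \<Phi> u and \<Phi> x are compared only at the images of finitely many basis
  vectors, so strong continuity suffices.\<close>

lemma has_derivative_strong_apply:
  fixes \<Phi> :: "'a::euclidean_space \<Rightarrow> 'b::real_normed_vector \<Rightarrow> 'c::real_normed_vector"
  assumes lin: "eventually (\<lambda>u. linear (\<Phi> u)) (nhds x)"
    and bound: "eventually (\<lambda>u. \<forall>\<eta>. norm (\<Phi> u \<eta>) \<le> K * norm \<eta>) (nhds x)"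
    and w: "(w has_derivative w') (at x)"
    and d: "((\<lambda>u. \<Phi> u (w x)) has_derivative d) (at x)"
    and cont: "\<And>\<eta>. isCont (\<lambda>u. \<Phi> u \<eta>) x"
  shows "((\<lambda>u. \<Phi> u (w u)) has_derivative (\<lambda>h. d h + \<Phi> x (w' h))) (at x)"
proof -
  have lin': "eventually (\<lambda>u. linear (\<Phi> u)) (at x)"
    and bound': "eventually (\<lambda>u. \<forall>\<eta>. norm (\<Phi> u \<eta>) \<le> K * norm \<eta>) (at x)"
    using lin bound by (auto simp: eventually_at_filter elim: eventually_mono)
  have linx: "linear (\<Phi> x)"
    using lin by (rule eventually_nhds_x_imp_x)
  have boundx: "norm (\<Phi> x \<eta>) \<le> K * norm \<eta>" for \<eta>
    using eventually_nhds_x_imp_x[OF bound] by blast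
  have blx: "bounded_linear (\<Phi> x)"
    using linx boundx by (auto simp: bounded_linear_def bounded_linear_axioms_def mult.commute)
  have w'lin: "bounded_linear w'"
    using w by (rule has_derivative_bounded_linear)
  let ?err = "\<lambda>u. norm (w u - w x - w' (u - x)) / norm (u - x)"
  \<comment> \<open>The oscillation of the family on the images of the basis vectors; it tends to 0
    as a finite sum of strongly continuous terms.\<close>
  let ?osc = "\<lambda>u. \<Sum>b\<in>Basis. norm (\<Phi> u (w' b) - \<Phi> x (w' b))"
  have "(?err \<longlongrightarrow> 0) (at x)"
    using w by (simp add: has_derivative_iff_norm)
  moreover have "(?osc \<longlongrightarrow> (\<Sum>b\<in>(Basis::'a set). norm (\<Phi> x (w' b) - \<Phi> x (w' b)))) (at x)"
    by (intro tendsto_intros cont[unfolded isCont_def])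
  ultimately have lim: "((\<lambda>u. K * ?err u + ?osc u) \<longlongrightarrow> K * 0 + (\<Sum>b\<in>(Basis::'a set). norm (\<Phi> x (w' b) - \<Phi> x (w' b)))) (at x)"
    by (intro tendsto_add tendsto_mult tendsto_const)
  have "eventually (\<lambda>u. norm (norm (\<Phi> u (w u - w x) - \<Phi> x (w' (u - x))) / norm (u - x)) \<le> K * ?err u + ?osc u) (at x)"
    using lin' bound' eventually_neq_at_within[of x x UNIV]
  proof eventually_elim
    case (elim u)
    have "w' (u - x) = (\<Sum>b\<in>Basis. ((u - x) \<bullet> b) *\<^sub>R w' b)"
      using linear_sum[OF bounded_linear.linear[OF w'lin], of "\<lambda>b. ((u - x) \<bullet> b) *\<^sub>R b" Basis]
      by (simp add: linear_scale[OF bounded_linear.linear[OF w'lin]] euclidean_representation)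
    then have "\<Phi> u (w' (u - x)) - \<Phi> x (w' (u - x)) =
        (\<Sum>b\<in>Basis. ((u - x) \<bullet> b) *\<^sub>R (\<Phi> u (w' b) - \<Phi> x (w' b)))"
      by (simp add: linear_sum[OF linx] linear_sum[OF elim(1)] linear_scale[OF linx]
          linear_scale[OF elim(1)] scaleR_diff_right sum_subtractf)
    also have "norm \<dots> \<le> (\<Sum>b\<in>Basis. norm (u - x) * norm (\<Phi> u (w' b) - \<Phi> x (w' b)))"
      by (intro sum_norm_le) (auto intro!: mult_right_mono Basis_le_norm)
    finally have 1: "norm (\<Phi> u (w' (u - x)) - \<Phi> x (w' (u - x))) \<le> norm (u - x) * ?osc u"
      by (simp add: sum_distrib_left)
    have "norm (\<Phi> u (w u - w x) - \<Phi> x (w' (u - x)))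
      = norm (\<Phi> u (w u - w x - w' (u - x)) + (\<Phi> u (w' (u - x)) - \<Phi> x (w' (u - x))))"
      by (simp add: linear_diff[OF elim(1)])
    also have "\<dots> \<le> K * norm (w u - w x - w' (u - x)) + norm (u - x) * ?osc u"
      using elim(2) 1 norm_triangle_ineq by (smt (verit, best))
    finally show ?case
      using elim(3) by (simp add: divide_simps) (simp add: algebra_simps)
  qed
  then have "((\<lambda>u. norm (\<Phi> u (w u - w x) - \<Phi> x (w' (u - x))) / norm (u - x)) \<longlongrightarrow> 0) (at x)"
    by (rule Lim_null_comparison) (use lim in simp)
  then have "((\<lambda>u. \<Phi> u (w u - w x)) has_derivative (\<lambda>h. \<Phi> x (w' h))) (at x)"
    using bounded_linear_compose[OF blx w'lin] linear_0[OF linx] by (simp add: has_derivative_iff_norm)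
  from has_derivative_add[OF d this]
  have *: "((\<lambda>u. \<Phi> u (w x) + \<Phi> u (w u - w x)) has_derivative (\<lambda>h. d h + \<Phi> x (w' h))) (at x)" .
  have "eventually (\<lambda>u. \<Phi> u (w x) + \<Phi> u (w u - w x) = \<Phi> u (w u)) (nhds x)"
    using lin by eventually_elim (simp add: linear_diff)
  then show ?thesis
    using has_derivative_transform_eventually[OF *, of "\<lambda>u. \<Phi> u (w u)"] eventually_at_filter
      eventually_nhds_x_imp_x by (smt (verit, best) UNIV_I eventually_mono)
qed


subsection \<open>Derivatives on a Riemannian manifold\<close>

abbreviation chart_inv :: "('m, 'n) chart \<Rightarrow> real ^ 'n \<Rightarrow> 'm" where
  "chart_inv c \<equiv> inv_into (fst c) (snd c)"

locale smooth_manifold =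
  fixes A :: "('m::t2_space, 'n::finite) chart set"
  assumes atlas: "smooth_atlas A"
begin

lemma chart_open: "c \<in> A \<Longrightarrow> open (fst c)"
  using atlas by (auto simp: smooth_atlas_def)

lemma chart_image_open: "c \<in> A \<Longrightarrow> open (snd c ` fst c)"
  using atlas by (auto simp: smooth_atlas_def)

lemma chart_homeomorphism: "c \<in> A \<Longrightarrow> homeomorphism (fst c) (snd c ` fst c) (snd c) (chart_inv c)"
  using atlas by (auto simp: smooth_atlas_def)

lemma chart_inv_chart: "c \<in> A \<Longrightarrow> y \<in> fst c \<Longrightarrow> chart_inv c (snd c y) = y"
  using chart_homeomorphism by (simp add: homeomorphism_def)

lemma chart_chart_inv: "u \<in> snd c ` fst c \<Longrightarrow> snd c (chart_inv c u) = u"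
  by (rule f_inv_into_f)

lemma chart_inv_mem: "u \<in> snd c ` fst c \<Longrightarrow> chart_inv c u \<in> fst c"
  by (rule inv_into_into)

lemma chart_inv_isCont: "c \<in> A \<Longrightarrow> u \<in> snd c ` fst c \<Longrightarrow> isCont (chart_inv c) u"
  using chart_homeomorphism chart_image_open
  by (auto simp: homeomorphism_def continuous_on_eq_continuous_at)

lemma chart_isCont: "c \<in> A \<Longrightarrow> y \<in> fst c \<Longrightarrow> isCont (snd c) y"
  using chart_homeomorphism chart_open
  by (auto simp: homeomorphism_def continuous_on_eq_continuous_at)

lemma chart_inv_image_mem: "c \<in> A \<Longrightarrow> u \<in> snd c ` (D \<inter> fst c) \<Longrightarrow> chart_inv c u \<in> D \<inter> fst c"
  using chart_inv_chart by fastforce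

lemma chart_image_Int_open:
  assumes "c \<in> A" "open D"
  shows "open (snd c ` (D \<inter> fst c))"
proof -
  have "snd c ` (D \<inter> fst c) = (snd c ` fst c) \<inter> chart_inv c -` D"
    using chart_inv_chart[OF assms(1)] by (auto simp: image_iff)
  moreover have "open ((snd c ` fst c) \<inter> chart_inv c -` D)"
    using chart_homeomorphism[OF assms(1)] chart_image_open[OF assms(1)] assms(2)
    by (intro continuous_open_preimage) (auto simp: homeomorphism_def)
  ultimately show ?thesis by simp
qed

lemma transition_smooth:
  "c \<in> A \<Longrightarrow> c' \<in> A \<Longrightarrow> smooth_on (snd c' \<circ> chart_inv c) (snd c ` (fst c \<inter> fst c'))"
  using atlas by (force simp: smooth_atlas_def)

lemma chart_at: "chart_at A y \<in> A" "y \<in> fst (chart_at A y)"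
proof -
  have "\<exists>c. c \<in> A \<and> y \<in> fst c"
    using atlas unfolding smooth_atlas_def by blast
  then have "chart_at A y \<in> A \<and> y \<in> fst (chart_at A y)"
    unfolding chart_at_def by (rule someI_ex)
  then show "chart_at A y \<in> A" "y \<in> fst (chart_at A y)"
    by simp_all
qed

lemma mderiv_eq:
  "mderiv A f y = frechet_derivative (f \<circ> chart_inv (chart_at A y)) (at (snd (chart_at A y) y))"
  by (simp add: mderiv_def case_prod_beta)

definition mdiff :: "('m \<Rightarrow> 'b::real_normed_vector) \<Rightarrow> 'm \<Rightarrow> bool" where
  "mdiff f y \<longleftrightarrow> f \<circ> chart_inv (chart_at A y) differentiable (at (snd (chart_at A y) y))"

lemma mderiv_bounded_linear: "mdiff f y \<Longrightarrow> bounded_linear (mderiv A f y)"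
  unfolding mdiff_def mderiv_eq by (rule has_derivative_bounded_linear[OF has_derivative_frechet])

lemma mderiv_linear: "mdiff f y \<Longrightarrow> linear (mderiv A f y)"
  using mderiv_bounded_linear bounded_linear.linear by blast

text \<open>Continuity is part of the notion because the coordinate expression describes
  \<open>h\<close> near \<open>a\<close> only if \<open>h\<close> stays in the domain of the
  preferred chart at \<open>h a\<close>. The chain rule relies on this.\<close>

definition pdiff :: "('a::real_normed_vector \<Rightarrow> 'm) \<Rightarrow> 'a \<Rightarrow> bool" where
  "pdiff h a \<longleftrightarrow> isCont h a \<and> (snd (chart_at A (h a)) \<circ> h) differentiable (at a)"

lemma pderiv_linear: "pdiff h a \<Longrightarrow> linear (pderiv A h a)"
  unfolding pdiff_def pderiv_def
  by (rule bounded_linear.linear[OF has_derivative_bounded_linear[OF has_derivative_frechet]]) simp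

lemma has_derivative_chain:
  assumes h: "pdiff h a" and f: "mdiff f (h a)"
  shows "((\<lambda>x. f (h x)) has_derivative (\<lambda>v. mderiv A f (h a) (pderiv A h a v))) (at a)"
proof -
  let ?c = "chart_at A (h a)"
  have 1: "(snd ?c \<circ> h has_derivative pderiv A h a) (at a)"
    using h has_derivative_frechet unfolding pdiff_def pderiv_def by blast
  have "(f \<circ> chart_inv ?c has_derivative mderiv A f (h a)) (at ((snd ?c \<circ> h) a))"
    using f has_derivative_frechet unfolding mdiff_def mderiv_eq o_apply by blast
  from diff_chain_at[OF 1 this]
  have d: "((f \<circ> chart_inv ?c) \<circ> (snd ?c \<circ> h) has_derivative (\<lambda>v. mderiv A f (h a) (pderiv A h a v))) (at a)"
    by (simp add: o_def)
  obtain S where S: "open S" "a \<in> S" "\<And>x. x \<in> S \<Longrightarrow> h x \<in> fst ?c"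
    using h chart_at[of "h a"] chart_open[of ?c] unfolding pdiff_def continuous_at_open
    by meson
  show ?thesis
    by (rule has_derivative_transform_within_open[OF d S(1,2)])
       (simp add: S(3) chart_inv_chart chart_at)
qed

lemma chart_inv_pdiff:
  assumes "c \<in> A" "u \<in> snd c ` fst c"
  shows "pdiff (chart_inv c) u"
  unfolding pdiff_def
proof
  let ?c = "chart_at A (chart_inv c u)"
  have "u \<in> snd c ` (fst c \<inter> fst ?c)"
    using assms chart_at(2)[of "chart_inv c u"] chart_chart_inv[OF assms(2)] chart_inv_mem
    by (metis IntI image_eqI)
  then show "snd ?c \<circ> chart_inv c differentiable (at u)"
    using transition_smooth[OF assms(1) chart_at(1)] smooth_on_differentiable by blast
qed (rule chart_inv_isCont[OF assms])

definition C1_on :: "'m set \<Rightarrow> ('m \<Rightarrow> 'b::real_normed_vector) \<Rightarrow> bool" where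
  "C1_on D f \<longleftrightarrow> (\<forall>c\<in>A. Ck_on 1 (f \<circ> chart_inv c) (snd c ` (D \<inter> fst c)))"

lemma strongly_differentiable_on_iff:
  "strongly_differentiable_on A D E F \<longleftrightarrow> (\<forall>\<xi>\<in>E. C1_on D (\<lambda>z. F z \<xi>))"
  by (simp only: strongly_differentiable_on_def C1_on_def o_def case_prod_unfold)

lemma C1_on_subset: "C1_on D f \<Longrightarrow> D' \<subseteq> D \<Longrightarrow> C1_on D' f"
  unfolding C1_on_def by (blast intro: Ck_on_subset)

lemma C1_on_cong:
  assumes "open D" "\<And>z. z \<in> D \<Longrightarrow> f z = h z"
  shows "C1_on D f \<longleftrightarrow> C1_on D h"
proof -
  have "Ck_on 1 (f \<circ> chart_inv c) (snd c ` (D \<inter> fst c)) \<longleftrightarrow> Ck_on 1 (h \<circ> chart_inv c) (snd c ` (D \<inter> fst c))"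
    if "c \<in> A" for c
    using assms that chart_inv_image_mem[OF that, of _ D] chart_image_Int_open[OF that assms(1)]
    by (intro Ck_on_cong) auto
  then show ?thesis
    by (simp add: C1_on_def)
qed

lemma C1_on_mdiff:
  assumes "C1_on D f" "z \<in> D"
  shows "mdiff f z"
proof -
  have "snd (chart_at A z) z \<in> snd (chart_at A z) ` (D \<inter> fst (chart_at A z))"
    using assms(2) chart_at[of z] by blast
  then show ?thesis
    using assms(1) chart_at(1)[of z] unfolding C1_on_def mdiff_def One_nat_def Ck_on_1 by blast
qed

lemma C1_on_has_derivative:
  assumes "C1_on D f" "c \<in> A" "u \<in> snd c ` (D \<inter> fst c)"
  shows "(f \<circ> chart_inv c has_derivative (\<lambda>v. mderiv A f (chart_inv c u) (pderiv A (chart_inv c) u v))) (at u)"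
proof -
  have "pdiff (chart_inv c) u" "mdiff f (chart_inv c u)"
    using chart_inv_image_mem[OF assms(2,3)] C1_on_mdiff[OF assms(1)] assms(2,3)
    by (auto intro: chart_inv_pdiff)
  from has_derivative_chain[OF this] show ?thesis
    by (simp add: o_def)
qed

lemma C1_on_continuous_derivative:
  assumes "C1_on D f" "c \<in> A"
  shows "continuous_on (snd c ` (D \<inter> fst c)) (\<lambda>u. mderiv A f (chart_inv c u) (pderiv A (chart_inv c) u v))"
proof -
  have "continuous_on (snd c ` (D \<inter> fst c)) (\<lambda>u. frechet_derivative (f \<circ> chart_inv c) (at u) v)"
    using assms unfolding C1_on_def One_nat_def Ck_on_1 by blast
  then show ?thesis
    by (rule continuous_on_eq) (simp add: frechet_derivative_eq[OF C1_on_has_derivative[OF assms]])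
qed

lemma C1_onI:
  assumes "\<And>c u. c \<in> A \<Longrightarrow> u \<in> snd c ` (D \<inter> fst c) \<Longrightarrow> (f \<circ> chart_inv c has_derivative f' c u) (at u)"
    and "\<And>c v. c \<in> A \<Longrightarrow> continuous_on (snd c ` (D \<inter> fst c)) (\<lambda>u. f' c u v)"
  shows "C1_on D f"
  unfolding C1_on_def
proof
  fix c assume c: "c \<in> A"
  have "continuous_on (snd c ` (D \<inter> fst c)) (\<lambda>u. frechet_derivative (f \<circ> chart_inv c) (at u) v)" for v
    by (rule continuous_on_eq[OF assms(2)[OF c, of v]]) (simp add: frechet_derivative_eq[OF assms(1)[OF c]])
  then show "Ck_on 1 (f \<circ> chart_inv c) (snd c ` (D \<inter> fst c))"
    using assms(1)[OF c] unfolding One_nat_def Ck_on_1 differentiable_def by blast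
qed

lemma mderiv_unique:
  assumes "(f \<circ> chart_inv (chart_at A z) has_derivative f') (at (snd (chart_at A z) z))"
  shows "mderiv A f z = f'"
  unfolding mderiv_eq by (rule frechet_derivative_eq[OF assms])

lemma mdiff_has_derivative:
  "mdiff f z \<Longrightarrow> (f \<circ> chart_inv (chart_at A z) has_derivative mderiv A f z) (at (snd (chart_at A z) z))"
  unfolding mdiff_def mderiv_eq by (rule has_derivative_frechet)

lemma chart_isCont_compose:
  assumes "c \<in> A" "z \<in> fst c" "isCont (f \<circ> chart_inv c) (snd c z)"
  shows "isCont f z"
proof -
  have "isCont (\<lambda>y. (f \<circ> chart_inv c) (snd c y)) z"
    by (rule isCont_o2[OF chart_isCont[OF assms(1,2)] assms(3)])
  moreover have "eventually (\<lambda>y. (f \<circ> chart_inv c) (snd c y) = f y) (nhds z)"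
    unfolding eventually_nhds using chart_open[OF assms(1)] assms(2)
    by (intro exI[of _ "fst c"]) (simp add: chart_inv_chart[OF assms(1)])
  ultimately show ?thesis
    by (simp add: isCont_cong)
qed

lemma C1_on_isCont:
  assumes "C1_on D f" "z \<in> D"
  shows "isCont f z"
  using has_derivative_continuous[OF mdiff_has_derivative[OF C1_on_mdiff[OF assms]]]
  by (rule chart_isCont_compose[OF chart_at])

lemma mderiv_cong:
  assumes "open D" "z \<in> D" "\<And>y. y \<in> D \<Longrightarrow> f y = h y"
  shows "mderiv A f z = mderiv A h z"
  unfolding mderiv_eq
  by (rule frechet_derivative_cong_open[OF chart_image_Int_open[OF chart_at(1)[of z] assms(1)]])
     (use chart_at[of z] assms(2,3) chart_inv_image_mem[OF chart_at(1)[of z], of _ D] in \<open>auto simp: o_def\<close>)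

end

section \<open>Orthonormal frames and local comparison of norms\<close>

lemma riemannian_metric_nonneg: "riemannian_metric A g \<Longrightarrow> 0 \<le> g y v v"
  unfolding riemannian_metric_def bilinear_def by (metis linear_0 order_less_imp_le order_refl)

locale riemannian_manifold = smooth_manifold A
  for A :: "('m::t2_space, 'n::finite) chart set" +
  fixes g :: "('m, 'n) metric" and e :: "'m \<Rightarrow> 'n \<Rightarrow> real ^ 'n"
  assumes metric: "riemannian_metric A g" and frame: "orthonormal_frame g e"
begin

lemma g_bilinear: "bilinear (g y)"
  and g_sym: "g y v w = g y w v"
  and g_pos: "v \<noteq> 0 \<Longrightarrow> 0 < g y v v"
  using metric by (auto simp: riemannian_metric_def)

lemma g_nonneg: "0 \<le> g y v v"
  by (rule riemannian_metric_nonneg[OF metric])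

lemma frame_inner: "g y (e y i) (e y j) = (if i = j then 1 else 0)"
  using frame unfolding orthonormal_frame_def by blast

lemma frame_combination_inner:
  "g y (\<Sum>i\<in>UNIV. v $ i *\<^sub>R e y i) (\<Sum>j\<in>UNIV. w $ j *\<^sub>R e y j) = v \<bullet> w"
proof -
  have "g y (\<Sum>i\<in>UNIV. v $ i *\<^sub>R e y i) (\<Sum>j\<in>UNIV. w $ j *\<^sub>R e y j) =
      (\<Sum>i\<in>UNIV. \<Sum>j\<in>UNIV. v $ i * (w $ j * g y (e y i) (e y j)))"
    by (simp add: bilinear_sum[OF g_bilinear] sum.cartesian_product bilinear_lmul[OF g_bilinear]
        bilinear_rmul[OF g_bilinear] mult_ac)
  also have "\<dots> = (\<Sum>i\<in>UNIV. v $ i * w $ i)"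
    by (simp add: frame_inner if_distrib cong: if_cong)
  finally show ?thesis
    by (simp add: inner_vec_def)
qed

lemma frame_combination_linear: "linear (\<lambda>v. \<Sum>i\<in>UNIV. v $ i *\<^sub>R e y i)"
  by (intro linearI) (simp_all add: scaleR_add_left sum.distrib scaleR_sum_right)

lemma frame_combination_norm: "metric_norm g y (\<Sum>i\<in>UNIV. v $ i *\<^sub>R e y i) = norm v"
  by (simp add: metric_norm_def frame_combination_inner norm_eq_sqrt_inner)

lemma frame_combination_bij: "bij (\<lambda>v. \<Sum>i\<in>UNIV. v $ i *\<^sub>R e y i)"
proof -
  let ?T = "\<lambda>v. \<Sum>i\<in>UNIV. v $ i *\<^sub>R e y i"
  have "v = 0" if "?T v = 0" for v
    using frame_combination_norm[of y v] that bilinear_lzero[OF g_bilinear] by (simp add: metric_norm_def)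
  then have "inj ?T"
    by (simp add: linear_injective_0[OF frame_combination_linear])
  moreover have "surj ?T"
    by (rule linear_inj_imp_surj[OF frame_combination_linear calculation])
  ultimately show ?thesis
    by (simp add: bij_def)
qed

text \<open>Cauchy-Schwarz in the coordinates of the orthonormal frame: the Hilbert-Schmidt norm
  dominates the operator norm.\<close>

lemma cotensor_norm_bound:
  assumes L: "linear L"
  shows "norm (L v) \<le> cotensor_norm e y L * metric_norm g y v"
proof -
  obtain w where v: "v = (\<Sum>i\<in>UNIV. w $ i *\<^sub>R e y i)"
    using frame_combination_bij[of y] unfolding bij_def surj_def by blast
  have "norm (L v) = norm (\<Sum>i\<in>UNIV. w $ i *\<^sub>R L (e y i))"
    by (simp add: v linear_sum[OF L] linear_scale[OF L])
  also have "\<dots> \<le> (\<Sum>i\<in>UNIV. \<bar>w $ i\<bar> * \<bar>norm (L (e y i))\<bar>)"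
    by (intro sum_norm_le) simp
  also have "\<dots> \<le> L2_set (\<lambda>i. w $ i) UNIV * L2_set (\<lambda>i. norm (L (e y i))) UNIV"
    by (rule L2_set_mult_ineq)
  also have "L2_set (\<lambda>i. w $ i) UNIV = norm w"
    by (simp add: norm_vec_def L2_set_def)
  finally show ?thesis
    by (simp add: v frame_combination_norm cotensor_norm_def L2_set_def mult.commute)
qed

lemma metric_coord_eq:
  "metric_coord A g c u v w = g (chart_inv c u) (pderiv A (chart_inv c) u v) (pderiv A (chart_inv c) u w)"
  by (simp add: metric_coord_def Let_def)

lemma metric_coord_bilinear:
  assumes "pdiff (chart_inv c) u"
  shows "bilinear (metric_coord A g c u)"
proof -
  note lin = pderiv_linear[OF assms]
  show ?thesis
    using g_bilinear[of "chart_inv c u"] linear_compose[OF lin]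
    unfolding bilinear_def metric_coord_eq o_def by blast
qed

lemma metric_coord_smooth: "c \<in> A \<Longrightarrow> smooth_on (\<lambda>u. metric_coord A g c u v w) (snd c ` fst c)"
  using metric unfolding riemannian_metric_def by blast

text \<open>Derivative bounds are measured with the metric, whereas continuity of derivatives is
  tested with fixed coordinate vectors. The absolute values of the metric coefficients have a
  continuous sum \<open>?M\<close>, which stays below its value at \<open>u0\<close> plus 1 on a
  small ball; \<open>B\<close> is the square root of that number.\<close>

lemma local_metric_bound:
  assumes "c \<in> A" "open D" "u0 \<in> snd c ` (D \<inter> fst c)"
  obtains \<epsilon> B where "0 < \<epsilon>" "0 \<le> B" "ball u0 \<epsilon> \<subseteq> snd c ` (D \<inter> fst c)"
    "\<And>u v. u \<in> ball u0 \<epsilon> \<Longrightarrow> metric_norm g (chart_inv c u) (pderiv A (chart_inv c) u v) \<le> B * norm v"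
proof -
  let ?M = "\<lambda>u. \<Sum>i\<in>UNIV. \<Sum>j\<in>UNIV. \<bar>metric_coord A g c u (axis i 1) (axis j 1)\<bar>"
  let ?S = "snd c ` (D \<inter> fst c)"
  have S: "open ?S"
    by (rule chart_image_Int_open[OF assms(1,2)])
  have "continuous_on ?S ?M"
    by (intro continuous_intros continuous_on_subset[OF smooth_on_continuous[OF metric_coord_smooth[OF assms(1)]]]) auto
  then have "open (?M -` {..< ?M u0 + 1} \<inter> ?S)"
    using continuous_on_open_vimage[OF S] open_lessThan by blast
  then obtain \<epsilon> where \<epsilon>: "0 < \<epsilon>" "ball u0 \<epsilon> \<subseteq> ?M -` {..< ?M u0 + 1} \<inter> ?S"
    using assms(3) by (rule_tac openE[of "?M -` {..< ?M u0 + 1} \<inter> ?S" u0]) auto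
  have M0: "0 \<le> ?M u0 + 1"
    by (intro add_nonneg_nonneg sum_nonneg) auto
  show thesis
  proof
    show "0 < \<epsilon>" "ball u0 \<epsilon> \<subseteq> ?S" "0 \<le> sqrt (?M u0 + 1)"
      using \<epsilon> M0 by auto
    fix u v assume u: "u \<in> ball u0 \<epsilon>"
    then have uS: "u \<in> snd c ` fst c" "?M u \<le> ?M u0 + 1"
      using \<epsilon> by auto
    have "metric_coord A g c u v v \<le> (\<Sum>i\<in>UNIV. \<Sum>j\<in>UNIV. (norm v)\<^sup>2 * \<bar>metric_coord A g c u (axis i 1) (axis j 1)\<bar>)"
    proof (subst bilinear_axis_expansion[OF metric_coord_bilinear[OF chart_inv_pdiff[OF assms(1) uS(1)]]], intro sum_mono)
      fix i j
      let ?G = "metric_coord A g c u (axis i 1) (axis j 1)"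
      have "v $ i * v $ j * ?G \<le> \<bar>v $ i\<bar> * \<bar>v $ j\<bar> * \<bar>?G\<bar>"
        by (metis abs_ge_self abs_mult)
      also have "\<dots> \<le> norm v * norm v * \<bar>?G\<bar>"
        by (intro mult_right_mono mult_mono component_le_norm_cart) auto
      finally show "v $ i * v $ j * ?G \<le> (norm v)\<^sup>2 * \<bar>?G\<bar>"
        by (simp add: power2_eq_square)
    qed
    also have "\<dots> = (norm v)\<^sup>2 * ?M u"
      by (simp add: sum_distrib_left)
    also have "\<dots> \<le> (norm v)\<^sup>2 * (?M u0 + 1)"
      using uS(2) by (intro mult_left_mono) auto
    finally have "sqrt (metric_coord A g c u v v) \<le> sqrt ((norm v)\<^sup>2 * (?M u0 + 1))"
      by simp
    also have "\<dots> = sqrt (?M u0 + 1) * norm v"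
      by (simp add: real_sqrt_mult mult.commute)
    finally show "metric_norm g (chart_inv c u) (pderiv A (chart_inv c) u v) \<le> sqrt (?M u0 + 1) * norm v"
      by (simp add: metric_norm_def metric_coord_eq)
  qed
qed


subsection \<open>Bounded families of class $C^1$\<close>

text \<open>Tangent vectors are coordinate vectors in the preferred chart, so the inverse of that
  chart has the identity as differential at its own base point.\<close>

lemma pderiv_chart_at: "pderiv A (chart_inv (chart_at A z)) (snd (chart_at A z) z) = id"
proof -
  let ?c = "chart_at A z"
  have "(snd ?c \<circ> chart_inv ?c has_derivative id) (at (snd ?c z))"
    by (rule has_derivative_transform_within_open[OF has_derivative_ident[folded id_def] chart_image_open[OF chart_at(1)[of z]]])
       (use chart_at(2)[of z] in \<open>simp_all add: f_inv_into_f\<close>)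
  then show ?thesis
    using frechet_derivative_eq chart_inv_chart[OF chart_at[of z]] by (simp add: pderiv_def)
qed

text \<open>The candidate differential \<open>T\<close> is given once, on tangent spaces, and
  transported to each chart by \<open>pderiv\<close>. In the preferred chart this transport is the
  identity, so \<open>T\<close> is the differential itself.\<close>

lemma C1_on_mderivI:
  assumes d: "\<And>c u. c \<in> A \<Longrightarrow> u \<in> snd c ` (D \<inter> fst c) \<Longrightarrow>
      (f \<circ> chart_inv c has_derivative (\<lambda>v. T (chart_inv c u) (pderiv A (chart_inv c) u v))) (at u)"
    and "\<And>c v. c \<in> A \<Longrightarrow>
      continuous_on (snd c ` (D \<inter> fst c)) (\<lambda>u. T (chart_inv c u) (pderiv A (chart_inv c) u v))"
  shows "C1_on D f" and "z \<in> D \<Longrightarrow> mderiv A f z = T z"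
proof -
  show "C1_on D f"
    by (rule C1_onI[OF d assms(2)])
  assume "z \<in> D"
  then have "snd (chart_at A z) z \<in> snd (chart_at A z) ` (D \<inter> fst (chart_at A z))"
    using chart_at(2)[of z] by blast
  from mderiv_unique[of f z, OF d[OF chart_at(1)[of z] this]] show "mderiv A f z = T z"
    by (simp add: pderiv_chart_at chart_inv_chart[OF chart_at])
qed

lemma cotensor_norm_L2: "cotensor_norm e y L = L2_set (\<lambda>i. norm (L (e y i))) UNIV"
  by (simp add: cotensor_norm_def L2_set_def)

lemma cotensor_norm_nonneg: "0 \<le> cotensor_norm e y L"
  by (simp add: cotensor_norm_L2)

lemma cotensor_norm_triangle:
  "cotensor_norm e y (\<lambda>v. L v + L' v) \<le> cotensor_norm e y L + cotensor_norm e y L'"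
proof -
  have "cotensor_norm e y (\<lambda>v. L v + L' v) \<le> L2_set (\<lambda>i. norm (L (e y i)) + norm (L' (e y i))) UNIV"
    unfolding cotensor_norm_L2 by (intro L2_set_mono norm_triangle_ineq) simp
  also have "\<dots> \<le> cotensor_norm e y L + cotensor_norm e y L'"
    unfolding cotensor_norm_L2 by (rule L2_set_triangle_ineq)
  finally show ?thesis .
qed

lemma cotensor_norm_minus: "cotensor_norm e y (\<lambda>v. - L v) = cotensor_norm e y L"
  by (simp add: cotensor_norm_def)

lemma cotensor_norm_bounded:
  assumes "\<And>\<xi>. norm (T \<xi>) \<le> K * norm \<xi>" "0 \<le> K"
  shows "cotensor_norm e y (\<lambda>v. T (L v)) \<le> K * cotensor_norm e y L"
proof -
  have "cotensor_norm e y (\<lambda>v. T (L v)) \<le> L2_set (\<lambda>i. K * norm (L (e y i))) UNIV"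
    unfolding cotensor_norm_L2 by (intro L2_set_mono assms) simp
  then show ?thesis
    using assms(2) by (simp add: cotensor_norm_L2 L2_set_right_distrib)
qed

lemma metric_norm_g_nonneg: "0 \<le> metric_norm g y v"
  by (simp add: metric_norm_def g_nonneg)

text \<open>All regularity is stated for fixed vectors. These range over the whole space: operators
  between fibres are first extended by projections, so that no subspace varies with the
  point.\<close>

definition C1_family ::
  "'m set \<Rightarrow> ('m \<Rightarrow> 'a::real_normed_vector \<Rightarrow> 'b::real_normed_vector) \<Rightarrow> real \<Rightarrow> real \<Rightarrow> bool" where
  "C1_family D F K L \<longleftrightarrow>
     (\<forall>z\<in>D. linear (F z)) \<and> (\<forall>z\<in>D. \<forall>\<xi>. norm (F z \<xi>) \<le> K * norm \<xi>) \<and>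
     (\<forall>\<xi>. C1_on D (\<lambda>z. F z \<xi>)) \<and>
     (\<forall>z\<in>D. \<forall>\<xi>. cotensor_norm e z (mderiv A (\<lambda>z. F z \<xi>) z) \<le> L * norm \<xi>)"

lemma C1_familyD:
  assumes "C1_family D F K L"
  shows "z \<in> D \<Longrightarrow> linear (F z)"
    and "z \<in> D \<Longrightarrow> norm (F z \<xi>) \<le> K * norm \<xi>"
    and "C1_on D (\<lambda>z. F z \<xi>)"
    and "z \<in> D \<Longrightarrow> cotensor_norm e z (mderiv A (\<lambda>z. F z \<xi>) z) \<le> L * norm \<xi>"
  using assms by (simp_all add: C1_family_def)

lemma mderiv_add:
  assumes "mdiff f z" "mdiff h z"
  shows "mderiv A (\<lambda>y. f y + h y) z = (\<lambda>v. mderiv A f z v + mderiv A h z v)"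
  using has_derivative_add[OF mdiff_has_derivative[OF assms(1)] mdiff_has_derivative[OF assms(2)]]
  by (intro mderiv_unique) (simp add: o_def)

lemma mderiv_scaleR:
  assumes "mdiff f z"
  shows "mderiv A (\<lambda>y. a *\<^sub>R f y) z = (\<lambda>v. a *\<^sub>R mderiv A f z v)"
  using has_derivative_scaleR_right[OF mdiff_has_derivative[OF assms], of a]
  by (intro mderiv_unique) (simp add: o_def)

text \<open>It makes the derivative, in a fixed direction, a uniformly bounded linear family in its
  own right, to which \<open>tendsto_strong_apply\<close> can be applied.\<close>

lemma family_mderiv_linear:
  assumes D: "open D" "z \<in> D" and F: "C1_family D F K L"
  shows "linear (\<lambda>\<xi>. mderiv A (\<lambda>y. F y \<xi>) z v)"
proof (rule linearI)
  note md = C1_on_mdiff[OF C1_familyD(3)[OF F] D(2)]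
  show "mderiv A (\<lambda>y. F y (\<xi> + \<eta>)) z v = mderiv A (\<lambda>y. F y \<xi>) z v + mderiv A (\<lambda>y. F y \<eta>) z v" for \<xi> \<eta>
    using mderiv_cong[OF D, of "\<lambda>y. F y (\<xi> + \<eta>)" "\<lambda>y. F y \<xi> + F y \<eta>"]
      linear_add[OF C1_familyD(1)[OF F]] mderiv_add[OF md md] by simp
  show "mderiv A (\<lambda>y. F y (a *\<^sub>R \<xi>)) z v = a *\<^sub>R mderiv A (\<lambda>y. F y \<xi>) z v" for a \<xi>
    using mderiv_cong[OF D, of "\<lambda>y. F y (a *\<^sub>R \<xi>)" "\<lambda>y. a *\<^sub>R F y \<xi>"]
      linear_scale[OF C1_familyD(1)[OF F]] mderiv_scaleR[OF md] by simp
qed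

text \<open>Differentiability is the strong product rule. For continuity of the derivative, each of
  its two terms is a uniformly bounded, strongly continuous family applied to a convergent
  argument.\<close>

lemma family_apply:
  assumes D: "open D" and F: "C1_family D F K L" and w: "C1_on D w"
  shows "C1_on D (\<lambda>z. F z (w z))"
    and "z \<in> D \<Longrightarrow> mderiv A (\<lambda>z. F z (w z)) z =
      (\<lambda>v. mderiv A (\<lambda>y. F y (w z)) z v + F z (mderiv A w z v))"
proof -
  define T where "T z v = mderiv A (\<lambda>y. F y (w z)) z v + F z (mderiv A w z v)" for z v
  have lin: "eventually (\<lambda>u. linear (F (chart_inv c u))) (nhds u0)"
    and bd: "eventually (\<lambda>u. \<forall>\<xi>. norm (F (chart_inv c u) \<xi>) \<le> K * norm \<xi>) (nhds u0)"
    if "c \<in> A" "u0 \<in> snd c ` (D \<inter> fst c)" for c u0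
  proof -
    have *: "eventually (\<lambda>u. u \<in> snd c ` (D \<inter> fst c)) (nhds u0)"
      by (rule eventually_nhds_in_open[OF chart_image_Int_open[OF that(1) D] that(2)])
    show "eventually (\<lambda>u. linear (F (chart_inv c u))) (nhds u0)"
      using * by eventually_elim (use chart_inv_image_mem[OF that(1)] C1_familyD(1)[OF F] in blast)
    show "eventually (\<lambda>u. \<forall>\<xi>. norm (F (chart_inv c u) \<xi>) \<le> K * norm \<xi>) (nhds u0)"
      using * by eventually_elim (use chart_inv_image_mem[OF that(1)] C1_familyD(2)[OF F] in blast)
  qed
  have cont: "isCont (\<lambda>u. F (chart_inv c u) \<eta>) u0" if "c \<in> A" "u0 \<in> snd c ` (D \<inter> fst c)" for c u0 \<eta>
    using has_derivative_continuous[OF C1_on_has_derivative[OF C1_familyD(3)[OF F] that]] by (simp add: o_def)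
  have 1: "((\<lambda>z. F z (w z)) \<circ> chart_inv c has_derivative (\<lambda>v. T (chart_inv c u) (pderiv A (chart_inv c) u v))) (at u)"
    if c: "c \<in> A" "u \<in> snd c ` (D \<inter> fst c)" for c u
    using has_derivative_strong_apply[OF lin[OF c] bd[OF c] C1_on_has_derivative[OF w c]
        C1_on_has_derivative[OF C1_familyD(3)[OF F] c, unfolded o_def] cont[OF c]]
    by (simp add: T_def o_def)
  have 2: "continuous_on (snd c ` (D \<inter> fst c)) (\<lambda>u. T (chart_inv c u) (pderiv A (chart_inv c) u v))"
    if c: "c \<in> A" for c v
  proof -
    have "isCont (\<lambda>u. T (chart_inv c u) (pderiv A (chart_inv c) u v)) u0" if u0: "u0 \<in> snd c ` (D \<inter> fst c)" for u0
    proof -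
      obtain \<epsilon> B where \<epsilon>: "0 < \<epsilon>" "0 \<le> B" "ball u0 \<epsilon> \<subseteq> snd c ` (D \<inter> fst c)"
        and B: "\<And>u v. u \<in> ball u0 \<epsilon> \<Longrightarrow> metric_norm g (chart_inv c u) (pderiv A (chart_inv c) u v) \<le> B * norm v"
        by (rule local_metric_bound[OF c D u0]) blast
      have ev: "eventually (\<lambda>u. u \<in> ball u0 \<epsilon>) (at u0)"
        using \<epsilon>(1) by (intro eventually_at_in_open') auto
      have mem: "chart_inv c u \<in> D" if "u \<in> ball u0 \<epsilon>" for u
        using that \<epsilon>(3) chart_inv_image_mem[OF c] by blast
      have S: "open (snd c ` (D \<inter> fst c))"
        by (rule chart_image_Int_open[OF c D])
      have wc: "((\<lambda>u. w (chart_inv c u)) \<longlongrightarrow> w (chart_inv c u0)) (at u0)"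
        using has_derivative_continuous[OF C1_on_has_derivative[OF w c u0]] by (simp add: isCont_def o_def)
      have "((\<lambda>u. mderiv A (\<lambda>y. F y (w (chart_inv c u))) (chart_inv c u) (pderiv A (chart_inv c) u v))
         \<longlongrightarrow> mderiv A (\<lambda>y. F y (w (chart_inv c u0))) (chart_inv c u0) (pderiv A (chart_inv c) u0 v)) (at u0)"
      proof (rule tendsto_strong_apply[where
            \<comment> \<open>\<open>L\<close> bounds the derivative in the cotensor norm, and
              \<open>B * norm v\<close> bounds the metric length of the coordinate vector
              \<open>v\<close> near \<open>u0\<close>.\<close>
            \<Phi> = "\<lambda>u \<xi>. mderiv A (\<lambda>y. F y \<xi>) (chart_inv c u) (pderiv A (chart_inv c) u v)" and K = "L * (B * norm v)"])
        show "eventually (\<lambda>u. linear (\<lambda>\<xi>. mderiv A (\<lambda>y. F y \<xi>) (chart_inv c u) (pderiv A (chart_inv c) u v))) (at u0)"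
          using ev by eventually_elim (use family_mderiv_linear[OF D _ F] mem in blast)
        show "eventually (\<lambda>u. \<forall>\<eta>. norm (mderiv A (\<lambda>y. F y \<eta>) (chart_inv c u) (pderiv A (chart_inv c) u v))
             \<le> L * (B * norm v) * norm \<eta>) (at u0)"
          using ev
        proof eventually_elim
          case (elim u)
          show ?case
          proof
            fix \<eta>
            let ?m = "mderiv A (\<lambda>y. F y \<eta>) (chart_inv c u)"
            have "norm (?m (pderiv A (chart_inv c) u v)) \<le>
                cotensor_norm e (chart_inv c u) ?m * metric_norm g (chart_inv c u) (pderiv A (chart_inv c) u v)"
              by (rule cotensor_norm_bound[OF mderiv_linear[OF C1_on_mdiff[OF C1_familyD(3)[OF F] mem[OF elim]]]])
            also have "\<dots> \<le> (L * norm \<eta>) * (B * norm v)"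
              using C1_familyD(4)[OF F mem[OF elim]] B[OF elim] cotensor_norm_nonneg metric_norm_g_nonneg
              by (intro mult_mono') auto
            finally show "norm (?m (pderiv A (chart_inv c) u v)) \<le> L * (B * norm v) * norm \<eta>"
              by (simp add: mult_ac)
          qed
        qed
        show "((\<lambda>u. mderiv A (\<lambda>y. F y (w (chart_inv c u0))) (chart_inv c u) (pderiv A (chart_inv c) u v))
            \<longlongrightarrow> mderiv A (\<lambda>y. F y (w (chart_inv c u0))) (chart_inv c u0) (pderiv A (chart_inv c) u0 v)) (at u0)"
          by (rule continuous_on_eq_continuous_at[OF S, THEN iffD1, rule_format,
                OF C1_on_continuous_derivative[OF C1_familyD(3)[OF F] c] u0, unfolded isCont_def])
      qed (rule wc)
      moreover have "((\<lambda>u. F (chart_inv c u) (mderiv A w (chart_inv c u) (pderiv A (chart_inv c) u v)))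
         \<longlongrightarrow> F (chart_inv c u0) (mderiv A w (chart_inv c u0) (pderiv A (chart_inv c) u0 v))) (at u0)"
      proof (rule tendsto_strong_apply[where \<Phi> = "\<lambda>u. F (chart_inv c u)" and K = K])
        show "eventually (\<lambda>u. linear (F (chart_inv c u))) (at u0)"
          "eventually (\<lambda>u. \<forall>\<xi>. norm (F (chart_inv c u) \<xi>) \<le> K * norm \<xi>) (at u0)"
          using lin[OF c u0] bd[OF c u0] by (simp_all add: eventually_at_filter eventually_mono)
        show "((\<lambda>u. mderiv A w (chart_inv c u) (pderiv A (chart_inv c) u v))
            \<longlongrightarrow> mderiv A w (chart_inv c u0) (pderiv A (chart_inv c) u0 v)) (at u0)"
          by (rule continuous_on_eq_continuous_at[OF S, THEN iffD1, rule_format,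
                OF C1_on_continuous_derivative[OF w c] u0, unfolded isCont_def])
        show "((\<lambda>u. F (chart_inv c u) (mderiv A w (chart_inv c u0) (pderiv A (chart_inv c) u0 v)))
            \<longlongrightarrow> F (chart_inv c u0) (mderiv A w (chart_inv c u0) (pderiv A (chart_inv c) u0 v))) (at u0)"
          using cont[OF c u0] by (simp add: isCont_def)
      qed
      ultimately show ?thesis
        unfolding isCont_def T_def by (rule tendsto_add)
    qed
    then show ?thesis
      by (simp add: continuous_at_imp_continuous_on)
  qed
  show "C1_on D (\<lambda>z. F z (w z))"
    by (rule C1_on_mderivI(1)[OF 1 2])
  show "z \<in> D \<Longrightarrow> mderiv A (\<lambda>z. F z (w z)) z = (\<lambda>v. mderiv A (\<lambda>y. F y (w z)) z v + F z (mderiv A w z v))"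
    using C1_on_mderivI(2)[OF 1 2] by (simp add: T_def fun_eq_iff)
qed

lemma C1_family_compose:
  assumes D: "open D" and F: "C1_family D F K L" and G: "C1_family D G K' L'"
    and nonneg: "0 \<le> K" "0 \<le> L"
  shows "C1_family D (\<lambda>z \<xi>. F z (G z \<xi>)) (K * K') (K * L' + L * K')"
proof -
  have "norm (F z (G z \<xi>)) \<le> K * K' * norm \<xi>" if "z \<in> D" for z \<xi>
  proof -
    have "norm (F z (G z \<xi>)) \<le> K * norm (G z \<xi>)"
      by (rule C1_familyD(2)[OF F that])
    also have "\<dots> \<le> K * (K' * norm \<xi>)"
      by (intro mult_left_mono C1_familyD(2)[OF G that] nonneg)
    finally show ?thesis by (simp add: mult_ac)
  qed
  moreover have "cotensor_norm e z (mderiv A (\<lambda>z. F z (G z \<xi>)) z) \<le> (K * L' + L * K') * norm \<xi>"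
    if z: "z \<in> D" for z \<xi>
  proof -
    have "cotensor_norm e z (mderiv A (\<lambda>z. F z (G z \<xi>)) z) \<le>
        cotensor_norm e z (mderiv A (\<lambda>y. F y (G z \<xi>)) z) + cotensor_norm e z (\<lambda>v. F z (mderiv A (\<lambda>z. G z \<xi>) z v))"
      unfolding family_apply(2)[OF D F C1_familyD(3)[OF G] z] by (rule cotensor_norm_triangle)
    also have "\<dots> \<le> L * norm (G z \<xi>) + K * cotensor_norm e z (mderiv A (\<lambda>z. G z \<xi>) z)"
      by (intro add_mono C1_familyD(4)[OF F z] cotensor_norm_bounded C1_familyD(2)[OF F z] nonneg)
    also have "\<dots> \<le> L * (K' * norm \<xi>) + K * (L' * norm \<xi>)"
      by (intro add_mono mult_left_mono C1_familyD(2)[OF G z] C1_familyD(4)[OF G z] nonneg)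
    finally show ?thesis by (simp add: algebra_simps)
  qed
  moreover have "linear (\<lambda>\<xi>. F z (G z \<xi>))" if "z \<in> D" for z
    using linear_compose[OF C1_familyD(1)[OF G that] C1_familyD(1)[OF F that]] by (simp add: o_def)
  ultimately show ?thesis
    using family_apply(1)[OF D F C1_familyD(3)[OF G]] by (simp add: C1_family_def)
qed

lemma C1_family_const:
  assumes "bounded_linear T" "\<And>\<xi>. norm (T \<xi>) \<le> K * norm \<xi>"
  shows "C1_family D (\<lambda>z. T) K 0"
proof -
  have "C1_on D (\<lambda>z. T \<xi>)" for \<xi>
    by (rule C1_onI[of _ _ "\<lambda>_ _ _. 0"]) (simp_all add: o_def)
  moreover have "mderiv A (\<lambda>z. T \<xi>) z = (\<lambda>v. 0)" for \<xi> z
    by (rule mderiv_unique) (simp add: o_def)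
  ultimately show ?thesis
    using assms by (simp add: C1_family_def bounded_linear.linear cotensor_norm_def)
qed

lemma C1_family_diff:
  assumes D: "open D" and F: "C1_family D F K L" and G: "C1_family D G K' L'"
  shows "C1_family D (\<lambda>z \<xi>. F z \<xi> - G z \<xi>) (K + K') (L + L')"
proof -
  have 1: "C1_on D (\<lambda>z. F z \<xi> - G z \<xi>) \<and>
     (\<forall>z\<in>D. mderiv A (\<lambda>z. F z \<xi> - G z \<xi>) z = (\<lambda>v. mderiv A (\<lambda>z. F z \<xi>) z v + - mderiv A (\<lambda>z. G z \<xi>) z v))" for \<xi>
  proof -
    note * = C1_familyD(3)[OF F, of \<xi>] C1_familyD(3)[OF G, of \<xi>]
    have a: "((\<lambda>z. F z \<xi> - G z \<xi>) \<circ> chart_inv c has_derivative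
        (\<lambda>v. (\<lambda>z v. mderiv A (\<lambda>z. F z \<xi>) z v + - mderiv A (\<lambda>z. G z \<xi>) z v) (chart_inv c u) (pderiv A (chart_inv c) u v))) (at u)"
      if "c \<in> A" "u \<in> snd c ` (D \<inter> fst c)" for c u
      using has_derivative_diff[OF C1_on_has_derivative[OF *(1) that] C1_on_has_derivative[OF *(2) that]]
      by (simp add: o_def)
    have b: "continuous_on (snd c ` (D \<inter> fst c))
        (\<lambda>u. (\<lambda>z v. mderiv A (\<lambda>z. F z \<xi>) z v + - mderiv A (\<lambda>z. G z \<xi>) z v) (chart_inv c u) (pderiv A (chart_inv c) u v))"
      if "c \<in> A" for c v
      by (intro continuous_intros C1_on_continuous_derivative[OF *(1) that] C1_on_continuous_derivative[OF *(2) that])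
    show ?thesis
      using C1_on_mderivI[OF a b] by simp
  qed
  have 2: "cotensor_norm e z (mderiv A (\<lambda>z. F z \<xi> - G z \<xi>) z) \<le> (L + L') * norm \<xi>" if z: "z \<in> D" for z \<xi>
  proof -
    have "cotensor_norm e z (mderiv A (\<lambda>z. F z \<xi> - G z \<xi>) z) \<le>
        cotensor_norm e z (mderiv A (\<lambda>y. F y \<xi>) z) + cotensor_norm e z (\<lambda>v. - mderiv A (\<lambda>z. G z \<xi>) z v)"
      unfolding bspec[OF conjunct2[OF 1] z] by (rule cotensor_norm_triangle)
    then show ?thesis
      using C1_familyD(4)[OF F z, of \<xi>] C1_familyD(4)[OF G z, of \<xi>]
      by (simp add: cotensor_norm_minus algebra_simps)
  qed
  have 3: "norm (F z \<xi> - G z \<xi>) \<le> (K + K') * norm \<xi>" if z: "z \<in> D" for z \<xi>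
    using norm_triangle_ineq4[of "F z \<xi>" "G z \<xi>"] C1_familyD(2)[OF F z, of \<xi>] C1_familyD(2)[OF G z, of \<xi>]
    by (simp add: algebra_simps)
  have "linear (\<lambda>\<xi>. F z \<xi> - G z \<xi>)" if "z \<in> D" for z
    by (rule linear_compose_sub[OF C1_familyD(1)[OF F that] C1_familyD(1)[OF G that]])
  with 1 2 3 show ?thesis
    unfolding C1_family_def by blast
qed

text \<open>On a small coordinate ball the intrinsic bounds \<open>l k\<close> become uniform bounds
  \<open>l k * (B * norm h)\<close> on the coordinate derivatives. They justify termwise
  differentiation, and by the Weierstrass test continuity of the sum of the derivatives.\<close>

lemma C1_on_series:
  fixes f :: "nat \<Rightarrow> 'm \<Rightarrow> 'b::banach"
  assumes D: "open D" and f: "\<And>k. C1_on D (f k)"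
    and conv: "\<And>z. z \<in> D \<Longrightarrow> summable (\<lambda>k. f k z)"
    and bound: "\<And>k z. z \<in> D \<Longrightarrow> cotensor_norm e z (mderiv A (f k) z) \<le> l k" and l: "summable l"
  shows "C1_on D (\<lambda>z. \<Sum>k. f k z)"
    and "z \<in> D \<Longrightarrow> cotensor_norm e z (mderiv A (\<lambda>z. \<Sum>k. f k z) z) \<le> suminf l"
proof -
  define T where "T z v = (\<Sum>k. mderiv A (f k) z v)" for z v
  have est: "norm (mderiv A (f k) z v) \<le> l k * metric_norm g z v" if "z \<in> D" for k z v
    using cotensor_norm_bound[OF mderiv_linear[OF C1_on_mdiff[OF f that]], of k v z]
      mult_right_mono[OF bound[OF that] metric_norm_g_nonneg] by (rule order_trans)
  have l0: "0 \<le> l k" if "z \<in> D" for k z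
    using bound[OF that, of k] cotensor_norm_nonneg order_trans by blast
  have summ: "summable (\<lambda>k. mderiv A (f k) z v)" if "z \<in> D" for z v
    by (rule summable_comparison_test'[OF summable_mult2[OF l] est[OF that]])
  have main: "((\<lambda>z. \<Sum>k. f k z) \<circ> chart_inv c has_derivative (\<lambda>v. T (chart_inv c u0) (pderiv A (chart_inv c) u0 v))) (at u0)
      \<and> isCont (\<lambda>u. T (chart_inv c u) (pderiv A (chart_inv c) u v)) u0"
    if c: "c \<in> A" and u0: "u0 \<in> snd c ` (D \<inter> fst c)" for c u0 v
  proof -
    obtain \<epsilon> B where \<epsilon>: "0 < \<epsilon>" "0 \<le> B" "ball u0 \<epsilon> \<subseteq> snd c ` (D \<inter> fst c)"
      and B: "\<And>u v. u \<in> ball u0 \<epsilon> \<Longrightarrow> metric_norm g (chart_inv c u) (pderiv A (chart_inv c) u v) \<le> B * norm v"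
      by (rule local_metric_bound[OF c D u0]) blast
    have mem: "chart_inv c u \<in> D" if "u \<in> ball u0 \<epsilon>" for u
      using that \<epsilon>(3) chart_inv_image_mem[OF c] by blast
    define d where "d k u h = mderiv A (f k) (chart_inv c u) (pderiv A (chart_inv c) u h)" for k u h
    have d_bound: "norm (d k u h) \<le> l k * (B * norm h)" if "u \<in> ball u0 \<epsilon>" for k u h
      unfolding d_def using est[OF mem[OF that]] mult_left_mono[OF B[OF that] l0[OF mem[OF that]]]
      by (rule order_trans)
    have Td: "T (chart_inv c u) (pderiv A (chart_inv c) u h) = (\<Sum>k. d k u h)" for u h
      by (simp add: T_def d_def)
    have d_summ: "summable (\<lambda>k. norm (d k u h))" if "u \<in> ball u0 \<epsilon>" for u h
      by (rule summable_comparison_test'[OF summable_mult2[OF l]]) (use d_bound[OF that] in simp)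
    have "\<exists>G. \<forall>x\<in>ball u0 \<epsilon>. (\<lambda>n. (f n \<circ> chart_inv c) x) sums G x \<and>
        (G has_derivative (\<lambda>h. \<Sum>k. d k x h)) (at x within ball u0 \<epsilon>)"
    proof (rule has_derivative_series)
      show "(f n \<circ> chart_inv c has_derivative d n x) (at x within ball u0 \<epsilon>)" if "x \<in> ball u0 \<epsilon>" for n x
        unfolding d_def by (rule has_derivative_at_withinI[OF C1_on_has_derivative[OF f c subsetD[OF \<epsilon>(3) that]]])
      show "u0 \<in> ball u0 \<epsilon>"
        using \<epsilon>(1) by simp
      show "(\<lambda>n. (f n \<circ> chart_inv c) u0) sums (\<Sum>n. f n (chart_inv c u0))"
        using conv[OF mem] \<epsilon>(1) by (simp add: summable_sums)
      fix r :: real assume "r > 0"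
      \<comment> \<open>The remainder of the sum of \<open>l\<close>, times \<open>B\<close>, bounds
        the remainder of the derivative series on the whole ball.\<close>
      have "(\<lambda>n. (suminf l - (\<Sum>i<n. l i)) * B) \<longlonglongrightarrow> (suminf l - suminf l) * B"
        by (intro tendsto_intros summable_LIMSEQ l)
      then have "eventually (\<lambda>n. (suminf l - (\<Sum>i<n. l i)) * B < r) sequentially"
        by (rule order_tendstoD) (use \<open>r > 0\<close> in simp)
      then show "eventually (\<lambda>n. \<forall>x\<in>ball u0 \<epsilon>. \<forall>h. norm ((\<Sum>i<n. d i x h) - (\<Sum>k. d k x h)) \<le> r * norm h) sequentially"
      proof eventually_elim
        case (elim n)
        show ?case
        proof (intro ballI allI)
          fix x h :: "real ^ 'n" assume x: "x \<in> ball u0 \<epsilon>"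
          have ls: "summable (\<lambda>i. l (i + n) * (B * norm h))"
            by (intro summable_mult2 summable_ignore_initial_segment l)
          have "norm ((\<Sum>i<n. d i x h) - (\<Sum>k. d k x h)) = norm (\<Sum>i. d (i + n) x h)"
            by (simp add: suminf_minus_initial_segment[OF summable_norm_cancel[OF d_summ[OF x]]] norm_minus_commute)
          also have "\<dots> \<le> (\<Sum>i. norm (d (i + n) x h))"
            by (rule summable_norm[OF summable_ignore_initial_segment[OF d_summ[OF x]]])
          also have "\<dots> \<le> (\<Sum>i. l (i + n) * (B * norm h))"
            by (rule suminf_le[OF d_bound[OF x] summable_ignore_initial_segment[OF d_summ[OF x]] ls])
          also have "\<dots> = (suminf l - (\<Sum>i<n. l i)) * (B * norm h)"
            by (simp add: suminf_mult2[symmetric] summable_ignore_initial_segment l suminf_minus_initial_segment)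
          also have "\<dots> \<le> r * norm h"
            using mult_right_mono[OF less_imp_le[OF elim] norm_ge_zero[of h]] by (simp add: mult_ac)
          finally show "norm ((\<Sum>i<n. d i x h) - (\<Sum>k. d k x h)) \<le> r * norm h" .
        qed
      qed
    qed simp
    then obtain G where G: "\<And>x. x \<in> ball u0 \<epsilon> \<Longrightarrow> (\<lambda>n. f n (chart_inv c x)) sums G x"
      "\<And>x. x \<in> ball u0 \<epsilon> \<Longrightarrow> (G has_derivative (\<lambda>h. \<Sum>k. d k x h)) (at x within ball u0 \<epsilon>)"
      unfolding o_apply by blast
    have "((\<lambda>z. \<Sum>k. f k z) \<circ> chart_inv c has_derivative (\<lambda>h. \<Sum>k. d k u0 h)) (at u0)"
    proof (rule has_derivative_transform_within_open[of G _ _ UNIV])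
      show "(G has_derivative (\<lambda>h. \<Sum>k. d k u0 h)) (at u0)"
        using G(2)[of u0] \<epsilon>(1) by (simp add: at_within_open[of u0 "ball u0 \<epsilon>"])
      show "G x = ((\<lambda>z. \<Sum>k. f k z) \<circ> chart_inv c) x" if "x \<in> ball u0 \<epsilon>" for x
        using sums_unique[OF G(1)[OF that]] by simp
    qed (use \<epsilon>(1) in auto)
    moreover have "continuous_on (ball u0 \<epsilon>) (\<lambda>u. \<Sum>k. d k u v)"
    proof (rule uniform_limit_theorem)
      show "uniform_limit (ball u0 \<epsilon>) (\<lambda>n u. \<Sum>i<n. d i u v) (\<lambda>u. \<Sum>k. d k u v) sequentially"
        by (rule Weierstrass_m_test[OF d_bound summable_mult2[OF l]])
      show "eventually (\<lambda>n. continuous_on (ball u0 \<epsilon>) (\<lambda>u. \<Sum>i<n. d i u v)) sequentially"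
        unfolding d_def
        by (intro always_eventually allI continuous_on_sum continuous_on_subset[OF C1_on_continuous_derivative[OF f c] \<epsilon>(3)])
    qed simp
    then have "isCont (\<lambda>u. \<Sum>k. d k u v) u0"
      using \<epsilon>(1) by (simp add: continuous_on_eq_continuous_at)
    ultimately show ?thesis
      by (simp add: Td)
  qed
  have 1: "((\<lambda>z. \<Sum>k. f k z) \<circ> chart_inv c has_derivative (\<lambda>v. T (chart_inv c u) (pderiv A (chart_inv c) u v))) (at u)"
    if "c \<in> A" "u \<in> snd c ` (D \<inter> fst c)" for c u
    using main that by blast
  have 2: "continuous_on (snd c ` (D \<inter> fst c)) (\<lambda>u. T (chart_inv c u) (pderiv A (chart_inv c) u v))"
    if "c \<in> A" for c v
    using main[OF that] by (simp add: continuous_at_imp_continuous_on)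
  show "C1_on D (\<lambda>z. \<Sum>k. f k z)"
    by (rule C1_on_mderivI(1)[OF 1 2])
  assume z: "z \<in> D"
  have sums: "(\<lambda>n. \<Sum>k<n. mderiv A (f k) z v) \<longlonglongrightarrow> T z v" for v
    unfolding T_def by (rule summable_LIMSEQ[OF summ[OF z]])
  \<comment> \<open>The cotensor norm involves only finitely many values on the frame, so it is
    continuous under pointwise limits and the bound passes from the partial sums to the sum.\<close>
  have "(\<lambda>n. cotensor_norm e z (\<lambda>v. \<Sum>k<n. mderiv A (f k) z v)) \<longlonglongrightarrow> cotensor_norm e z (T z)"
    unfolding cotensor_norm_def by (rule tendsto_real_sqrt tendsto_sum tendsto_power tendsto_norm sums)+
  moreover have "cotensor_norm e z (\<lambda>v. \<Sum>k<n. mderiv A (f k) z v) \<le> suminf l" for n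
  proof -
    have "cotensor_norm e z (\<lambda>v. \<Sum>k<n. mderiv A (f k) z v) \<le> (\<Sum>k<n. l k)"
    proof (induction n)
      case 0
      then show ?case by (simp add: cotensor_norm_def)
    next
      case (Suc n)
      show ?case
        using cotensor_norm_triangle[of z "\<lambda>v. \<Sum>k<n. mderiv A (f k) z v" "mderiv A (f n) z"] Suc bound[OF z, of n]
        by simp
    qed
    also have "\<dots> \<le> suminf l"
      using l0[OF z] by (intro sum_le_suminf l) auto
    finally show ?thesis .
  qed
  ultimately have "cotensor_norm e z (T z) \<le> suminf l"
    by (intro LIMSEQ_le_const2) auto
  then show "cotensor_norm e z (mderiv A (\<lambda>z. \<Sum>k. f k z) z) \<le> suminf l"
    using C1_on_mderivI(2)[OF 1 2 z] by simp
qed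

lemma C1_family_series:
  fixes F :: "nat \<Rightarrow> 'm \<Rightarrow> 'a::real_normed_vector \<Rightarrow> 'b::banach"
  assumes D: "open D" and F: "\<And>k. C1_family D (F k) (K k) (L k)" and K: "summable K" and L: "summable L"
  shows "C1_family D (\<lambda>z \<xi>. \<Sum>k. F k z \<xi>) (suminf K) (suminf L)"
proof -
  have ns: "summable (\<lambda>k. norm (F k z \<xi>))" if "z \<in> D" for z \<xi>
    by (rule summable_comparison_test'[OF summable_mult2[OF K, of "norm \<xi>"]])
       (use C1_familyD(2)[OF F that] in simp)
  have s: "summable (\<lambda>k. F k z \<xi>)" if "z \<in> D" for z \<xi>
    by (rule summable_norm_cancel[OF ns[OF that]])
  have "linear (\<lambda>\<xi>. \<Sum>k. F k z \<xi>)" if z: "z \<in> D" for z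
    by (rule linearI)
       (simp_all add: linear_add[OF C1_familyD(1)[OF F z]] linear_scale[OF C1_familyD(1)[OF F z]]
          suminf_add[OF s[OF z] s[OF z]] suminf_scaleR_right[OF s[OF z]])
  moreover have "norm (\<Sum>k. F k z \<xi>) \<le> suminf K * norm \<xi>" if z: "z \<in> D" for z \<xi>
  proof -
    have "norm (\<Sum>k. F k z \<xi>) \<le> (\<Sum>k. norm (F k z \<xi>))"
      by (rule summable_norm[OF ns[OF z]])
    also have "\<dots> \<le> (\<Sum>k. K k * norm \<xi>)"
      by (rule suminf_le[OF C1_familyD(2)[OF F z] ns[OF z] summable_mult2[OF K]])
    finally show ?thesis
      by (simp add: suminf_mult2[OF K])
  qed
  moreover have "C1_on D (\<lambda>z. \<Sum>k. F k z \<xi>)" for \<xi>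
    by (rule C1_on_series(1)[OF D C1_familyD(3)[OF F] s C1_familyD(4)[OF F] summable_mult2[OF L]])
  moreover have "cotensor_norm e z (mderiv A (\<lambda>z. \<Sum>k. F k z \<xi>) z) \<le> suminf L * norm \<xi>" if "z \<in> D" for z \<xi>
    using C1_on_series(2)[OF D C1_familyD(3)[OF F] s C1_familyD(4)[OF F] summable_mult2[OF L] that, of \<xi>]
    by (simp add: suminf_mult2[OF L])
  ultimately show ?thesis
    by (simp add: C1_family_def)
qed

text \<open>The calculus of families yields crude bounds for the operators; here such a bound is
  exchanged for one known independently, without touching the derivative.\<close>

lemma C1_family_bound:
  assumes "C1_family D F K L" "\<And>z \<xi>. z \<in> D \<Longrightarrow> norm (F z \<xi>) \<le> K' * norm \<xi>"
  shows "C1_family D F K' L"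
  using assms by (simp add: C1_family_def)

end


subsection \<open>The exponential map at the zero vector\<close>

text \<open>The finite-dimensional Riesz theorem: a positive definite form gives an injective, hence
  surjective, linear map. It makes the description in \<open>christoffel\<close>
  well-defined.\<close>

lemma positive_definite_representation:
  fixes b :: "real ^ 'n \<Rightarrow> real ^ 'n \<Rightarrow> real"
  assumes b: "bilinear b" and pos: "\<And>v. v \<noteq> 0 \<Longrightarrow> 0 < b v v" and f: "linear f"
  shows "\<exists>!z. \<forall>y. b z y = f y"
proof -
  define T where "T z = (\<chi> j. b z (axis j 1))" for z
  have T: "linear T"
    by (intro linearI) (simp_all add: T_def vec_eq_iff bilinear_ladd[OF b] bilinear_lmul[OF b])
  have inner: "T z \<bullet> y = b z y" for z y
  proof -
    have "b z y = b z (\<Sum>j\<in>UNIV. y $ j *\<^sub>R axis j 1)"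
      using basis_expansion[of y] by (simp add: scalar_mult_eq_scaleR)
    also have "\<dots> = (\<Sum>j\<in>UNIV. b z (y $ j *\<^sub>R axis j 1))"
      using linear_sum[of "b z"] b by (simp add: bilinear_def)
    finally show ?thesis
      by (simp add: T_def inner_vec_def bilinear_rmul[OF b] mult.commute)
  qed
  have "inj T"
    unfolding linear_injective_0[OF T] using inner pos by (metis inner_zero_left less_irrefl)
  then have "surj T"
    by (rule linear_inj_imp_surj[OF T])
  have f_eq: "f y = (\<chi> j. f (axis j 1)) \<bullet> y" for y
  proof -
    have "f y = f (\<Sum>j\<in>UNIV. y $ j *\<^sub>R axis j 1)"
      using basis_expansion[of y] by (simp add: scalar_mult_eq_scaleR)
    also have "\<dots> = (\<Sum>j\<in>UNIV. y $ j * f (axis j 1))"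
      by (simp add: linear_sum[OF f] linear_scale[OF f])
    finally show ?thesis
      by (simp add: inner_vec_def mult.commute)
  qed
  obtain z where z: "T z = (\<chi> j. f (axis j 1))"
    using \<open>surj T\<close> by (metis surjD)
  show ?thesis
  proof (rule ex1I[of _ z])
    show "\<forall>y. b z y = f y"
      using inner f_eq z by metis
    fix z' assume z': "\<forall>y. b z' y = f y"
    have "T z' = T z"
      using inner f_eq z z' by (metis vector_eq_rdot)
    then show "z' = z"
      using \<open>inj T\<close> by (simp add: inj_eq)
  qed
qed

section \<open>Christoffel symbols and conservation of energy\<close>

context riemannian_manifold
begin

text \<open>The chart is a left inverse of \<open>chart_inv c\<close>, so by the chain rule the
  differential of the latter is injective.\<close>

lemma pderiv_chart_inv_eq_0:
  assumes "c \<in> A" "u \<in> snd c ` fst c" "pderiv A (chart_inv c) u v = 0"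
  shows "v = 0"
proof -
  let ?y = "chart_inv c u"
  have y: "?y \<in> fst c"
    by (rule chart_inv_mem[OF assms(2)])
  have "mdiff (snd c) ?y"
    unfolding mdiff_def
    using smooth_on_differentiable[OF transition_smooth[OF chart_at(1)[of ?y] assms(1)]] chart_at(2)[of ?y] y by blast
  from has_derivative_chain[OF chart_inv_pdiff[OF assms(1,2)] this]
  have "((\<lambda>x. snd c (chart_inv c x)) has_derivative (\<lambda>v. mderiv A (snd c) ?y (pderiv A (chart_inv c) u v))) (at u)" .
  moreover have "((\<lambda>x. snd c (chart_inv c x)) has_derivative (\<lambda>v. v)) (at u)"
    by (rule has_derivative_transform_within_open[OF has_derivative_ident chart_image_open[OF assms(1)] assms(2)])
       (simp add: f_inv_into_f)
  ultimately have "mderiv A (snd c) ?y (pderiv A (chart_inv c) u v) = v"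
    using has_derivative_unique by metis
  then show ?thesis
    using linear_0[OF mderiv_linear[OF \<open>mdiff (snd c) ?y\<close>]] assms(3) by simp
qed

lemma metric_coord_pos:
  assumes "c \<in> A" "u \<in> snd c ` fst c" "v \<noteq> 0"
  shows "0 < metric_coord A g c u v v"
  using pderiv_chart_inv_eq_0[OF assms(1,2), of v] assms(3) by (auto simp: metric_coord_eq intro!: g_pos)

abbreviation dmetric :: "('m, 'n) chart \<Rightarrow> real ^ 'n \<Rightarrow> real ^ 'n \<Rightarrow> real ^ 'n \<Rightarrow> real ^ 'n \<Rightarrow> real" where
  "dmetric c u a v w \<equiv> frechet_derivative (\<lambda>u. metric_coord A g c u v w) (at u) a"

lemma metric_coord_has_derivative:
  assumes "c \<in> A" "u \<in> snd c ` fst c"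
  shows "((\<lambda>u. metric_coord A g c u v w) has_derivative (\<lambda>a. dmetric c u a v w)) (at u)"
  by (rule has_derivative_frechet[OF smooth_on_differentiable[OF metric_coord_smooth[OF assms(1)] assms(2)]])

lemma dmetric_expansion:
  assumes c: "c \<in> A" "u \<in> snd c ` fst c"
  shows "dmetric c u a v w = (\<Sum>i\<in>UNIV. \<Sum>j\<in>UNIV. v $ i * w $ j * dmetric c u a (axis i 1) (axis j 1))"
proof -
  have "((\<lambda>u. \<Sum>i\<in>UNIV. \<Sum>j\<in>UNIV. v $ i * w $ j * metric_coord A g c u (axis i 1) (axis j 1)) has_derivative
      (\<lambda>a. \<Sum>i\<in>UNIV. \<Sum>j\<in>UNIV. v $ i * w $ j * dmetric c u a (axis i 1) (axis j 1))) (at u)"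
    by (intro has_derivative_sum has_derivative_mult_right metric_coord_has_derivative[OF c])
  then have "((\<lambda>u. metric_coord A g c u v w) has_derivative
      (\<lambda>a. \<Sum>i\<in>UNIV. \<Sum>j\<in>UNIV. v $ i * w $ j * dmetric c u a (axis i 1) (axis j 1))) (at u)"
    by (rule has_derivative_transform_within_open[OF _ chart_image_open[OF c(1)] c(2)])
       (rule bilinear_axis_expansion[OF metric_coord_bilinear[OF chart_inv_pdiff[OF c(1)]], symmetric])
  from frechet_derivative_eq[OF this] show ?thesis
    by simp
qed

text \<open>The Koszul formula with both lower arguments equal to \<open>v\<close>, where two of its
  three terms coincide.\<close>

lemma christoffel_metric_coord:
  assumes c: "c \<in> A" "u \<in> snd c ` fst c"
  shows "metric_coord A g c u (christoffel A g c u v v) y = dmetric c u v v y - dmetric c u y v v / 2"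
proof -
  define f where "f y = (dmetric c u v v y + dmetric c u v v y - dmetric c u y v v) / 2" for y
  have l1: "linear (\<lambda>y. dmetric c u y v v)"
    by (rule bounded_linear.linear[OF has_derivative_bounded_linear[OF metric_coord_has_derivative[OF c]]])
  have l2: "linear (\<lambda>y. dmetric c u v v y)"
  proof -
    have eq: "(\<lambda>y. dmetric c u v v y) =
        (\<lambda>y. \<Sum>i\<in>UNIV. \<Sum>j\<in>UNIV. v $ i * y $ j * dmetric c u v (axis i 1) (axis j 1))"
      by (rule ext) (rule dmetric_expansion[OF c])
    show ?thesis
      by (subst eq, intro linearI) (simp_all add: algebra_simps sum.distrib sum_distrib_left)
  qed
  have "linear f"
    unfolding f_def using linear_add[OF l1] linear_add[OF l2] linear_scale[OF l1] linear_scale[OF l2]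
    by (intro linearI) (simp_all add: field_simps)
  from positive_definite_representation[OF metric_coord_bilinear[OF chart_inv_pdiff[OF c]] metric_coord_pos[OF c] this]
  have "\<forall>y. metric_coord A g c u (THE z. \<forall>y. metric_coord A g c u z y = f y) y = f y"
    by (rule theI')
  moreover have "christoffel A g c u v v = (THE z. \<forall>y. metric_coord A g c u z y = f y)"
    by (simp only: christoffel_def Let_def f_def)
  ultimately have "metric_coord A g c u (christoffel A g c u v v) y = f y"
    by simp
  then show ?thesis
    by (simp add: f_def)
qed

text \<open>The derivative of G(u', u') is 2 G(u'', u') plus the derivative of the metric along u'.
  Replacing u'' by the geodesic equation makes the two cancel. The energy is differentiated through
  its expansion in metric coefficients, since base point and vectors both vary.\<close>

lemma geodesic_energy_derivative:
  assumes geo: "geodesic_on A g J \<gamma>" and J: "open J" and c: "c \<in> A" and t: "t \<in> J" "\<gamma> t \<in> fst c"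
  defines "u \<equiv> snd c \<circ> \<gamma>"
  defines "u' \<equiv> (\<lambda>t. vector_derivative u (at t))"
  shows "((\<lambda>t. metric_coord A g c (u t) (u' t) (u' t)) has_real_derivative 0) (at t)"
    and "(u has_vector_derivative u' t) (at t)"
    and "isCont u' t"
    and "frechet_derivative u (at t) 1 = u' t"
proof -
  let ?N = "J \<inter> \<gamma> -` fst c"
  have "continuous_on J \<gamma>"
    using geo by (simp add: geodesic_on_def)
  then have N: "open ?N"
    by (rule continuous_open_preimage[OF _ J chart_open[OF c]])
  have tN: "t \<in> ?N"
    using t by simp
  have smooth: "smooth_on u ?N" and eqn: "vector_derivative u' (at t) + christoffel A g c (u t) (u' t) (u' t) = 0"
    using geo c tN unfolding geodesic_on_def u_def u'_def Let_def by blast+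
  have ud: "(u has_vector_derivative u' s) (at s)" if "s \<in> ?N" for s
    using smooth_on_differentiable[OF smooth that] by (simp add: u'_def vector_derivative_works)
  have fr: "frechet_derivative u (at s) 1 = u' s" if "s \<in> ?N" for s
    using ud[OF that] frechet_derivative_eq[of u _ s] by (simp add: has_vector_derivative_def)
  have "smooth_on u' ?N"
    using smooth_on_frechet_derivative[OF smooth, of 1] smooth_on_cong[OF N fr] by simp
  from smooth_on_differentiable[OF this tN]
  obtain u'' where u'': "(u' has_vector_derivative u'') (at t)" "u'' = vector_derivative u' (at t)"
    by (simp add: vector_derivative_works)
  show "(u has_vector_derivative u' t) (at t)" "frechet_derivative u (at t) 1 = u' t"
    using ud fr tN by auto
  show "isCont u' t"
    using u''(1) by (rule has_vector_derivative_continuous)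
  have uc: "u s \<in> snd c ` fst c" if "s \<in> ?N" for s
    using that by (simp add: u_def)
  note ut = uc[OF tN]
  let ?G = "\<lambda>t i j. metric_coord A g c (u t) (axis i 1) (axis j 1)"
  let ?D = "\<lambda>i j. dmetric c (u t) (u' t) (axis i 1) (axis j 1)"
  have G: "((\<lambda>t. ?G t i j) has_real_derivative ?D i j) (at t)" for i j
    using vector_derivative_diff_chain_within[OF ud[OF tN] has_derivative_at_withinI[OF metric_coord_has_derivative[OF c ut]]]
    by (simp add: o_def has_real_derivative_iff_has_vector_derivative)
  have comp: "((\<lambda>t. u' t $ i) has_real_derivative u'' $ i) (at t)" for i
    using bounded_linear.has_vector_derivative[OF bounded_linear_vec_nth u''(1), of i]
    by (simp add: has_real_derivative_iff_has_vector_derivative)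
  have "((\<lambda>t. \<Sum>i\<in>UNIV. \<Sum>j\<in>UNIV. u' t $ i * u' t $ j * ?G t i j) has_real_derivative
      (\<Sum>i\<in>UNIV. \<Sum>j\<in>UNIV. (u'' $ i * u' t $ j + u'' $ j * u' t $ i) * ?G t i j + ?D i j * (u' t $ i * u' t $ j))) (at t)"
    by (intro DERIV_sum DERIV_mult comp G)
  moreover have "(\<Sum>i\<in>UNIV. \<Sum>j\<in>UNIV. (u'' $ i * u' t $ j + u'' $ j * u' t $ i) * ?G t i j + ?D i j * (u' t $ i * u' t $ j)) =
      metric_coord A g c (u t) u'' (u' t) + metric_coord A g c (u t) (u' t) u'' + dmetric c (u t) (u' t) (u' t) (u' t)"
    unfolding dmetric_expansion[OF c ut, of "u' t" "u' t" "u' t"]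
      bilinear_axis_expansion[OF metric_coord_bilinear[OF chart_inv_pdiff[OF c ut]], of u'']
      bilinear_axis_expansion[OF metric_coord_bilinear[OF chart_inv_pdiff[OF c ut]], of _ u'']
      sum.distrib[symmetric]
    by (intro sum.cong refl) (simp add: algebra_simps)
  moreover have "metric_coord A g c (u t) (u' t) u'' = metric_coord A g c (u t) u'' (u' t)"
    by (simp add: metric_coord_eq g_sym)
  \<comment> \<open>With \<open>y = u' t\<close> the Koszul formula leaves half of the derivative of
    the metric, with a minus sign; the two symmetric terms together cancel the third.\<close>
  moreover have "u'' = - christoffel A g c (u t) (u' t) (u' t)"
    using eqn u''(2) by (simp add: eq_neg_iff_add_eq_0)
  then have "metric_coord A g c (u t) u'' (u' t) = - (dmetric c (u t) (u' t) (u' t) (u' t) / 2)"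
    by (simp add: bilinear_lneg[OF metric_coord_bilinear[OF chart_inv_pdiff[OF c ut]]] christoffel_metric_coord[OF c ut])
  ultimately have D0: "((\<lambda>t. \<Sum>i\<in>UNIV. \<Sum>j\<in>UNIV. u' t $ i * u' t $ j * ?G t i j) has_real_derivative 0) (at t)"
    by simp
  show "((\<lambda>t. metric_coord A g c (u t) (u' t) (u' t)) has_real_derivative 0) (at t)"
  proof (rule has_field_derivative_transform_within_open[OF D0 N tN])
    fix s assume "s \<in> ?N"
    then show "(\<Sum>i\<in>UNIV. \<Sum>j\<in>UNIV. u' s $ i * u' s $ j * ?G s i j) = metric_coord A g c (u s) (u' s) (u' s)"
      by (intro bilinear_axis_expansion[symmetric] metric_coord_bilinear chart_inv_pdiff[OF c] uc)
  qed
qed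

text \<open>The times at which the geodesic is at \<open>x\<close> with zero velocity form a set
  that is open and closed in the interval \<open>J\<close>. It is open because the energy is
  constant near such a time, hence 0, so the velocity vanishes and the curve rests; its complement
  is open by continuity of position and velocity.\<close>

lemma exp_rel_zero:
  assumes "exp_rel A g x 0 y"
  shows "y = x"
proof -
  obtain J \<gamma> where J: "open J" "is_interval J" "{0..1} \<subseteq> J" and geo: "geodesic_on A g J \<gamma>"
    and init: "\<gamma> 0 = x" "pderiv A \<gamma> 0 1 = 0" and end1: "\<gamma> 1 = y"
    using assms unfolding exp_rel_def by blast
  define c where "c = chart_at A x"
  have c: "c \<in> A" "x \<in> fst c"
    by (simp_all add: c_def chart_at)
  define u where "u = snd c \<circ> \<gamma>"
  define u' where "u' = (\<lambda>t. vector_derivative u (at t))"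
  have cont: "continuous_on J \<gamma>"
    using geo by (simp add: geodesic_on_def)
  have open_vim: "open (J \<inter> \<gamma> -` S)" if "open S" for S
    by (rule continuous_open_preimage[OF cont J(1) that])
  note en = geodesic_energy_derivative[OF geo J(1) c(1), folded u_def, folded u'_def]
  have vel: "pderiv A \<gamma> t 1 = u' t" if "t \<in> J" "\<gamma> t = x" for t
    using en(4)[of t] that c(2) by (simp add: pderiv_def c_def[symmetric] u_def[symmetric] u'_def)
  \<comment> \<open>Asking for \<gamma> t = x, and not only for zero velocity, keeps the single
    chart at \<open>x\<close> available near every time in \<open>Z\<close>.\<close>
  define Z where "Z = {t \<in> J. \<gamma> t = x \<and> u' t = 0}"
  have "open Z"
    unfolding open_contains_ball
  proof
    fix t assume "t \<in> Z"
    then have t: "t \<in> J" "\<gamma> t = x" "u' t = 0"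
      by (simp_all add: Z_def)
    obtain \<epsilon> where \<epsilon>: "0 < \<epsilon>" "ball t \<epsilon> \<subseteq> J \<inter> \<gamma> -` fst c"
      by (rule openE[OF open_vim[OF chart_open[OF c(1)]], of t]) (use t c in auto)
    have mem: "s \<in> J" "\<gamma> s \<in> fst c" if "s \<in> ball t \<epsilon>" for s
      using that \<epsilon>(2) by auto
    have uc: "u s \<in> snd c ` fst c" if "s \<in> ball t \<epsilon>" for s
      using mem(2)[OF that] by (simp add: u_def)
    have "\<exists>k. \<forall>s\<in>ball t \<epsilon>. metric_coord A g c (u s) (u' s) (u' s) = k"
      by (rule has_field_derivative_zero_constant[OF convex_ball])
         (use has_field_derivative_at_within[OF en(1)[OF mem]] in \<open>simp add: u'_def\<close>)
    then obtain k where k: "\<And>s. s \<in> ball t \<epsilon> \<Longrightarrow> metric_coord A g c (u s) (u' s) (u' s) = k"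
      by blast
    \<comment> \<open>The constant is evaluated at \<open>t\<close>, where the velocity is 0;
      positive definiteness then turns zero energy into zero velocity on the ball.\<close>
    have "k = 0"
      using k[of t] \<epsilon>(1) t(3) uc[of t] bilinear_lzero[OF metric_coord_bilinear[OF chart_inv_pdiff[OF c(1)]]] by simp
    then have u'0: "u' s = 0" if "s \<in> ball t \<epsilon>" for s
      using k[OF that] metric_coord_pos[OF c(1) uc[OF that], of "u' s"] by fastforce
    have "(u has_vector_derivative 0) (at s within ball t \<epsilon>)" if "s \<in> ball t \<epsilon>" for s
      using en(2)[OF mem[OF that]] u'0[OF that] by (simp add: u'_def has_vector_derivative_at_within)
    from has_vector_derivative_zero_constant[OF convex_ball this]
    obtain k' where "\<And>s. s \<in> ball t \<epsilon> \<Longrightarrow> u s = k'"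
      by blast
    then have "u s = u t" if "s \<in> ball t \<epsilon>" for s
      using that \<epsilon>(1) centre_in_ball by metis
    then have "\<gamma> s = x" if "s \<in> ball t \<epsilon>" for s
      using chart_inv_chart[OF c(1) mem(2)[OF that]] chart_inv_chart[OF c] t(2) that by (metis comp_apply u_def)
    with u'0 mem(1) have "ball t \<epsilon> \<subseteq> Z"
      by (auto simp: Z_def)
    with \<epsilon>(1) show "\<exists>\<epsilon>>0. ball t \<epsilon> \<subseteq> Z"
      by blast
  qed
  have "open (J - Z)"
    unfolding open_contains_ball
  proof
    fix t assume t: "t \<in> J - Z"
    show "\<exists>\<epsilon>>0. ball t \<epsilon> \<subseteq> J - Z"
    proof (cases "\<gamma> t = x")
      case False
      obtain \<epsilon> where "0 < \<epsilon>" "ball t \<epsilon> \<subseteq> J \<inter> \<gamma> -` (- {x})"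
        by (rule openE[OF open_vim[of "- {x}"], of t]) (use t False in auto)
      then show ?thesis
        by (intro exI[of _ \<epsilon>]) (auto simp: Z_def)
    next
      case True
      then have "u' t \<noteq> 0" "isCont u' t"
        using t en(3)[of t] c(2) by (auto simp: Z_def)
      then obtain \<epsilon>1 where \<epsilon>1: "0 < \<epsilon>1" "\<And>s. dist t s < \<epsilon>1 \<Longrightarrow> u' s \<noteq> 0"
        using continuous_at_avoid[of t u' 0] by blast
      obtain \<epsilon>2 where \<epsilon>2: "0 < \<epsilon>2" "ball t \<epsilon>2 \<subseteq> J"
        by (rule openE[OF J(1), of t]) (use t in auto)
      show ?thesis
        using \<epsilon>1 \<epsilon>2 by (intro exI[of _ "min \<epsilon>1 \<epsilon>2"]) (auto simp: Z_def)
    qed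
  qed
  have "0 \<in> J" "1 \<in> J"
    using J(3) by (simp_all add: subset_iff)
  moreover from this have "0 \<in> Z" "Z \<subseteq> J"
    using init vel[of 0] by (auto simp: Z_def)
  moreover have "connected J"
    by (rule is_interval_connected[OF J(2)])
  ultimately have "J - Z = {}"
    using connectedD[of J Z "J - Z"] \<open>open Z\<close> \<open>open (J - Z)\<close> by blast
  with \<open>1 \<in> J\<close> have "1 \<in> Z"
    by blast
  then show ?thesis
    using end1 by (simp add: Z_def)
qed

lemma exp_map_zero:
  assumes "0 \<in> exp_dom A g x"
  shows "exp_map A g x 0 = x"
proof -
  obtain y where "exp_rel A g x 0 y"
    using assms unfolding exp_dom_def by blast
  with exp_rel_zero show ?thesis
    unfolding exp_map_def by (intro the_equality) blast+
qed


subsection \<open>Geodesic balls\<close>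

text \<open>The inverse map is smooth in charts, hence continuous on the open image, and the image
  of the smaller set is a preimage under it.\<close>

lemma diffeo_into_open_image:
  assumes f: "diffeo_into A S f" and S': "S' \<subseteq> S" "open S'"
  shows "open (f ` S')"
proof -
  have inj: "inj_on f S" and fS: "open (f ` S)"
    and sm: "\<And>c. c \<in> A \<Longrightarrow> smooth_on (inv_into S f \<circ> chart_inv c) (snd c ` (f ` S \<inter> fst c))"
    using f by (auto simp: diffeo_into_def case_prod_beta)
  have "isCont (inv_into S f) y" if y: "y \<in> f ` S" for y
  proof (rule chart_isCont_compose[OF chart_at])
    let ?c = "chart_at A y"
    have "snd ?c y \<in> snd ?c ` (f ` S \<inter> fst ?c)"
      using y chart_at(2)[of y] by blast
    then show "isCont (inv_into S f \<circ> chart_inv ?c) (snd ?c y)"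
      using smooth_on_differentiable[OF sm[OF chart_at(1)[of y]]] differentiable_imp_continuous_within by blast
  qed
  then have "continuous_on (f ` S) (inv_into S f)"
    by (simp add: continuous_at_imp_continuous_on)
  then have "open (f ` S \<inter> inv_into S f -` S')"
    by (rule continuous_open_preimage[OF _ fS S'(2)])
  moreover have "f ` S \<inter> inv_into S f -` S' = f ` S'"
    using S'(1) inv_into_f_f[OF inj] by (auto intro!: image_eqI)
  ultimately show ?thesis
    by simp
qed

text \<open>The inverse named in \<open>diffeo_into\<close> depends on the set. On the smaller image
  both inverses agree, and this image is open, so smoothness transfers.\<close>

lemma diffeo_into_subset:
  assumes f: "diffeo_into A S f" and S': "S' \<subseteq> S" "open S'"
  shows "diffeo_into A S' f"
proof -
  have inj: "inj_on f S" "inj_on f S'" and cont: "continuous_on S' f"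
    and sm1: "\<And>c. c \<in> A \<Longrightarrow> smooth_on (snd c \<circ> f) (S \<inter> f -` fst c)"
    and sm2: "\<And>c. c \<in> A \<Longrightarrow> smooth_on (inv_into S f \<circ> chart_inv c) (snd c ` (f ` S \<inter> fst c))"
    using f S'(1) by (auto simp: diffeo_into_def case_prod_beta intro: inj_on_subset continuous_on_subset)
  have op: "open (f ` S')"
    by (rule diffeo_into_open_image[OF f S'])
  have "smooth_on (inv_into S' f \<circ> chart_inv c) (snd c ` (f ` S' \<inter> fst c))" if c: "c \<in> A" for c
  proof (rule smooth_on_cong[OF chart_image_Int_open[OF c op], THEN iffD1])
    show "smooth_on (inv_into S f \<circ> chart_inv c) (snd c ` (f ` S' \<inter> fst c))"
      by (rule smooth_on_subset[OF sm2[OF c]]) (use S'(1) in blast)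
    fix u assume "u \<in> snd c ` (f ` S' \<inter> fst c)"
    from chart_inv_image_mem[OF c this] obtain v where "v \<in> S'" "chart_inv c u = f v"
      by blast
    then show "(inv_into S f \<circ> chart_inv c) u = (inv_into S' f \<circ> chart_inv c) u"
      using inv_into_f_f[OF inj(1)] inv_into_f_f[OF inj(2)] S'(1) by auto
  qed
  moreover have "smooth_on (snd c \<circ> f) (S' \<inter> f -` fst c)" if "c \<in> A" for c
    by (rule smooth_on_subset[OF sm1[OF that]]) (use S'(1) in blast)
  ultimately show ?thesis
    using inj cont op by (simp add: diffeo_into_def case_prod_beta)
qed

lemma tangent_ball_eq: "tangent_ball g x r = (\<lambda>v. \<Sum>i\<in>UNIV. v $ i *\<^sub>R e x i) ` ball 0 r"
proof -
  have "v \<in> (\<lambda>v. \<Sum>i\<in>UNIV. v $ i *\<^sub>R e x i) ` ball 0 r" if "metric_norm g x v < r" for v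
  proof -
    obtain w where "v = (\<Sum>i\<in>UNIV. w $ i *\<^sub>R e x i)"
      using frame_combination_bij[of x] unfolding bij_def surj_def by blast
    then show ?thesis
      using that by (simp add: frame_combination_norm)
  qed
  then show ?thesis
    by (auto simp: tangent_ball_def frame_combination_norm)
qed

lemma tangent_ball_open: "open (tangent_ball g x r)"
  unfolding tangent_ball_eq
  by (rule open_surjective_linear_image[OF open_ball frame_combination_linear bij_is_surj[OF frame_combination_bij]])

lemma geod_ball_eq: "geod_ball A g x r = normal_param A g e x ` ball 0 r"
  by (simp add: geod_ball_def tangent_ball_eq image_image normal_param_def)

lemma op_norm_le_imp:
  assumes "op_norm S norm q f \<le> ennreal C" "v \<in> S" "\<And>a. a *\<^sub>R v \<in> S"
    and hom: "\<And>a. q (f (a *\<^sub>R v)) = \<bar>a\<bar> * q (f v)" and C: "0 \<le> C"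
  shows "q (f v) \<le> C * norm v"
proof (cases "v = 0")
  case True
  then show ?thesis
    using hom[of 0] by simp
next
  case False
  have "ennreal (q (f ((1 / norm v) *\<^sub>R v))) \<le> op_norm S norm q f"
    unfolding op_norm_def using assms(3) False by (intro SUP_upper) simp
  then have "q (f ((1 / norm v) *\<^sub>R v)) \<le> C"
    using assms(1) C by (meson ennreal_le_iff order_trans)
  then show ?thesis
    using False by (simp add: hom divide_simps mult.commute)
qed

section \<open>Consequences of the bounded geometry conditions\<close>

context
  fixes s :: real
  assumes bgc: "bounded_geometry_conditions A g e s"
begin

lemma s_pos: "0 < s"
  using bgc by (simp add: bounded_geometry_conditions_def)

lemma exp_diffeo: "diffeo_into A (tangent_ball g x s) (exp_map A g x)"
  using bgc by (simp add: bounded_geometry_conditions_def)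

lemma normal_param_0: "normal_param A g e x 0 = x"
proof -
  have "0 \<in> tangent_ball g x s"
    using s_pos by (simp add: tangent_ball_def metric_norm_def bilinear_lzero[OF g_bilinear])
  then have "0 \<in> exp_dom A g x"
    using bgc by (auto simp: bounded_geometry_conditions_def)
  then show ?thesis
    by (simp add: normal_param_def exp_map_zero)
qed

lemma normal_param_inj: "inj_on (normal_param A g e x) (ball 0 s)"
proof -
  have "inj_on (exp_map A g x) (tangent_ball g x s)"
    using exp_diffeo by (simp add: diffeo_into_def)
  then show ?thesis
    using comp_inj_on[OF inj_on_subset[OF bij_is_inj[OF frame_combination_bij[of x]]], of "ball 0 s" "exp_map A g x"]
    by (simp add: tangent_ball_eq normal_param_def[abs_def] o_def)
qed

lemma normal_param_pdiff:
  assumes "v \<in> ball 0 s"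
  shows "pdiff (normal_param A g e x) v"
proof -
  let ?T = "\<lambda>v. \<Sum>i\<in>UNIV. v $ i *\<^sub>R e x i"
  let ?c = "chart_at A (normal_param A g e x v)"
  have T: "bounded_linear ?T"
    using frame_combination_linear linear_conv_bounded_linear by blast
  have TS: "?T v \<in> tangent_ball g x s"
    using assms by (simp add: tangent_ball_eq)
  have np: "normal_param A g e x = exp_map A g x \<circ> ?T"
    by (simp add: normal_param_def[abs_def] o_def)
  have "isCont (exp_map A g x) (?T v)"
    using exp_diffeo[of x] TS tangent_ball_open by (simp add: diffeo_into_def continuous_on_eq_continuous_at)
  then have 1: "isCont (normal_param A g e x) v"
    unfolding np o_def by (rule isCont_o2[OF linear_continuous_at[OF T]])
  have "smooth_on (snd ?c \<circ> exp_map A g x) (tangent_ball g x s \<inter> exp_map A g x -` fst ?c)"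
    using exp_diffeo[of x] chart_at(1) by (auto simp: diffeo_into_def case_prod_beta)
  moreover have "exp_map A g x (?T v) \<in> fst ?c"
    using chart_at(2)[of "normal_param A g e x v"] by (simp add: normal_param_def)
  ultimately have "(snd ?c \<circ> exp_map A g x) differentiable (at (?T v))"
    using TS smooth_on_differentiable by blast
  then have "(snd ?c \<circ> exp_map A g x \<circ> ?T) differentiable (at v)"
    using differentiableI[OF bounded_linear_imp_has_derivative[OF T]] by (rule differentiable_chain_at[rotated])
  then show ?thesis
    using 1 by (simp add: pdiff_def np o_assoc)
qed

lemma geod_ball_open: "r \<le> s \<Longrightarrow> open (geod_ball A g x r)"
  unfolding geod_ball_def
  by (rule diffeo_into_open_image[OF exp_diffeo]) (auto simp: tangent_ball_def tangent_ball_open[unfolded tangent_ball_def])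

lemma center_mem_geod_ball: "0 < r \<Longrightarrow> x \<in> geod_ball A g x r"
  unfolding geod_ball_eq by (rule image_eqI[of _ _ 0]) (simp_all add: normal_param_0)

lemma normal_chart_eq:
  assumes "y \<in> geod_ball A g x r" "r \<le> s"
  shows "normal_chart A g e r x y = normal_chart A g e s x y"
proof -
  have *: "ball 0 r \<subseteq> ball (0 :: real ^ 'n) s"
    using assms(2) by auto
  obtain v where v: "v \<in> ball 0 r" "y = normal_param A g e x v"
    using assms(1) unfolding geod_ball_eq by blast
  have "normal_chart A g e r x y = v"
    unfolding normal_chart_def v(2) by (rule inv_into_f_f[OF inj_on_subset[OF normal_param_inj *] v(1)])
  moreover have "normal_chart A g e s x y = v"
    unfolding normal_chart_def v(2) by (rule inv_into_f_f[OF normal_param_inj subsetD[OF * v(1)]])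
  ultimately show ?thesis
    by simp
qed

text \<open>The bundle is required to satisfy the conditions at radius \<open>r\<close>. The
  constant \<open>C\<close> for \<open>s\<close> still works: the normal charts for the two radii
  agree on an open set, so their differentials agree, and the suprema run over smaller sets.\<close>

lemma bounded_geometry_conditions_smaller:
  assumes r: "0 < r" "r \<le> s"
  shows "bounded_geometry_conditions A g e r"
proof -
  obtain C where C: "0 < C"
    "\<And>x. (SUP y \<in> geod_ball A g x s. op_norm UNIV (metric_norm g y) norm (mderiv A (normal_chart A g e s x) y)) \<le> ennreal C"
    "\<And>x. (SUP v \<in> ball 0 s. op_norm UNIV norm (metric_norm g (normal_param A g e x v)) (pderiv A (normal_param A g e x) v)) \<le> ennreal C"
    using bgc unfolding bounded_geometry_conditions_def by blast
  have sub: "tangent_ball g x r \<subseteq> tangent_ball g x s" for x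
    using r by (auto simp: tangent_ball_def)
  have dom: "tangent_ball g x s \<subseteq> exp_dom A g x" for x
    using bgc by (simp add: bounded_geometry_conditions_def)
  have bsub: "ball 0 r \<subseteq> ball (0 :: real ^ 'n) s"
    using r by auto
  have "mderiv A (normal_chart A g e r x) y = mderiv A (normal_chart A g e s x) y" if "y \<in> geod_ball A g x r" for x y
    by (rule mderiv_cong[OF geod_ball_open[OF r(2)] that normal_chart_eq[OF _ r(2)]])
  then have "(SUP y \<in> geod_ball A g x r. op_norm UNIV (metric_norm g y) norm (mderiv A (normal_chart A g e r x) y)) =
      (SUP y \<in> geod_ball A g x r. op_norm UNIV (metric_norm g y) norm (mderiv A (normal_chart A g e s x) y))" for x
    by (intro SUP_cong) auto
  also have "(SUP y \<in> geod_ball A g x r. op_norm UNIV (metric_norm g y) norm (mderiv A (normal_chart A g e s x) y)) \<le>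
      (SUP y \<in> geod_ball A g x s. op_norm UNIV (metric_norm g y) norm (mderiv A (normal_chart A g e s x) y))" for x
    by (rule SUP_subset_mono) (use bsub in \<open>auto simp: geod_ball_eq\<close>)
  also note C(2)
  finally have 1: "(SUP y \<in> geod_ball A g x r. op_norm UNIV (metric_norm g y) norm (mderiv A (normal_chart A g e r x) y)) \<le> ennreal C" for x .
  have 2: "(SUP v \<in> ball 0 r. op_norm UNIV norm (metric_norm g (normal_param A g e x v)) (pderiv A (normal_param A g e x) v)) \<le> ennreal C" for x
    by (rule order_trans[OF SUP_subset_mono[OF bsub order_refl] C(3)])
  have 3: "tangent_ball g x r \<subseteq> exp_dom A g x \<and> diffeo_into A (tangent_ball g x r) (exp_map A g x)" for x
    using sub dom diffeo_into_subset[OF exp_diffeo sub tangent_ball_open] by blast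
  show ?thesis
    unfolding bounded_geometry_conditions_def using r(1) C(1) 1 2 3 by blast
qed

lemma metric_norm_scaleR: "metric_norm g y (a *\<^sub>R v) = \<bar>a\<bar> * metric_norm g y v"
  by (simp add: metric_norm_def bilinear_lmul[OF g_bilinear] bilinear_rmul[OF g_bilinear]
      real_sqrt_mult flip: mult.assoc)

text \<open>A bound with an unspecified constant, uniform in the base point. It serves the case of
  vanishing dP, where the metric matrices are not controlled by the smallness hypothesis.\<close>

lemma pderiv_normal_param_bounded:
  obtains C where "\<And>x v h. v \<in> ball 0 s \<Longrightarrow>
    metric_norm g (normal_param A g e x v) (pderiv A (normal_param A g e x) v h) \<le> C * norm h"
proof -
  obtain C where C: "0 < C"
    "\<And>x. (SUP v \<in> ball 0 s. op_norm UNIV norm (metric_norm g (normal_param A g e x v)) (pderiv A (normal_param A g e x) v)) \<le> ennreal C"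
    using bgc unfolding bounded_geometry_conditions_def by blast
  have "metric_norm g (normal_param A g e x v) (pderiv A (normal_param A g e x) v h) \<le> C * norm h"
    if v: "v \<in> ball 0 s" for x v h
  proof (rule op_norm_le_imp[where S = UNIV and f = "pderiv A (normal_param A g e x) v"])
    show "op_norm UNIV norm (metric_norm g (normal_param A g e x v)) (pderiv A (normal_param A g e x) v) \<le> ennreal C"
      by (rule order_trans[OF SUP_upper[OF v] C(2)])
  qed (use C(1) in \<open>simp_all add: linear_scale[OF pderiv_linear[OF normal_param_pdiff[OF v]]] metric_norm_scaleR\<close>)
  then show thesis
    using that by blast
qed

text \<open>The squared length of the image of \<open>h\<close> is the quadratic form of the metric
  matrix at \<open>h\<close>, hence at most the matrix norm times the square of the norm of
  \<open>h\<close>. This is the origin of the exponent 1/2 in the smallness condition.\<close>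

lemma pderiv_normal_param_metric_matrix:
  assumes v: "v \<in> ball 0 s"
    and \<alpha>: "ennreal_sqrt (metric_matrix_norm A g e s x) \<le> ennreal \<alpha>" "0 \<le> \<alpha>"
  shows "metric_norm g (normal_param A g e x v) (pderiv A (normal_param A g e x) v h) \<le> \<alpha> * norm h"
proof -
  let ?np = "normal_param A g e x" and ?\<phi> = "normal_chart A g e s x"
  let ?ch = "(geod_ball A g x s, ?\<phi>)"
  let ?b = "\<lambda>h k. g (?np v) (pderiv A ?np v h) (pderiv A ?np v k)"
  let ?M = "metric_matrix A g e s x (?np v)"
  have \<phi>: "?\<phi> (?np w) = w" if "w \<in> ball 0 s" for w
    unfolding normal_chart_def by (rule inv_into_f_f[OF normal_param_inj that])
  have inv: "chart_inv ?ch w = ?np w" if "w \<in> ball 0 s" for w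
  proof -
    have "inj_on ?\<phi> (geod_ball A g x s)"
      unfolding geod_ball_eq by (rule inj_on_inverseI[of _ ?np]) (auto simp: \<phi>)
    then have "chart_inv ?ch (?\<phi> (?np w)) = ?np w"
      using that by (simp add: geod_ball_eq)
    then show ?thesis
      by (simp only: \<phi>[OF that])
  qed
  have pd: "pderiv A (chart_inv ?ch) v = pderiv A ?np v"
    unfolding pderiv_def inv[OF v]
    by (rule frechet_derivative_cong_open[OF open_ball v]) (simp only: o_apply inv)
  have b: "bilinear ?b"
    using g_bilinear[of "?np v"] linear_compose[OF pderiv_linear[OF normal_param_pdiff[OF v, of x]]]
    unfolding bilinear_def o_def by blast
  have M: "?M $ i $ j = ?b (axis i 1) (axis j 1)" for i j
    unfolding metric_matrix_def Let_def \<phi>[OF v] using pd inv[OF v] by (simp add: metric_coord_eq)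
  have hM: "h \<bullet> (?M *v h) = ?b h h"
    unfolding bilinear_axis_expansion[OF b, of h h]
    by (simp add: inner_vec_def matrix_vector_mult_def M sum_distrib_left mult_ac)
  have fin: "metric_matrix_norm A g e s x \<noteq> \<infinity>"
    using \<alpha> by (auto simp: ennreal_sqrt_def top_unique)
  define \<Lambda> where "\<Lambda> = enn2real (metric_matrix_norm A g e s x)"
  have "ennreal (sqrt \<Lambda>) \<le> ennreal \<alpha>"
    using fin \<alpha>(1) by (simp add: \<Lambda>_def ennreal_sqrt_def)
  then have \<Lambda>: "0 \<le> \<Lambda>" "metric_matrix_norm A g e s x = ennreal \<Lambda>" "sqrt \<Lambda> \<le> \<alpha>"
    using fin \<alpha>(2) by (simp_all add: \<Lambda>_def less_top)
  have "norm (?M *v h) \<le> \<Lambda> * norm h"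
  proof (rule op_norm_le_imp[where S = UNIV and f = "\<lambda>h. ?M *v h"])
    have "?np v \<in> geod_ball A g x s"
      using v by (simp add: geod_ball_eq)
    then have "op_norm UNIV norm norm (\<lambda>h. ?M *v h) \<le> metric_matrix_norm A g e s x"
      unfolding metric_matrix_norm_def by (rule SUP_upper)
    then show "op_norm UNIV norm norm (\<lambda>h. ?M *v h) \<le> ennreal \<Lambda>"
      by (simp add: \<Lambda>(2))
  qed (simp_all add: \<Lambda>(1) matrix_vector_mult_scaleR)
  then have "norm h * norm (?M *v h) \<le> norm h * (\<Lambda> * norm h)"
    by (rule mult_left_mono) simp
  then have "?b h h \<le> \<Lambda> * (norm h)\<^sup>2"
    using norm_cauchy_schwarz[of h "?M *v h"] by (simp add: hM power2_eq_square mult_ac)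
  then have "sqrt (?b h h) \<le> sqrt (\<Lambda> * (norm h)\<^sup>2)"
    by simp
  also have "\<dots> = sqrt \<Lambda> * norm h"
    by (simp add: real_sqrt_mult)
  also have "\<dots> \<le> \<alpha> * norm h"
    by (intro mult_right_mono \<Lambda>) simp
  finally show ?thesis
    by (simp add: metric_norm_def)
qed

text \<open>The mean value inequality on the convex coordinate ball between 0 and \<open>v\<close>;
  the centre 0 is sent to \<open>x\<close> because \<open>exp_map\<close> at the zero vector is
  known.\<close>

lemma radial_bound:
  assumes f: "C1_on UNIV f" and M: "\<And>y. cotensor_norm e y (mderiv A f y) \<le> M"
    and \<alpha>: "\<And>v h. v \<in> ball 0 s \<Longrightarrow>
      metric_norm g (normal_param A g e x v) (pderiv A (normal_param A g e x) v h) \<le> \<alpha> * norm h"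
    and v: "v \<in> ball 0 s"
  shows "norm (f (normal_param A g e x v) - f x) \<le> M * \<alpha> * norm v"
proof -
  let ?np = "normal_param A g e x"
  let ?d = "\<lambda>w h. mderiv A f (?np w) (pderiv A ?np w h)"
  have "norm (f (?np v) - f (?np 0)) \<le> M * \<alpha> * norm (v - 0)"
  proof (rule differentiable_bound)
    fix w :: "real ^ 'n" assume w: "w \<in> ball 0 s"
    show "((\<lambda>w. f (?np w)) has_derivative ?d w) (at w within ball 0 s)"
      by (rule has_derivative_at_withinI[OF has_derivative_chain[OF normal_param_pdiff[OF w] C1_on_mdiff[OF f UNIV_I]]])
    have "norm (?d w h) \<le> M * \<alpha> * norm h" for h
    proof -
      have "norm (?d w h) \<le> cotensor_norm e (?np w) (mderiv A f (?np w)) * metric_norm g (?np w) (pderiv A ?np w h)"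
        by (rule cotensor_norm_bound[OF mderiv_linear[OF C1_on_mdiff[OF f UNIV_I]]])
      also have "\<dots> \<le> M * (\<alpha> * norm h)"
        by (intro mult_mono' M \<alpha>[OF w] cotensor_norm_nonneg metric_norm_g_nonneg)
      finally show ?thesis by (simp add: mult_ac)
    qed
    then show "onorm (?d w) \<le> M * \<alpha>"
      by (rule onorm_le)
  qed (use v s_pos in auto)
  then show ?thesis
    by (simp add: normal_param_0)
qed

end

end


lemma Hausdorff_space_t2: "Hausdorff_space (euclidean :: 'a::t2_space topology)"
  unfolding Hausdorff_space_def disjnt_def using hausdorff by (metis open_openin)

lemma homeomorphism_inj_on: "homeomorphism S T f g \<Longrightarrow> inj_on f S"
  by (rule inj_on_inverseI) (rule homeomorphism_apply1)


subsection \<open>Unitary maps\<close>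

lemma unitary_on_compose:
  assumes "unitary_on S S' T" "unitary_on S' S'' T'"
  shows "unitary_on S S'' (T' \<circ> T)"
proof -
  have im: "T ` S = S'" "T' ` S' = S''"
    using assms by (simp_all add: unitary_on_def)
  have mem: "T \<xi> \<in> S'" if "\<xi> \<in> S" for \<xi>
    using im that by blast
  have "(T' \<circ> T) ` S = S''"
    using im by (simp only: image_comp[symmetric])
  then show ?thesis
    using assms mem unfolding unitary_on_def clinear_on_def by simp
qed

lemma unitary_on_cong:
  assumes "unitary_on S S' T" "complex_vector.subspace S" "\<And>\<xi>. \<xi> \<in> S \<Longrightarrow> T' \<xi> = T \<xi>"
  shows "unitary_on S S' T'"
proof -
  have "T' ` S = T ` S"
    using assms(3) by (rule image_cong[OF refl])
  then show ?thesis
    using assms unfolding unitary_on_def clinear_on_def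
    by (simp add: complex_vector.subspace_add complex_vector.subspace_scale)
qed

lemma unitary_on_inj:
  assumes "unitary_on S S' T" "complex_vector.subspace S"
  shows "inj_on T S"
proof (rule inj_onI)
  fix \<xi> \<eta> assume mem: "\<xi> \<in> S" "\<eta> \<in> S" and eq: "T \<xi> = T \<eta>"
  have "(- 1) *\<^sub>C \<eta> \<in> S"
    by (rule complex_vector.subspace_scale[OF assms(2) mem(2)])
  moreover have m: "(- 1) *\<^sub>C \<eta> = - \<eta>"
    by (rule complex_vector.scale_minus_left[of 1, simplified complex_vector.scale_one])
  ultimately have d: "\<xi> + - \<eta> \<in> S"
    using complex_vector.subspace_add[OF assms(2) mem(1), of "- \<eta>"] by simp
  have "T (\<xi> + - \<eta>) = T \<xi> + T (- \<eta>)"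
    using assms(1) mem \<open>(- 1) *\<^sub>C \<eta> \<in> S\<close> unfolding unitary_on_def clinear_on_def m by blast
  also have "T (- \<eta>) = (- 1) *\<^sub>C T \<eta>"
    using assms(1) mem(2) unfolding unitary_on_def clinear_on_def m[symmetric] by blast
  also have "T \<xi> + \<dots> = 0"
    using eq complex_vector.scale_minus_left[of 1 "T \<eta>"] by simp
  finally have "norm (\<xi> + - \<eta>) = 0"
    using unitary_on_norm[OF assms(1) d] by simp
  then show "\<xi> = \<eta>"
    by simp
qed

lemma unitary_on_inverse:
  assumes T: "unitary_on S S' T" and inv: "\<And>\<xi>. \<xi> \<in> S \<Longrightarrow> T' (T \<xi>) = \<xi>"
    and sub: "complex_vector.subspace S"
  shows "unitary_on S' S T'"
proof -
  have im: "T ` S = S'"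
    using T by (simp add: unitary_on_def)
  have "T' (T \<xi> + T \<eta>) = T' (T \<xi>) + T' (T \<eta>)" "T' (a *\<^sub>C T \<xi>) = a *\<^sub>C T' (T \<xi>)"
    "cinner (T' (T \<xi>)) (T' (T \<eta>)) = cinner (T \<xi>) (T \<eta>)" if "\<xi> \<in> S" "\<eta> \<in> S" for \<xi> \<eta> a
    using T that complex_vector.subspace_add[OF sub that] complex_vector.subspace_scale[OF sub that(1), of a] inv
    unfolding unitary_on_def clinear_on_def by metis+
  moreover have "T' ` T ` S = S"
    using inv by (simp add: image_image)
  ultimately show ?thesis
    unfolding unitary_on_def clinear_on_def im[symmetric] by (simp add: ball_simps)
qed

lemma unitary_on_inv_into:
  assumes "unitary_on S S' T" "complex_vector.subspace S"
  shows "unitary_on S' S (inv_into S T)"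
  by (rule unitary_on_inverse[OF assms(1) inv_into_f_f[OF unitary_on_inj[OF assms]] assms(2)])

lemma unitary_on_continuous:
  assumes T: "unitary_on S S' T" and sub: "complex_vector.subspace S"
  shows "continuous_on S T"
proof (rule continuous_onI)
  fix \<xi> and \<epsilon> :: real assume \<xi>: "\<xi> \<in> S" and "0 < \<epsilon>"
  have "dist (T \<eta>) (T \<xi>) = dist \<eta> \<xi>" if \<eta>: "\<eta> \<in> S" for \<eta>
  proof -
    have d: "\<eta> - \<xi> \<in> S"
      by (rule complex_vector.subspace_diff[OF sub \<eta> \<xi>])
    have "T (\<eta> - \<xi> + \<xi>) = T (\<eta> - \<xi>) + T \<xi>"
      using T d \<xi> unfolding unitary_on_def clinear_on_def by blast
    then have "T \<eta> - T \<xi> = T (\<eta> - \<xi>)"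
      by simp
    then show ?thesis
      using unitary_on_norm[OF T d] by (simp add: dist_norm)
  qed
  with \<open>0 < \<epsilon>\<close> show "\<exists>\<delta>>0. \<forall>\<eta>\<in>S. dist \<eta> \<xi> < \<delta> \<longrightarrow> dist (T \<eta>) (T \<xi>) \<le> \<epsilon>"
    by (intro exI[of _ \<epsilon>]) auto
qed


subsection \<open>The bundle of ranges\<close>

context riemannian_manifold
begin

text \<open>Each of the k factors is differentiated once while the other k - 1 are bounded by
  \<open>K\<close>. For \<open>k = 0\<close> the truncated exponent is harmless since the factor
  \<open>of_nat k\<close> is 0.\<close>

lemma C1_family_funpow:
  fixes F :: "'m \<Rightarrow> 'x::real_normed_vector \<Rightarrow> 'x"
  assumes D: "open D" and F: "C1_family D F K L" and K: "0 \<le> K" "0 \<le> L"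
  shows "C1_family D (\<lambda>z \<xi>. (F z ^^ k) \<xi>) (K ^ k) (of_nat k * K ^ (k - 1) * L)"
proof (induction k)
  case 0
  have "(\<lambda>z \<xi>. (F z ^^ 0) \<xi>) = (\<lambda>z \<xi>. \<xi>)"
    by (simp add: fun_eq_iff)
  then show ?case
    using C1_family_const[OF bounded_linear_ident, of 1 D] by simp
next
  case (Suc k)
  have "K * (of_nat k * K ^ (k - 1) * L) + L * K ^ k = of_nat (Suc k) * K ^ (Suc k - 1) * L"
    by (cases k) (simp_all add: algebra_simps)
  with C1_family_compose[OF D F Suc K] show ?case
    by simp
qed

text \<open>Strong continuity becomes joint continuity through the uniform bound. Together with the
  projections it gives continuity of the trivializations in both directions.\<close>

lemma C1_family_continuous_on:
  fixes F :: "'m \<Rightarrow> 'x::real_normed_vector \<Rightarrow> 'y::real_normed_vector"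
  assumes D: "open D" and F: "C1_family D F K L"
  shows "continuous_on (D \<times> UNIV) (\<lambda>(z, \<xi>). F z \<xi>)"
  unfolding continuous_on_def
proof
  fix p assume p: "p \<in> D \<times> (UNIV :: 'x set)"
  have ev: "eventually (\<lambda>q. q \<in> D \<times> UNIV) (at p within D \<times> UNIV)"
    by (simp add: eventually_at_filter)
  have "((\<lambda>q. F (fst q) (snd q)) \<longlongrightarrow> F (fst p) (snd p)) (at p within D \<times> UNIV)"
  proof (rule tendsto_strong_apply[where \<Phi> = "\<lambda>q. F (fst q)" and K = K])
    show "eventually (\<lambda>q. linear (F (fst q))) (at p within D \<times> UNIV)"
      using ev by eventually_elim (auto intro: C1_familyD(1)[OF F])
    show "eventually (\<lambda>q. \<forall>\<eta>. norm (F (fst q) \<eta>) \<le> K * norm \<eta>) (at p within D \<times> UNIV)"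
      using ev by eventually_elim (auto intro: C1_familyD(2)[OF F])
    show "(snd \<longlongrightarrow> snd p) (at p within D \<times> UNIV)"
      by (intro tendsto_snd tendsto_ident_at)
    have "isCont (\<lambda>z. F z (snd p)) (fst p)"
      using p by (intro C1_on_isCont[OF C1_familyD(3)[OF F]]) auto
    then show "((\<lambda>q. F (fst q) (snd p)) \<longlongrightarrow> F (fst p) (snd p)) (at p within D \<times> UNIV)"
      by (rule isCont_tendsto_compose) (intro tendsto_fst tendsto_ident_at)
  qed
  then show "((\<lambda>(z, \<xi>). F z \<xi>) \<longlongrightarrow> (case p of (z, \<xi>) \<Rightarrow> F z \<xi>)) (at p within D \<times> UNIV)"
    by (simp add: case_prod_unfold)
qed

end

text \<open>The larger radius and the metric matrices have been eliminated: what remains of the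
  smallness hypothesis is that projections over one ball are \<delta>-close to the projection at its
  centre.\<close>

locale projection_bundle = riemannian_manifold A g e
  for A :: "('m::t2_space, 'n::finite) chart set" and g e +
  fixes P :: "'m \<Rightarrow> 'h::complex_hilbert_space \<Rightarrow> 'h" and r \<delta> \<beta> :: real
  assumes conn: "connected (UNIV :: 'm set)"
    and proj: "orthogonal_projection (P x)"
    and P_C1: "strongly_differentiable_on A UNIV UNIV P"
    and P_deriv: "cotensor_norm e z (mderiv A (\<lambda>y. P y \<xi>) z) \<le> \<beta> * norm \<xi>" and \<beta>: "0 \<le> \<beta>"
    and P_near: "y \<in> geod_ball A g x r \<Longrightarrow> norm (P x \<xi> - P y \<xi>) \<le> \<delta> * norm \<xi>"
    and \<delta>: "0 \<le> \<delta>" "\<delta> < 1/2"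
    and U_open: "open (geod_ball A g x r)" and U_center: "x \<in> geod_ball A g x r"
    and bgc: "bounded_geometry_conditions A g e r"
begin

abbreviation U :: "'m \<Rightarrow> 'm set" where
  "U x \<equiv> geod_ball A g x r"

abbreviation S :: "'m \<Rightarrow> 'h set" where
  "S x \<equiv> range (P x)"

text \<open>In the notation of the paper, $W_x(y) = P(y)\,Q_{x,y}$ and $W_x(y)^* = Q_{x,y}\,P(x)$.\<close>

definition Q :: "'m \<Rightarrow> 'm \<Rightarrow> 'h \<Rightarrow> 'h" where
  "Q x y \<equiv> proj_isqrt (P x) (P y)"

lemma near_projections: "y \<in> U x \<Longrightarrow> near_projections (P x) (P y) \<delta>"
  by (intro near_projections.intro proj P_near \<delta>)

lemma P_range: "\<xi> \<in> S x \<longleftrightarrow> P x \<xi> = \<xi>"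
  by (rule orthogonal_projection_range[OF proj])

lemma P_idem [simp]: "P x (P x \<xi>) = P x \<xi>"
  by (rule orthogonal_projection_idem[OF proj])

lemma S_closed: "closed_csubspace (S x)"
  by (rule closed_csubspace_range_projection[OF proj])

lemma S_subspace: "complex_vector.subspace (S x)"
  using S_closed by (simp add: closed_csubspace_def)

lemma Q_range: "y \<in> U x \<Longrightarrow> \<xi> \<in> S x \<Longrightarrow> Q x y \<xi> \<in> S x"
  unfolding Q_def proj_isqrt_def by (rule near_projections.R_range[OF near_projections])

lemma W_unitary: "y \<in> U x \<Longrightarrow> unitary_on (S x) (S y) (\<lambda>\<eta>. P y (Q x y \<eta>))"
  unfolding Q_def proj_isqrt_def by (rule near_projections.unitary[OF near_projections])

lemma W_left_inverse: "y \<in> U x \<Longrightarrow> \<xi> \<in> S x \<Longrightarrow> Q x y (P x (P y (Q x y \<xi>))) = \<xi>"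
  unfolding Q_def proj_isqrt_def by (rule near_projections.R_pq_R[OF near_projections])

lemma W_right_inverse: "y \<in> U x \<Longrightarrow> \<xi> \<in> S y \<Longrightarrow> P y (Q x y (Q x y (P x \<xi>))) = \<xi>"
  unfolding Q_def proj_isqrt_def by (rule near_projections.unitary_right_inverse[OF near_projections])

lemma im_W_eq: "y \<in> U x \<Longrightarrow> \<eta> \<in> S x \<Longrightarrow> im_W P x y \<eta> = P y (Q x y \<eta>)"
  unfolding im_W_def Q_def proj_isqrt_def
  using near_projections.inv_sqrt_on_eq[OF near_projections] by simp

lemma im_triv_eq:
  assumes "y \<in> U x" "\<xi> \<in> S y"
  shows "im_triv P x (y, \<xi>) = (y, Q x y (P x \<xi>))"
  using near_projections.adjoint_on_eq[OF near_projections[OF assms(1)], of "im_W P x y" \<xi>]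
    im_W_eq[OF assms(1)] assms(2)
  unfolding im_triv_def Q_def proj_isqrt_def by simp

lemma W_adjoint_unitary:
  assumes "y \<in> U x"
  shows "unitary_on (S y) (S x) (\<lambda>\<xi>. Q x y (P x \<xi>))"
  by (rule unitary_on_inverse[OF W_unitary[OF assms] _ S_subspace]) (rule W_left_inverse[OF assms])

lemma C1_family_P: "C1_family D P 1 \<beta>"
  unfolding C1_family_def
proof (intro conjI ballI allI)
  show "C1_on D (\<lambda>z. P z \<xi>)" for \<xi>
    using P_C1 unfolding strongly_differentiable_on_iff by (blast intro: C1_on_subset)
qed (use P_deriv orthogonal_projection_linear[OF proj] orthogonal_projection_norm[OF proj] in auto)

lemma C1_family_const_P: "C1_family D (\<lambda>z. P x) 1 0"
  using C1_family_const[OF orthogonal_projection_bounded_linear[OF proj], of x 1]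
    orthogonal_projection_norm[OF proj] by simp

text \<open>The difference rule bounds the operators only by 2, for which the power series would not
  be controlled; the bound \<delta> from nearness of the projections replaces it.\<close>

lemma C1_family_gap: "C1_family (U x) (\<lambda>z \<xi>. proj_gap (P x) (P z) \<xi>) \<delta> \<beta>"
proof -
  have "C1_family (U x) (\<lambda>z \<xi>. P z (P x \<xi>)) 1 \<beta>"
    using C1_family_compose[OF U_open C1_family_P C1_family_const_P] \<beta> by simp
  from C1_family_compose[OF U_open C1_family_const_P this]
  have "C1_family (U x) (\<lambda>z \<xi>. P x (P z (P x \<xi>))) 1 \<beta>"
    by simp
  from C1_family_diff[OF U_open C1_family_const_P this]
  have "C1_family (U x) (\<lambda>z \<xi>. proj_gap (P x) (P z) \<xi>) 2 \<beta>"
    by (simp add: proj_gap_def)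
  then show ?thesis
    by (rule C1_family_bound) (rule near_projections.gap_bound[OF near_projections])
qed

text \<open>The value is \<beta>/(1 - \<delta>)^2, the derivative of the geometric series times
  \<beta>. It does not depend on the base point.\<close>

definition Q_const :: real where
  "Q_const = (\<Sum>k. of_nat k * \<delta> ^ (k - 1) * \<beta>)"

lemma Q_const_summable: "summable (\<lambda>k. of_nat k * \<delta> ^ (k - 1) * \<beta>)"
proof -
  have "summable (\<lambda>n. diffs (\<lambda>_. 1) n * \<delta> ^ n)"
    using \<delta> by (intro termdiff_converges[of _ 1]) (auto intro: summable_geometric)
  then have "summable (\<lambda>n. of_nat (Suc n) * \<delta> ^ n * \<beta>)"
    by (intro summable_mult2) (simp add: diffs_def)
  then show ?thesis
    using summable_Suc_iff[of "\<lambda>k. of_nat k * \<delta> ^ (k - 1) * \<beta>"] by simp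
qed

lemma Q_const_nonneg: "0 \<le> Q_const"
  unfolding Q_const_def using \<delta> \<beta> by (intro suminf_nonneg Q_const_summable) simp

text \<open>Since the coefficients are at most 1, the k-th term has bound \<delta>^k and derivative
  bound k \<delta>^(k-1) \<beta>; both series converge, so the sum is a family with these total
  bounds.\<close>

lemma C1_family_Q: "C1_family (U x) (Q x) (1 / (1 - \<delta>)) Q_const"
proof -
  have "C1_family (U x) (\<lambda>z \<xi>. isqrt_coeff k *\<^sub>R (proj_gap (P x) (P z) ^^ k) \<xi>) (\<delta> ^ k) (of_nat k * \<delta> ^ (k - 1) * \<beta>)" for k
  proof -
    have "norm (isqrt_coeff k *\<^sub>R \<xi>) \<le> 1 * norm \<xi>" for \<xi> :: 'h
      using isqrt_coeff_nonneg[of k] isqrt_coeff_le_1[of k] by (simp add: mult_left_le_one_le)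
    from C1_family_const[OF bounded_linear_scaleR_right this]
    have "C1_family (U x) (\<lambda>z \<xi> :: 'h. isqrt_coeff k *\<^sub>R \<xi>) 1 0" .
    from C1_family_compose[OF U_open this C1_family_funpow[OF U_open C1_family_gap \<delta>(1) \<beta>]]
    show ?thesis by simp
  qed
  from C1_family_series[OF U_open this _ Q_const_summable]
  have "C1_family (U x) (\<lambda>z \<xi>. \<Sum>k. isqrt_coeff k *\<^sub>R (proj_gap (P x) (P z) ^^ k) \<xi>) (\<Sum>k. \<delta> ^ k) Q_const"
    using \<delta> by (simp add: summable_geometric Q_const_def)
  moreover have "(\<Sum>k. \<delta> ^ k) = 1 / (1 - \<delta>)"
    using \<delta> by (simp add: suminf_geometric)
  ultimately show ?thesis
    by (simp add: Q_def[abs_def] proj_isqrt_def isqrt_series_def[abs_def])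
qed

section \<open>Topology of the total space and equivalence of the fibres\<close>

definition total_over :: "'m \<Rightarrow> ('m \<times> 'h) set" where
  "total_over x = im_total P \<inter> {p. fst p \<in> U x}"

lemma mem_im_total: "(y, \<xi>) \<in> im_total P \<longleftrightarrow> \<xi> \<in> S y"
  by (simp add: im_total_def)

text \<open>Both directions are restrictions of maps defined for all vectors of the Hilbert space,
  by families of class \<open>C1_family\<close>; joint continuity of these gives continuity for the
  topologies induced by the product.\<close>

lemma im_triv_homeomorphism:
  "homeomorphism (total_over x) (U x \<times> S x) (im_triv P x) (\<lambda>(y, \<eta>). (y, P y (Q x y \<eta>)))"
proof (rule homeomorphismI)
  have "C1_family (U x) (\<lambda>z \<xi>. Q x z (P x \<xi>)) (1 / (1 - \<delta>) * 1) (1 / (1 - \<delta>) * 0 + Q_const * 1)"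
    by (rule C1_family_compose[OF U_open C1_family_Q C1_family_const_P]) (use \<delta> Q_const_nonneg in auto)
  then have "continuous_on (total_over x) (\<lambda>(z, \<xi>). Q x z (P x \<xi>))"
    by (rule continuous_on_subset[OF C1_family_continuous_on[OF U_open]]) (auto simp: total_over_def)
  then have "continuous_on (total_over x) (\<lambda>p. (fst p, (\<lambda>(z, \<xi>). Q x z (P x \<xi>)) p))"
    by (intro continuous_intros)
  then show "continuous_on (total_over x) (im_triv P x)"
    by (rule continuous_on_eq) (auto simp: total_over_def mem_im_total im_triv_eq)
  have "C1_family (U x) (\<lambda>z \<xi>. P z (Q x z \<xi>)) (1 * (1 / (1 - \<delta>))) (1 * Q_const + \<beta> * (1 / (1 - \<delta>)))"
    by (rule C1_family_compose[OF U_open C1_family_P C1_family_Q]) (use \<beta> in auto)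
  then have "continuous_on (U x \<times> S x) (\<lambda>(z, \<xi>). P z (Q x z \<xi>))"
    by (rule continuous_on_subset[OF C1_family_continuous_on[OF U_open]]) auto
  then have "continuous_on (U x \<times> S x) (\<lambda>p. (fst p, (\<lambda>(z, \<xi>). P z (Q x z \<xi>)) p))"
    by (intro continuous_intros)
  then show "continuous_on (U x \<times> S x) (\<lambda>(y, \<eta>). (y, P y (Q x y \<eta>)))"
    by (rule continuous_on_eq) auto
  show "im_triv P x ` total_over x \<subseteq> U x \<times> S x"
    using Q_range by (auto simp: total_over_def mem_im_total im_triv_eq)
  show "(\<lambda>(y, \<eta>). (y, P y (Q x y \<eta>))) ` (U x \<times> S x) \<subseteq> total_over x"
    by (auto simp: total_over_def mem_im_total)
  show "(\<lambda>(y, \<eta>). (y, P y (Q x y \<eta>))) (im_triv P x p) = p" if "p \<in> total_over x" for p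
    using that by (cases p) (auto simp: total_over_def mem_im_total im_triv_eq W_right_inverse)
  show "im_triv P x ((\<lambda>(y, \<eta>). (y, P y (Q x y \<eta>))) q) = q" if "q \<in> U x \<times> S x" for q
    using that W_left_inverse by (auto simp: im_triv_eq)
qed

text \<open>Each trivialization is a homeomorphism of a relatively open part of the total space, so
  generating sets are relatively open. Conversely a relatively open set is the union of its parts
  over the balls, which cover since each contains its centre. The Hausdorff property and continuity
  of the projection are then inherited.\<close>

lemma im_topology_eq: "im_topology U P = top_of_set (im_total P)"
proof -
  let ?B = "{V. V \<subseteq> im_total P \<and>
         (\<exists>x. fst ` V \<subseteq> U x \<and> openin (top_of_set (U x \<times> range (P x))) (im_triv P x ` V))}"
  have over: "openin (top_of_set (im_total P)) (total_over x)" for x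
  proof -
    have "open {p :: 'm \<times> 'h. fst p \<in> U x}"
      using open_vimage_fst[OF U_open[of x]] by (simp add: vimage_def)
    then show ?thesis
      unfolding total_over_def by (rule openin_open_Int)
  qed
  have basic: "openin (top_of_set (im_total P)) V" if VB: "V \<in> ?B" for V
  proof -
    obtain x where V: "V \<subseteq> im_total P" "fst ` V \<subseteq> U x" "openin (top_of_set (U x \<times> S x)) (im_triv P x ` V)"
      using VB by blast
    note hom = im_triv_homeomorphism[of x]
    have sub: "V \<subseteq> total_over x"
      using V by (auto simp: total_over_def)
    have "openin (top_of_set (total_over x)) (total_over x \<inter> im_triv P x -` (im_triv P x ` V))"
      using homeomorphism_image1[OF hom]
      by (intro continuous_openin_preimage[OF homeomorphism_cont1[OF hom] _ V(3)]) blast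
    moreover have "inj_on (im_triv P x) (total_over x)"
      by (rule homeomorphism_inj_on[OF hom])
    then have "im_triv P x q \<in> im_triv P x ` V \<longleftrightarrow> q \<in> V" if "q \<in> total_over x" for q
      using that sub by (rule inj_on_image_mem_iff)
    then have "total_over x \<inter> im_triv P x -` (im_triv P x ` V) = V"
      using sub by blast
    ultimately have "openin (top_of_set (total_over x)) V"
      by simp
    then show ?thesis
      by (rule openin_trans[OF _ over])
  qed
  have "openin (im_topology U P) V \<longleftrightarrow> openin (top_of_set (im_total P)) V" for V
  proof
    assume "openin (im_topology U P) V"
    then have gen: "generate_topology_on ?B V"
      by (simp add: im_topology_def openin_topology_generated_by_iff)
    show "openin (top_of_set (im_total P)) V"
      by (rule generate_topology_on_coarsest[OF istopology_openin _ gen]) (rule basic)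
  next
    assume V: "openin (top_of_set (im_total P)) V"
    have "openin (im_topology U P) (V \<inter> total_over x)" for x
    proof -
      have "openin (top_of_set (total_over x)) (V \<inter> total_over x)"
        using V by (auto simp: openin_open total_over_def)
      then have "openin (top_of_set (U x \<times> S x)) (im_triv P x ` (V \<inter> total_over x))"
        by (rule homeomorphism_imp_open_map[OF im_triv_homeomorphism])
      then have "V \<inter> total_over x \<in> ?B"
        by (auto simp: total_over_def)
      then show ?thesis
        unfolding im_topology_def by (rule topology_generated_by_Basis)
    qed
    then have "openin (im_topology U P) (\<Union>x. V \<inter> total_over x)"
      by (intro openin_Union) auto
    moreover have "(\<Union>x. V \<inter> total_over x) = V"
      using openin_subset[OF V] U_center by (auto simp: total_over_def)
    ultimately show "openin (im_topology U P) V"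
      by simp
  qed
  then show ?thesis
    by (simp add: topology_eq)
qed

text \<open>Over a ball every fibre is unitarily equivalent to that at the centre. Hence the points
  whose fibre is equivalent to the one over \<open>x0\<close>, and those whose fibre is not, both
  form open sets, and connectedness applies.\<close>

lemma fibre_identification_exists: "\<exists>E \<Theta>. fibre_identification P E \<Theta>"
proof -
  fix x0 :: 'm
  define Z where "Z = {x. \<exists>T. unitary_on (S x) (S x0) T}"
  have iff: "y \<in> Z \<longleftrightarrow> x \<in> Z" if "y \<in> U x" for x y
  proof
    show "x \<in> Z" if "y \<in> Z"
      using that unitary_on_compose[OF W_unitary[OF \<open>y \<in> U x\<close>]] unfolding Z_def mem_Collect_eq by meson
    show "y \<in> Z" if "x \<in> Z"
      using that unitary_on_compose[OF W_adjoint_unitary[OF \<open>y \<in> U x\<close>]] unfolding Z_def mem_Collect_eq by meson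
  qed
  have "open Z"
    unfolding open_subopen[of "Z"]
  proof
    show "\<exists>T. open T \<and> x \<in> T \<and> T \<subseteq> Z" if "x \<in> Z" for x
      using that iff by (intro exI[of _ "U x"] conjI U_open U_center subsetI) simp
  qed
  moreover have "open (- Z)"
    unfolding open_subopen[of "- Z"]
  proof
    show "\<exists>T. open T \<and> x \<in> T \<and> T \<subseteq> - Z" if "x \<in> - Z" for x
      using that iff by (intro exI[of _ "U x"] conjI U_open U_center subsetI) simp
  qed
  moreover have "x0 \<in> Z"
    unfolding Z_def using unitary_on_compose[OF W_unitary[OF U_center] W_adjoint_unitary[OF U_center]] by blast
  ultimately have "Z = UNIV"
    using connectedD[OF conn, of Z "- Z"] by blast
  then have "\<exists>\<Theta>. \<forall>x. unitary_on (S x) (S x0) (\<Theta> x)"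
    unfolding Z_def by (intro choice) blast
  then show ?thesis
    using S_closed unfolding fibre_identification_def by blast
qed

section \<open>Transition maps for a common model fibre\<close>

context
  fixes E :: "'h set" and \<Theta> :: "'m \<Rightarrow> 'h \<Rightarrow> 'h"
  assumes id: "fibre_identification P E \<Theta>"
begin

lemma \<Theta>_unitary: "unitary_on (S x) E (\<Theta> x)"
  using id by (simp add: fibre_identification_def)

lemma E_subspace: "complex_vector.subspace E"
  using id by (simp add: fibre_identification_def closed_csubspace_def)

abbreviation \<Theta>inv :: "'m \<Rightarrow> 'h \<Rightarrow> 'h" where
  "\<Theta>inv x \<equiv> inv_into (S x) (\<Theta> x)"

lemma \<Theta>inv_unitary: "unitary_on E (S x) (\<Theta>inv x)"
  by (rule unitary_on_inv_into[OF \<Theta>_unitary S_subspace])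

lemma \<Theta>_mem: "\<xi> \<in> S x \<Longrightarrow> \<Theta> x \<xi> \<in> E" and \<Theta>inv_mem: "\<eta> \<in> E \<Longrightarrow> \<Theta>inv x \<eta> \<in> S x"
  using \<Theta>_unitary[of x] \<Theta>inv_unitary[of x] by (auto simp: unitary_on_def)

lemma \<Theta>inv_\<Theta>: "\<xi> \<in> S x \<Longrightarrow> \<Theta>inv x (\<Theta> x \<xi>) = \<xi>"
  by (rule inv_into_f_f[OF unitary_on_inj[OF \<Theta>_unitary S_subspace]])

lemma \<Theta>_\<Theta>inv: "\<eta> \<in> E \<Longrightarrow> \<Theta> x (\<Theta>inv x \<eta>) = \<eta>"
  using \<Theta>_unitary[of x] by (intro f_inv_into_f) (simp add: unitary_on_def)

text \<open>The identification is linear only on its fibre. Preceded by the projection it becomes a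
  bounded linear map of the whole space, as constant members of a \<open>C1_family\<close> must
  be.\<close>

lemma \<Theta>_P: "bounded_linear (\<lambda>\<xi>. \<Theta> x (P x \<xi>))" "norm (\<Theta> x (P x \<xi>)) \<le> 1 * norm \<xi>"
proof -
  show bd: "norm (\<Theta> x (P x \<xi>)) \<le> 1 * norm \<xi>" for \<xi>
    using unitary_on_norm[OF \<Theta>_unitary, of "P x \<xi>" x] orthogonal_projection_norm[OF proj, of x \<xi>] by simp
  have lin: "clinear_on (S x) (\<Theta> x)"
    using \<Theta>_unitary by (simp add: unitary_on_def)
  show "bounded_linear (\<lambda>\<xi>. \<Theta> x (P x \<xi>))"
  proof (rule bounded_linear_intro[of _ 1])
    show "\<Theta> x (P x (\<xi> + \<eta>)) = \<Theta> x (P x \<xi>) + \<Theta> x (P x \<eta>)" for \<xi> \<eta>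
      using lin by (simp add: linear_add[OF orthogonal_projection_linear[OF proj]] clinear_on_def)
    show "\<Theta> x (P x (a *\<^sub>R \<xi>)) = a *\<^sub>R \<Theta> x (P x \<xi>)" for a \<xi>
      by (simp add: linear_scale[OF orthogonal_projection_linear[OF proj]] clinear_on_scaleR[OF lin])
    show "norm (\<Theta> x (P x \<xi>)) \<le> norm \<xi> * 1" for \<xi>
      using bd[of \<xi>] by simp
  qed
qed

abbreviation \<psi> :: "'m \<Rightarrow> 'm \<times> 'h \<Rightarrow> 'm \<times> 'h" where
  "\<psi> x \<equiv> map_prod id (\<Theta> x) \<circ> im_triv P x"

lemma \<psi>_homeomorphism:
  "homeomorphism (total_over x) (U x \<times> E) (\<psi> x)
     ((\<lambda>(y, \<eta>). (y, P y (Q x y \<eta>))) \<circ> map_prod id (\<Theta>inv x))"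
proof (rule homeomorphism_compose[OF im_triv_homeomorphism])
  show "homeomorphism (U x \<times> S x) (U x \<times> E) (map_prod id (\<Theta> x)) (map_prod id (\<Theta>inv x))"
  proof (rule homeomorphismI)
    have "continuous_on (U x \<times> S x) (\<lambda>p. (fst p, \<Theta> x (snd p)))"
      by (intro continuous_intros continuous_on_compose2[OF unitary_on_continuous[OF \<Theta>_unitary S_subspace]]) auto
    then show "continuous_on (U x \<times> S x) (map_prod id (\<Theta> x))"
      by (rule continuous_on_eq) auto
    have "continuous_on (U x \<times> E) (\<lambda>p. (fst p, \<Theta>inv x (snd p)))"
      by (intro continuous_intros continuous_on_compose2[OF unitary_on_continuous[OF \<Theta>inv_unitary E_subspace]]) auto
    then show "continuous_on (U x \<times> E) (map_prod id (\<Theta>inv x))"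
      by (rule continuous_on_eq) auto
  qed (auto simp: \<Theta>_mem \<Theta>inv_mem \<Theta>inv_\<Theta> \<Theta>_\<Theta>inv)
qed

abbreviation \<tau> :: "'m \<Rightarrow> 'm \<Rightarrow> 'm \<Rightarrow> 'h \<Rightarrow> 'h" where
  "\<tau> \<equiv> transition (top_of_set (im_total P)) fst U \<psi>"

text \<open>The outer \<open>P x\<close> acts as the identity here, since its argument lies in the
  fibre; it is written so that the right-hand side, apart from \<open>\<Theta>inv y\<close>, is an
  operator family on all of the Hilbert space.\<close>

lemma transition_eq:
  assumes z: "z \<in> U x \<inter> U y" and \<eta>: "\<eta> \<in> E"
  shows "\<tau> x y z \<eta> = \<Theta> x (P x (Q x z (P x (P z (Q y z (\<Theta>inv y \<eta>))))))"
proof -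
  have over: "{p \<in> topspace (top_of_set (im_total P)). fst p \<in> U y} = total_over y"
    by (auto simp: total_over_def)
  let ?p = "(z, P z (Q y z (\<Theta>inv y \<eta>)))"
  have "inv_into (total_over y) (\<psi> y) (z, \<eta>) = ?p"
  proof (rule inv_into_f_eq)
    show "inj_on (\<psi> y) (total_over y)"
      by (rule homeomorphism_inj_on[OF \<psi>_homeomorphism])
    show "?p \<in> total_over y"
      using z by (auto simp: total_over_def mem_im_total)
    show "\<psi> y ?p = (z, \<eta>)"
      using homeomorphism_apply2[OF \<psi>_homeomorphism[of y], of "(z, \<eta>)"] z \<eta> by simp
  qed
  moreover have "Q x z (P x (P z (Q y z (\<Theta>inv y \<eta>)))) \<in> S x"
    using z by (intro Q_range) auto
  ultimately show ?thesis
    unfolding transition_def over using z by (simp add: im_triv_eq P_range)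
qed

text \<open>The Leibniz bound for the derivative of the product of \<open>Q x z\<close>,
  \<open>P z\<close> and \<open>Q y z\<close>: operators \<open>Q\<close> are bounded by 1/(1 -
  \<delta>), their derivatives by \<open>Q_const\<close>, and that of \<open>P\<close> by \<beta>.
  Neither base point occurs in it.\<close>

definition \<tau>_const :: real where
  "\<tau>_const = 1 / (1 - \<delta>) * (Q_const + \<beta> * (1 / (1 - \<delta>))) + Q_const * (1 / (1 - \<delta>))"

lemma C1_family_transition:
  "\<exists>K. C1_family (U x \<inter> U y) (\<lambda>z \<xi>. \<Theta> x (P x (Q x z (P x (P z (Q y z \<xi>)))))) K \<tau>_const"
proof -
  let ?D = "U x \<inter> U y" and ?K = "1 / (1 - \<delta>)"
  have D: "open ?D"
    by (intro open_Int U_open)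
  have mono: "C1_family ?D F K L" if "C1_family D' F K L" "?D \<subseteq> D'" for F :: "'m \<Rightarrow> 'h \<Rightarrow> 'h" and K L D'
    using that C1_on_subset unfolding C1_family_def by blast
  have K: "0 \<le> ?K"
    using \<delta> by simp
  note Qx = mono[OF C1_family_Q[of x] Int_lower1] and Qy = mono[OF C1_family_Q[of y] Int_lower2]
  have 1: "C1_family ?D (\<lambda>z \<xi>. P z (Q y z \<xi>)) ?K (Q_const + \<beta> * ?K)"
    using C1_family_compose[OF D C1_family_P Qy] \<beta> by simp
  have 2: "C1_family ?D (\<lambda>z \<xi>. P x (P z (Q y z \<xi>))) ?K (Q_const + \<beta> * ?K)"
    using C1_family_compose[OF D C1_family_const_P 1] by simp
  have 3: "C1_family ?D (\<lambda>z \<xi>. Q x z (P x (P z (Q y z \<xi>)))) (?K * ?K) (?K * (Q_const + \<beta> * ?K) + Q_const * ?K)"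
    by (rule C1_family_compose[OF D Qx 2 K Q_const_nonneg])
  have 4: "C1_family ?D (\<lambda>z \<xi>. \<Theta> x (P x (Q x z (P x (P z (Q y z \<xi>)))))) (?K * ?K) (?K * (Q_const + \<beta> * ?K) + Q_const * ?K)"
    using C1_family_compose[OF D C1_family_const[OF \<Theta>_P] 3] by simp
  show ?thesis
    using 4 unfolding \<tau>_const_def by blast
qed

text \<open>For fixed \<eta> the vector \<open>\<Theta>inv y \<eta>\<close> does not depend on z and
  has the norm of \<eta>, so the bounds of the extended family carry over. Unitarity comes from the
  factorization into an inverse identification, W_y(z), the adjoint of W_x(z), and an
  identification.\<close>

lemma transition_bounds:
  shows "strongly_differentiable_on A (U x \<inter> U y) E (\<tau> x y)"
    and "z \<in> U x \<inter> U y \<Longrightarrow> unitary_on E E (\<tau> x y z)"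
    and "z \<in> U x \<inter> U y \<Longrightarrow> strong_deriv_norm A e E (\<tau> x y) z \<le> ennreal \<tau>_const"
proof -
  let ?D = "U x \<inter> U y"
  let ?F = "\<lambda>z \<xi>. \<Theta> x (P x (Q x z (P x (P z (Q y z \<xi>)))))"
  have D: "open ?D"
    by (intro open_Int U_open)
  obtain K where F: "C1_family ?D ?F K \<tau>_const"
    using C1_family_transition by blast
  show "strongly_differentiable_on A ?D E (\<tau> x y)"
    unfolding strongly_differentiable_on_iff
  proof
    fix \<eta> assume "\<eta> \<in> E"
    show "C1_on ?D (\<lambda>z. \<tau> x y z \<eta>)"
      using C1_on_cong[OF D, of "\<lambda>z. \<tau> x y z \<eta>" "\<lambda>z. ?F z (\<Theta>inv y \<eta>)"] transition_eq[OF _ \<open>\<eta> \<in> E\<close>]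
        C1_familyD(3)[OF F] by blast
  qed
  assume z: "z \<in> ?D"
  have "unitary_on E E (\<Theta> x \<circ> ((\<lambda>\<xi>. Q x z (P x \<xi>)) \<circ> ((\<lambda>\<eta>. P z (Q y z \<eta>)) \<circ> \<Theta>inv y)))"
    using z by (intro unitary_on_compose[OF _ \<Theta>_unitary] unitary_on_compose[OF _ W_adjoint_unitary]
        unitary_on_compose[OF \<Theta>inv_unitary W_unitary]) auto
  then show "unitary_on E E (\<tau> x y z)"
  proof (rule unitary_on_cong[OF _ E_subspace])
    fix \<eta> assume "\<eta> \<in> E"
    have "Q x z (P x (P z (Q y z (\<Theta>inv y \<eta>)))) \<in> S x"
      using z by (intro Q_range) auto
    then show "\<tau> x y z \<eta> = (\<Theta> x \<circ> ((\<lambda>\<xi>. Q x z (P x \<xi>)) \<circ> ((\<lambda>\<eta>. P z (Q y z \<eta>)) \<circ> \<Theta>inv y))) \<eta>"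
      unfolding transition_eq[OF z \<open>\<eta> \<in> E\<close>] by (simp add: P_range)
  qed
  show "strong_deriv_norm A e E (\<tau> x y) z \<le> ennreal \<tau>_const"
    unfolding strong_deriv_norm_def op_norm_def
  proof (rule SUP_least)
    fix \<eta> assume "\<eta> \<in> {v \<in> E. norm v \<le> 1}"
    then have \<eta>: "\<eta> \<in> E" "norm \<eta> \<le> 1"
      by simp_all
    have "mderiv A (\<lambda>z. \<tau> x y z \<eta>) z = mderiv A (\<lambda>z. ?F z (\<Theta>inv y \<eta>)) z"
      by (rule mderiv_cong[OF D z transition_eq[OF _ \<eta>(1)]])
    then have "cotensor_norm e z (strong_deriv A (\<tau> x y) z \<eta>) \<le> \<tau>_const * norm (\<Theta>inv y \<eta>)"
      unfolding strong_deriv_def using C1_familyD(4)[OF F z] by simp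
    also have "norm (\<Theta>inv y \<eta>) = norm \<eta>"
      by (rule unitary_on_norm[OF \<Theta>inv_unitary \<eta>(1)])
    also have "\<tau>_const * norm \<eta> \<le> \<tau>_const * 1"
      using \<delta> \<beta> Q_const_nonneg \<eta>(2) by (intro mult_left_mono) (simp_all add: \<tau>_const_def)
    also have "\<dots> = \<tau>_const"
      by simp
    finally show "ennreal (cotensor_norm e z (strong_deriv A (\<tau> x y) z \<eta>)) \<le> ennreal \<tau>_const"
      by (rule ennreal_leI)
  qed
qed

lemma hilbert_bundle:
  assumes sep: "separable_space (euclidean :: 'h topology)"
  shows "hilbert_bundle_bounded_geometry A g e r (im_topology U P) fst E \<psi>"
proof -
  \<comment> \<open>The model fibre is a continuous image of the whole separable space, by a
    projection followed by an identification.\<close>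
  have "separable_space (top_of_set E)"
  proof (rule separable_space_continuous_map_image[OF sep])
    fix x0
    show "continuous_map euclidean (top_of_set E) (\<lambda>\<xi>. \<Theta> x0 (P x0 \<xi>))"
      using linear_continuous_on[OF \<Theta>_P(1)] \<Theta>_mem by (simp add: continuous_map_in_subtopology)
    show "(\<lambda>\<xi>. \<Theta> x0 (P x0 \<xi>)) ` topspace euclidean = topspace (top_of_set E)"
      using \<Theta>_unitary[of x0] by (simp add: unitary_on_def image_image[symmetric])
  qed
  moreover have "Hausdorff_space (top_of_set (im_total P))"
    by (intro Hausdorff_space_subtopology Hausdorff_space_t2)
  moreover have "continuous_map (top_of_set (im_total P)) euclidean fst"
    by (simp add: continuous_on_fst)
  moreover have "x \<in> fst ` topspace (top_of_set (im_total P))" for x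
    by (rule image_eqI[of _ _ "(x, P x 0)"]) (simp_all add: mem_im_total)
  then have "fst ` topspace (top_of_set (im_total P)) = UNIV"
    by blast
  moreover have "homeomorphic_map (subtopology (top_of_set (im_total P))
      {p \<in> topspace (top_of_set (im_total P)). fst p \<in> U x}) (top_of_set (U x \<times> E)) (\<psi> x)" for x
  proof -
    have eq: "subtopology (top_of_set (im_total P)) {p \<in> topspace (top_of_set (im_total P)). fst p \<in> U x}
        = top_of_set (total_over x)"
      unfolding subtopology_subtopology total_over_def by (rule arg_cong[of _ _ top_of_set]) auto
    show ?thesis
      unfolding eq homeomorphic_map_maps homeomorphic_maps_def
      using \<psi>_homeomorphism[of x] unfolding homeomorphism_def
      by (intro exI[of _ "(\<lambda>(y, \<eta>). (y, P y (Q x y \<eta>))) \<circ> map_prod id (\<Theta>inv x)"]) (auto simp only: continuous_map_subtopology_eu topspace_euclidean_subtopology)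
  qed
  moreover have "fst (\<psi> x p) = fst p" for x p
    by (simp add: im_triv_def case_prod_beta)
  moreover have "(SUP x. SUP y. SUP z \<in> U x \<inter> U y. strong_deriv_norm A e E (\<tau> x y) z) < \<infinity>"
  proof -
    have "(SUP x. SUP y. SUP z \<in> U x \<inter> U y. strong_deriv_norm A e E (\<tau> x y) z) \<le> ennreal \<tau>_const"
      by (intro SUP_least transition_bounds(3))
    then show ?thesis
      by (rule order_le_less_trans) simp
  qed
  ultimately show ?thesis
    using bgc transition_bounds(1,2) id
    unfolding hilbert_bundle_bounded_geometry_def Let_def im_topology_eq
    by (simp add: fibre_identification_def)
qed

end

end

section \<open>From the hypotheses to the constants of the bundle construction\<close>

lemma (in riemannian_manifold) strong_deriv_norm_bound:
  assumes smooth: "strongly_differentiable_on A UNIV UNIV F" and lin: "\<And>z. linear (F z)"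
    and bound: "strong_deriv_norm A e UNIV F z \<le> ennreal \<beta>" and \<beta>: "0 \<le> \<beta>"
  shows "cotensor_norm e z (mderiv A (\<lambda>y. F y \<xi>) z) \<le> \<beta> * norm \<xi>"
proof -
  have C1: "C1_on UNIV (\<lambda>y. F y \<xi>)" for \<xi>
    using smooth by (simp add: strongly_differentiable_on_iff)
  have "mderiv A (\<lambda>y. F y (a *\<^sub>R \<xi>)) z = (\<lambda>v. a *\<^sub>R mderiv A (\<lambda>y. F y \<xi>) z v)" for a
    using mderiv_scaleR[OF C1_on_mdiff[OF C1[of \<xi>] UNIV_I], of a z] by (simp add: linear_scale[OF lin])
  then have hom: "cotensor_norm e z (strong_deriv A F z (a *\<^sub>R \<xi>)) = \<bar>a\<bar> * cotensor_norm e z (strong_deriv A F z \<xi>)" for a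
    by (simp add: strong_deriv_def cotensor_norm_L2 L2_set_right_distrib)
  show ?thesis
    unfolding strong_deriv_def[symmetric]
    by (rule op_norm_le_imp[where S = UNIV and f = "strong_deriv A F z"])
       (use bound \<beta> hom in \<open>auto simp: strong_deriv_norm_def\<close>)
qed

theorem theorem5p1:
  fixes A :: "('m::{t2_space, second_countable_topology}, 'n::finite) chart set"
    and g :: "('m, 'n) metric"
    and e :: "'m \<Rightarrow> 'n \<Rightarrow> real ^ 'n"
    and P :: "'m \<Rightarrow> 'h::complex_hilbert_space \<Rightarrow> 'h"
    and s r :: real
  assumes "connected (UNIV :: 'm set)" and "smooth_atlas A" and "riemannian_metric A g"
    and "orthonormal_frame g e"
    and "bounded_geometry_conditions A g e s"
    and "separable_space (euclidean :: 'h topology)"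
    and "\<nexists>B :: 'h set. finite B \<and> complex_vector.span B = UNIV"
    and "\<And>x. orthogonal_projection (P x)"
    and "strongly_differentiable_on A UNIV UNIV P"
    and "(SUP x. strong_deriv_norm A e UNIV P x) < \<infinity>"
    and "0 < r" and "r < s"
    and "4 * ennreal r * (SUP x. ennreal_sqrt (metric_matrix_norm A g e s x))
           * (SUP x. strong_deriv_norm A e UNIV P x) < 1"
  shows "topspace (im_topology (\<lambda>x. geod_ball A g x r) P) = im_total P \<and>
    (\<exists>E \<Theta>. fibre_identification P E \<Theta>) \<and>
    (\<forall>E \<Theta>. fibre_identification P E \<Theta> \<longrightarrow>
       hilbert_bundle_bounded_geometry A g e r
         (im_topology (\<lambda>x. geod_ball A g x r) P) fst E
         (\<lambda>x. map_prod id (\<Theta> x) \<circ> im_triv P x))"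
proof -
  interpret riemannian_manifold A g e
    using assms(2-4) by unfold_locales
  note bgc = assms(5) and r = \<open>0 < r\<close> \<open>r < s\<close>
  define a where "a = (SUP x. ennreal_sqrt (metric_matrix_norm A g e s x))"
  define b where "b = (SUP x. strong_deriv_norm A e UNIV P x)"
  define \<beta> where "\<beta> = enn2real b"
  have b: "b = ennreal \<beta>" and \<beta>: "0 \<le> \<beta>"
    using assms(10) by (simp_all add: \<beta>_def b_def[symmetric] less_top)
  have small: "4 * ennreal r * a * b < 1"
    using assms(13) by (simp add: a_def b_def)
  have P_deriv: "cotensor_norm e z (mderiv A (\<lambda>y. P y \<xi>) z) \<le> \<beta> * norm \<xi>" for z \<xi>
  proof (rule strong_deriv_norm_bound[OF assms(9) orthogonal_projection_linear[OF assms(8)] _ \<beta>])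
    show "strong_deriv_norm A e UNIV P z \<le> ennreal \<beta>"
      unfolding b[symmetric] b_def by (rule SUP_upper) simp
  qed
  \<comment> \<open>A real \<alpha> is wanted that bounds the differentials of all normal
    parametrizations and makes the product with r and \<beta> small. The supremum over the metric
    matrices provides it only when it is finite.\<close>
  obtain \<alpha> where \<alpha>: "0 \<le> \<alpha>" "r * \<alpha> * \<beta> < 1 / 4"
    "\<And>x v h. v \<in> ball 0 s \<Longrightarrow>
      metric_norm g (normal_param A g e x v) (pderiv A (normal_param A g e x) v h) \<le> \<alpha> * norm h"
  \<comment> \<open>For \<beta> = 0 the hypothesis holds even if \<open>a\<close> is infinite,
    because infinity times 0 is 0 in \<open>ennreal\<close>. Then any finite \<alpha> does, and
    bounded geometry supplies one; the absolute value makes it nonnegative.\<close>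
  proof (cases "\<beta> = 0")
    case True
    obtain C where C: "\<And>x v h. v \<in> ball 0 s \<Longrightarrow>
        metric_norm g (normal_param A g e x v) (pderiv A (normal_param A g e x) v h) \<le> C * norm h"
      by (rule pderiv_normal_param_bounded[OF bgc]) blast
    have "metric_norm g (normal_param A g e x v) (pderiv A (normal_param A g e x) v h) \<le> \<bar>C\<bar> * norm h"
      if "v \<in> ball 0 s" for x v h
      using C[OF that] mult_right_mono[OF abs_ge_self[of C] norm_ge_zero[of h]] by (rule order_trans)
    with True show thesis
      by (intro that[of "\<bar>C\<bar>"]) simp_all
  next
    case False
    then have "0 < \<beta>"
      using \<beta> by simp
    \<comment> \<open>With positive \<beta> and r, an infinite factor would make the whole product
      infinite, so the inequality can be moved to the reals.\<close>
    have "a \<noteq> \<infinity>"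
    proof
      assume "a = \<infinity>"
      then have "4 * ennreal r * a * b = \<infinity>"
        using r(1) \<open>0 < \<beta>\<close> by (simp add: b ennreal_mult_top ennreal_top_mult)
      with small show False
        by simp
    qed
    then have a: "a = ennreal (enn2real a)"
      by (simp add: less_top)
    have "4 * ennreal r * a * b = ennreal (4 * r * enn2real a * \<beta>)"
      using r(1) \<beta> by (subst a) (simp add: b ennreal_mult)
    with small have "4 * r * enn2real a * \<beta> < 1"
      by (simp add: ennreal_less_one_iff)
    moreover have le: "ennreal_sqrt (metric_matrix_norm A g e s x) \<le> a" for x
      unfolding a_def by (rule SUP_upper) simp
    have "ennreal_sqrt (metric_matrix_norm A g e s x) \<le> ennreal (enn2real a)" for x
      unfolding a[symmetric] by (rule le)
    from pderiv_normal_param_metric_matrix[OF bgc _ this]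
    have "metric_norm g (normal_param A g e x v) (pderiv A (normal_param A g e x) v h) \<le> enn2real a * norm h"
      if "v \<in> ball 0 s" for x v h
      using that by simp
    ultimately show thesis
      by (intro that[of "enn2real a"]) simp_all
  qed
  have near: "norm (P x \<xi> - P y \<xi>) \<le> r * \<alpha> * \<beta> * norm \<xi>" if y: "y \<in> geod_ball A g x r" for x y \<xi>
  proof -
    obtain v where v: "v \<in> ball 0 r" "y = normal_param A g e x v"
      using y unfolding geod_ball_eq by blast
    then have vs: "v \<in> ball 0 s"
      using r by simp
    have C1: "C1_on UNIV (\<lambda>z. P z \<xi>)"
      using assms(9) by (simp add: strongly_differentiable_on_iff)
    \<comment> \<open>The estimate is made for each vector separately, since only the functions z
      \<mapsto> P(z) \<xi> are differentiable; linearity of the bound in the norm of \<xi> gives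
      operator nearness with \<delta> = r \<alpha> \<beta>.\<close>
    have "norm (P y \<xi> - P x \<xi>) \<le> \<beta> * norm \<xi> * \<alpha> * norm v"
      unfolding v(2) by (rule radial_bound[OF bgc C1 P_deriv \<alpha>(3) vs])
    also have "\<dots> \<le> \<beta> * norm \<xi> * \<alpha> * r"
      using v(1) \<beta> \<alpha>(1) by (intro mult_left_mono) simp_all
    finally show ?thesis
      by (simp add: norm_minus_commute mult_ac)
  qed
  interpret projection_bundle A g e P r "r * \<alpha> * \<beta>" \<beta>
  proof
    show "0 \<le> r * \<alpha> * \<beta>" "r * \<alpha> * \<beta> < 1 / 2"
      using r(1) \<alpha>(1,2) \<beta> by simp_all
    show "open (geod_ball A g x r)" "x \<in> geod_ball A g x r" for x
      using geod_ball_open[OF bgc] center_mem_geod_ball[OF bgc] r by simp_all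
    show "bounded_geometry_conditions A g e r"
      using bounded_geometry_conditions_smaller[OF bgc] r by simp
  qed (fact assms(1) assms(8) assms(9) P_deriv \<beta> near)+
  show ?thesis
    using fibre_identification_exists hilbert_bundle[OF _ assms(6)]
    by (simp add: im_topology_eq)
qed

end
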